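(* Let $M>0$. Then there exists a constant $C=C(M)>0$ such that $$\|\xi\|_{H^1}\le C\big\|\big(\lambda-P(\mathbb A(f))^*\big)[\xi]\big\|_{H^1}$$ for all $\lambda\in\mathbb R$ with $|\lambda|\ge1$, all $\xi\in\widehat H^1(\mathbb S)$, and all $f\in H^2(\mathbb S)$ with $\|f\|_{H^2}\le M$. In particular, for each $f\in H^2(\mathbb S)$ the set $\{\lambda\in\mathbb R:|\lambda|\ge1\}$ is contained in the resolvent set of $P(\mathbb A(f))^*\in\mathcal L(\widehat H^1(\mathbb S))$.
   Context: $\mathbb S:=\mathbb R/2\pi\mathbb Z$; functions on $\mathbb S$ are $2\pi$-periodic on $\mathbb R$; $H^r(\mathbb S)$ periodic Sobolev spaces; $\widehat H^r(\mathbb S):=\{h\in H^r(\mathbb S):\int_{-\pi}^\pi h=0\}$, $\widehat L_2=\widehat H^0$; $P:L_2(\mathbb S)\to\widehat L_2(\mathbb S)$, $Ph:=h-\frac1{2\pi}\int_{-\pi}^\pi h\,dx$, is the orthogonal projection. Notation: $'=\partial_x$, $\delta_{[x,s]}f:=f(x)-f(x-s)$, $T_{[x,s]}f:=\tanh(\delta_{[x,s]}f/2)$, $t_{[s]}:=\tan(s/2)$, $\mathrm{PV}$ = principal value at $s=0$. For $f\in H^2(\mathbb S)$ let $\mathbb A(f)[\overline\omega](x):=\frac1{2\pi}\mathrm{PV}\int_{-\pi}^{\pi}\frac{f'(x)t_{[s]}[1-(T_{[x,s]}f)^2]-(1+t_{[s]}^2)T_{[x,s]}f}{t_{[s]}^2+(T_{[x,s]}f)^2}\overline\omega(x-s)\,ds$,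 a bounded operator on $L_2(\mathbb S)$, and let $(\mathbb A(f))^*\in\mathcal L(L_2(\mathbb S))$ be its $L_2$-adjoint (the double layer potential), given by $$(\mathbb A(f))^*[\xi](x)=\frac1{2\pi}\mathrm{PV}\!\int_{-\pi}^{\pi}\frac{(1+t_{[s]}^2)T_{[x,s]}f-f'(x-s)t_{[s]}[1-(T_{[x,s]}f)^2]}{t_{[s]}^2+(T_{[x,s]}f)^2}\,\xi(x-s)\,ds.$$ $P(\mathbb A(f))^*$ is the adjoint of $\mathbb A(f)|_{\widehat L_2(\mathbb S)}\in\mathcal L(\widehat L_2(\mathbb S))$. *)

theory Defs
  imports "HOL-Analysis.Analysis"
begin

text \<open>Functions on the circle S = R/2piZ are modelled as 2pi-periodic functions
  real => real. Integrals over S are Lebesgue integrals over [-pi, pi].\<close>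

definition periodic2pi :: "(real \<Rightarrow> real) \<Rightarrow> bool" where
  "periodic2pi h \<longleftrightarrow> (\<forall>x. h (x + 2 * pi) = h x)"

definition in_L2 :: "(real \<Rightarrow> real) \<Rightarrow> bool" where
  "in_L2 h \<longleftrightarrow> h \<in> borel_measurable lborel \<and>
     set_integrable lborel {-pi..pi} (\<lambda>x. (h x)\<^sup>2)"

definition fourier_coeff :: "(real \<Rightarrow> real) \<Rightarrow> int \<Rightarrow> complex" where
  "fourier_coeff h k = (1 / (2 * pi)) *
     (LINT x:{-pi..pi}|lborel. complex_of_real (h x) * cis (- (of_int k * x)))"

definition sob_weight :: "nat \<Rightarrow> (real \<Rightarrow> real) \<Rightarrow> int \<Rightarrow> real" where
  "sob_weight r h k = (1 + (real_of_int k)\<^sup>2) ^ r * (cmod (fourier_coeff h k))\<^sup>2"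

definition Hs :: "nat \<Rightarrow> (real \<Rightarrow> real) set" where
  "Hs r = {h. periodic2pi h \<and> in_L2 h \<and> (sob_weight r h) summable_on UNIV}"

definition Hs_norm :: "nat \<Rightarrow> (real \<Rightarrow> real) \<Rightarrow> real" where
  "Hs_norm r h = sqrt (2 * pi * (\<Sum>\<^sub>\<infinity>k\<in>UNIV. sob_weight r h k))"

definition Hhat :: "nat \<Rightarrow> (real \<Rightarrow> real) set" where
  "Hhat r = {h \<in> Hs r. (LINT x:{-pi..pi}|lborel. h x) = 0}"

definition Pproj :: "(real \<Rightarrow> real) \<Rightarrow> real \<Rightarrow> real" where
  "Pproj h = (\<lambda>x. h x - (1 / (2 * pi)) * (LINT y:{-pi..pi}|lborel. h y))"

text \<open>Kernel of the double layer potential (A(f))^*.\<close>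
definition Astar_kernel :: "(real \<Rightarrow> real) \<Rightarrow> real \<Rightarrow> real \<Rightarrow> real" where
  "Astar_kernel f x s =
     (let t = tan (s / 2); T = tanh ((f x - f (x - s)) / 2) in
      ((1 + t\<^sup>2) * T - deriv f (x - s) * t * (1 - T\<^sup>2)) / (t\<^sup>2 + T\<^sup>2))"

definition Astar :: "(real \<Rightarrow> real) \<Rightarrow> (real \<Rightarrow> real) \<Rightarrow> real \<Rightarrow> real" where
  "Astar f \<xi> x = (1 / (2 * pi)) *
     Lim (at_right 0) (\<lambda>\<epsilon>. LINT s:{s. \<epsilon> < \<bar>s\<bar> \<and> \<bar>s\<bar> \<le> pi}|lborel.
                             Astar_kernel f x s * \<xi> (x - s))"

definition resolv_op :: "real \<Rightarrow> (real \<Rightarrow> real) \<Rightarrow> (real \<Rightarrow> real) \<Rightarrow> real \<Rightarrow> real" where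
  "resolv_op lam f \<xi> = (\<lambda>x. lam * \<xi> x - Pproj (Astar f \<xi>) x)"

end

theory Submission
  imports Defs
begin

text \<open>Writing $z = x + i f$, the kernel of $\mathbb A(f)^*$ is $\partial_y$ of twice the argument of
  $\sin((z(x) - z(y))/2)$, and the kernel of $\mathbb A(f)$ is $\partial_x$ of it; since $f'$ is
  $1/2$-Hoelder continuous, both are $O(|x-y|^{-1/2})$. Integrating by parts,
  $(\mathbb A(f)^* \xi)' = - \mathbb A(f) \xi'$, so the claim becomes one about
  $\lambda - \mathbb A(f)$ on $\widehat L_2$. For $\omega \in \widehat L_2$ the function
  $\Phi(p) = \int \cot((p - z(y))/2)\, \omega(y)\, dy$ satisfies $\int \Phi^2 dp = 0$ along the graph
  shifted by $\pm i \epsilon$; letting $\epsilon \to 0$ gives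
  $\int (B + i(\mathbb A(f) \omega \mp \omega))^2 / (1 + i f') = 0$ with a real function $B$. The real
  parts of these two Rellich identities bound $\|\omega\|_2$ by $\|(\lambda - \mathbb A(f)) \omega\|_2$
  uniformly in $|\lambda| \ge 1$, and the method of continuity yields surjectivity.\<close>

section \<open>Integration over the circle\<close>

text \<open>The constant may depend on \<open>f\<close> only through \<open>M\<close>, so two roles
  of \<open>f\<close> are kept apart. The Hoelder constant \<open>H\<close> of the derivative only
  makes kernels integrable and operators bounded; the estimate itself sees \<open>f\<close> through
  \<open>m\<close>, a bound for the derivative. The Rellich identities pair \<open>B\<close> with
  \<open>A \<omega> + \<omega>\<close> and with \<open>A \<omega> - \<omega>\<close>. Combined with
  weights (1 - lam)/2 and (1 + lam)/2 they produce (lam - A) \<omega> and a surplus (lam^2 - 1)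
  \<omega>^2, whose sign is where |lam| >= 1 enters. The obstacle is the limit: on the graph the
  cotangent kernel is not absolutely integrable. Subtracting \<open>zd y * \<omega> x\<close>
  removes the singularity when \<omega> is Hoelder continuous, and the subtracted integral is known
  exactly and yields the jump, so no jump theorem for principal values is invoked. Trigonometric
  polynomials are such densities; they are dense, and boundedness of \<open>A\<close> carries the
  estimate to all mean-zero \<omega>. Elements of the spaces are genuine functions rather than
  classes, so linearity of \<open>A\<close> and equality of solutions hold almost
  everywhere.\<close>

abbreviation circ :: "real measure" where
  "circ \<equiv> restrict_space lborel {-pi..pi}"

lemma space_circ [simp]: "space circ = {-pi..pi}"
  by (simp add: space_restrict_space)

lemma integrable_circ_iff:
  fixes h :: "real \<Rightarrow> 'b::{banach, second_countable_topology}"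
  shows "integrable circ h \<longleftrightarrow> set_integrable lborel {-pi..pi} h"
  by (simp add: integrable_restrict_space set_integrable_def)

lemma integral_circ_eq:
  fixes h :: "real \<Rightarrow> 'b::{banach, second_countable_topology}"
  shows "integral\<^sup>L circ h = (LINT x:{-pi..pi}|lborel. h x)"
  by (simp add: integral_restrict_space set_lebesgue_integral_def)

lemma AE_circ_iff: "(AE x in circ. P x) \<longleftrightarrow> (AE x in lborel. x \<in> {-pi..pi} \<longrightarrow> P x)"
  by (simp add: AE_restrict_space_iff)

lemma measurable_circI: "h \<in> borel_measurable borel \<Longrightarrow> h \<in> borel_measurable circ"
  by (simp add: measurable_restrict_space1)

lemma measurable_circ_id: "(\<lambda>x. x) \<in> borel_measurable circ"
  by (rule measurable_circI) simp

lemma emeasure_circ: "emeasure circ {-pi..pi} = ennreal (2 * pi)"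
  by (simp add: emeasure_restrict_space)

interpretation circ: finite_measure circ
  by (rule finite_measureI) (simp add: emeasure_circ)

interpretation circ_circ: pair_sigma_finite circ circ ..

lemma measure_circ [simp]: "measure circ {-pi..pi} = 2 * pi"
  using emeasure_circ by (simp add: measure_def)

lemma integrable_circ_bounded:
  fixes h :: "real \<Rightarrow> 'b::{banach, second_countable_topology}"
  assumes "h \<in> borel_measurable borel" "\<And>x. x \<in> {-pi..pi} \<Longrightarrow> norm (h x) \<le> B"
  shows "integrable circ h"
  by (rule circ.integrable_const_bound[where B=B])
     (use assms in \<open>auto intro!: AE_I2 measurable_circI\<close>)

lemma measurable_circ_pair:
  assumes "F \<in> borel_measurable (borel \<Otimes>\<^sub>M borel)"
  shows "F \<in> borel_measurable (circ \<Otimes>\<^sub>M circ)"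
proof -
  have "(\<lambda>p. F (fst p, snd p)) \<in> borel_measurable (circ \<Otimes>\<^sub>M circ)"
  proof (rule measurable_compose[OF _ assms], rule measurable_Pair)
    show "fst \<in> borel_measurable (circ \<Otimes>\<^sub>M circ)"
by (rule measurable_compose[OF measurable_fst measurable_circ_id])
    show "snd \<in> borel_measurable (circ \<Otimes>\<^sub>M circ)"
by (rule measurable_compose[OF measurable_snd measurable_circ_id])
  qed
  then show ?thesis by simp
qed

text \<open>The exceptional set \<open>S\<close> is there for antiderivatives such as
  \<open>\<Theta>\<close>, which are continuous everywhere but differentiated only off the diagonal.
  Integrability is a hypothesis because the fundamental theorem by itself yields a gauge
  integral.\<close>

lemma set_integral_FTC:
  fixes F :: "real \<Rightarrow> 'b::euclidean_space"
  assumes "a \<le> b" "finite S" "continuous_on {a..b} F"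
    and "\<And>x. x \<in> {a<..<b} - S \<Longrightarrow> (F has_vector_derivative f x) (at x)"
    and "set_integrable lborel {a..b} f"
  shows "(LINT x:{a..b}|lborel. f x) = F b - F a"
proof -
  have "(f has_integral F b - F a) {a..b}"
    by (rule fundamental_theorem_of_calculus_interior_strong[OF assms(2,1)]) (use assms in auto)
  then show ?thesis
    using set_borel_integral_eq_integral(2)[OF assms(5)] by (simp add: integral_unique)
qed

section \<open>Periodic functions, reduction modulo \<open>2 * pi\<close>, and reflections of the
  circle\<close>

lemma periodic2pi_int:
  assumes "\<And>x. h (x + 2 * pi) = h (x::real)"
  shows "h (x + 2 * pi * of_int n) = h x"
proof -
  have nat: "h (x + 2 * pi * of_nat k) = h x" for x k
  proof (induction k)
    case (Suc k)
    have "h (x + 2 * pi * of_nat (Suc k)) = h ((x + 2 * pi * of_nat k) + 2 * pi)"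
      by (simp add: algebra_simps)
    then show ?case using Suc assms by simp
  qed simp
  show ?thesis
  proof (cases "n \<ge> 0")
    case True
    then show ?thesis using nat[of x "nat n"] by simp
  next
    case False
    then show ?thesis using nat[of "x + 2 * pi * of_int n" "nat (-n)"] by (simp add: algebra_simps)
  qed
qed

text \<open>The representative of \<open>x\<close> modulo \<open>2 * pi\<close> in the half-open
  interval from -pi to pi. It turns periodicity into the single equation
  \<open>h (pe x) = h x\<close>.\<close>

definition pe :: "real \<Rightarrow> real" where
  "pe x = x - 2 * pi * of_int \<lfloor>(x + pi) / (2 * pi)\<rfloor>"

lemma pe_bounds: "- pi \<le> pe x" "pe x < pi"
proof -
  have "of_int \<lfloor>(x + pi) / (2 * pi)\<rfloor> \<le> (x + pi) / (2 * pi)" by (rule of_int_floor_le)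
  then have "2 * pi * of_int \<lfloor>(x + pi) / (2 * pi)\<rfloor> \<le> x + pi" by (subst (asm) pos_le_divide_eq) (auto simp: mult_ac)
  then show "- pi \<le> pe x" by (simp add: pe_def)
  have "(x + pi) / (2 * pi) < of_int \<lfloor>(x + pi) / (2 * pi)\<rfloor> + 1" by linarith
  then have "x + pi < 2 * pi * of_int \<lfloor>(x + pi) / (2 * pi)\<rfloor> + 2 * pi" by (subst (asm) pos_divide_less_eq) (auto simp: algebra_simps)
  then show "pe x < pi" by (simp add: pe_def)
qed

lemma pe_measurable [measurable]: "pe \<in> borel_measurable borel"
  unfolding pe_def[abs_def] by measurable

lemma pe_periodic: "pe (x + 2 * pi) = pe x"
proof -
  have "(x + 2 * pi + pi) / (2 * pi) = (x + pi) / (2 * pi) + 1" by (simp add: field_simps)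
  then show ?thesis by (simp add: pe_def algebra_simps)
qed

lemma pe_eq: "- pi \<le> x \<Longrightarrow> x < pi \<Longrightarrow> pe x = x"
proof -
  assume *: "- pi \<le> x" "x < pi"
  have "\<lfloor>(x + pi) / (2 * pi)\<rfloor> = 0"
    by (rule floor_unique) (use * in \<open>auto simp: field_simps\<close>)
  then show ?thesis by (simp add: pe_def)
qed

lemma periodic_pe:
  assumes "\<And>x. h (x + 2 * pi) = h (x::real)"
  shows "h (pe x) = h x"
proof -
  have "x = pe x + 2 * pi * of_int \<lfloor>(x + pi) / (2 * pi)\<rfloor>" by (simp add: pe_def)
  then show ?thesis using periodic2pi_int[of h, OF assms] by metis
qed

lemma AE_neq: "AE x in lborel. x \<noteq> (c::real)"
  by (rule AE_lborel_singleton)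

lemma AE_circ_neq: "AE x in circ. x \<noteq> (c::real)"
  using AE_neq[of c] by (auto simp: AE_circ_iff elim: eventually_mono)

lemma nn_integral_Ico_Icc:
  fixes h :: "real \<Rightarrow> ennreal"
  shows "(\<integral>\<^sup>+y. h y * indicator {a..<b} y \<partial>lborel) = (\<integral>\<^sup>+y. h y * indicator {a..b} y \<partial>lborel)"
  by (rule nn_integral_cong_AE, rule eventually_mono[OF AE_neq[of b]])
     (auto simp: indicator_def)

lemma nn_integral_shift_set:
  fixes h :: "real \<Rightarrow> ennreal"
  assumes [measurable]: "h \<in> borel_measurable borel"
  shows "(\<integral>\<^sup>+y. h y * indicator {a..<b} y \<partial>lborel)
       = (\<integral>\<^sup>+y. h (y + t) * indicator {a - t..<b - t} y \<partial>lborel)"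
proof -
  have "(\<integral>\<^sup>+y. h y * indicator {a..<b} y \<partial>lborel)
      = (\<integral>\<^sup>+y. h (t + 1 * y) * indicator {a..<b} (t + 1 * y) \<partial>lborel)"
    by (subst nn_integral_real_affine[where c=1 and t=t]) auto
  also have "\<dots> = (\<integral>\<^sup>+y. h (y + t) * indicator {a - t..<b - t} y \<partial>lborel)"
    by (rule nn_integral_cong) (auto simp: indicator_def add.commute)
  finally show ?thesis .
qed

text \<open>The window is moved by whole periods until it starts in [-pi, pi), cut at
  \<open>pi\<close>, and the overhanging piece is moved back by one period.\<close>

lemma nn_integral_periodic:
  fixes h :: "real \<Rightarrow> ennreal"
  assumes m [measurable]: "h \<in> borel_measurable borel" and per: "\<And>x. h (x + 2 * pi) = h x"
  shows "(\<integral>\<^sup>+y. h y * indicator {a..<a + 2 * pi} y \<partial>lborel)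
       = (\<integral>\<^sup>+y. h y * indicator {-pi..<pi} y \<partial>lborel)"
proof -
  let ?I = "\<lambda>a b. (\<integral>\<^sup>+y. h y * indicator {a..<b} y \<partial>lborel)"
  have split: "?I a c = ?I a b + ?I b c" if "a \<le> b" "b \<le> c" for a b c
    by (subst nn_integral_add[symmetric]) (use that in \<open>auto intro!: nn_integral_cong simp: indicator_def\<close>)
  have sh: "?I (a + 2 * pi * of_int n) (b + 2 * pi * of_int n) = ?I a b" for a b n
    by (subst nn_integral_shift_set[OF m, of _ _ "2 * pi * of_int n"])
       (simp add: periodic2pi_int[of h, OF per])
  define n where "n = \<lfloor>(a + pi) / (2 * pi)\<rfloor>"
  have a: "a = pe a + 2 * pi * of_int n" by (simp add: pe_def n_def)
  have "?I a (a + 2 * pi) = ?I (pe a) (pe a + 2 * pi)"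
  proof -
    have "a + 2 * pi = pe a + 2 * pi + 2 * pi * of_int n" using a by simp
    then show ?thesis using sh[of "pe a" n "pe a + 2 * pi"] a by metis
  qed
  also have "\<dots> = ?I (pe a) pi + ?I pi (pe a + 2 * pi)"
    by (rule split) (use pe_bounds[of a] in auto)
  also have "?I pi (pe a + 2 * pi) = ?I (-pi) (pe a)"
    using sh[of "-pi" 1 "pe a"] by (simp add: algebra_simps)
  also have "?I (pe a) pi + ?I (-pi) (pe a) = ?I (-pi) pi"
    using split[of "-pi" "pe a" pi] pe_bounds[of a] by (simp add: add.commute)
  finally show ?thesis .
qed

lemma nn_integral_circ_reflect:
  fixes h :: "real \<Rightarrow> ennreal"
  assumes m [measurable]: "h \<in> borel_measurable borel" and per: "\<And>x. h (x + 2 * pi) = h x"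
  shows "(\<integral>\<^sup>+s. h (x - s) \<partial>circ) = (\<integral>\<^sup>+s. h s \<partial>circ)"
proof -
  have "(\<integral>\<^sup>+s. h (x - s) \<partial>circ) = (\<integral>\<^sup>+s. h (x - s) * indicator {-pi..pi} s \<partial>lborel)"
    by (simp add: nn_integral_restrict_space)
  also have "\<dots> = (\<integral>\<^sup>+s. h (x + (-1) * s) * indicator {x - pi..x + pi} (x + (-1) * s) \<partial>lborel)"
    by (rule nn_integral_cong) (auto simp: indicator_def)
  also have "\<dots> = (\<integral>\<^sup>+y. h y * indicator {x - pi..x + pi} y \<partial>lborel)"
    by (subst nn_integral_real_affine[where c="-1" and t=x]) auto
  also have "\<dots> = (\<integral>\<^sup>+y. h y * indicator {-pi..pi} y \<partial>lborel)"
    using nn_integral_periodic[OF m per, of "x - pi"] by (simp add: nn_integral_Ico_Icc add.commute)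
  finally show ?thesis by (simp add: nn_integral_restrict_space)
qed

text \<open>Equality of image measures transfers integrability and vector-valued integrals in one
  stroke, which the version for nonnegative functions does not.\<close>

lemma distr_circ_reflect: "distr circ borel (\<lambda>s. pe (x - s)) = distr circ borel pe"
proof (rule measure_eqI)
  fix A assume "A \<in> sets (distr circ borel (\<lambda>s. pe (x - s)))"
  then have [measurable]: "A \<in> sets borel" by simp
  have [measurable]: "pe \<in> borel_measurable circ"
    by (rule measurable_circI) measurable
  have [measurable]: "(\<lambda>s. pe (x - s)) \<in> borel_measurable circ"
    by (rule measurable_circI) measurable
  have 1: "emeasure (distr circ borel g) A = (\<integral>\<^sup>+s. indicator A (g s) \<partial>circ)"
    if [measurable]: "g \<in> borel_measurable circ" for g
    by (subst nn_integral_indicator[symmetric], simp)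
       (subst nn_integral_distr, auto)
  show "emeasure (distr circ borel (\<lambda>s. pe (x - s))) A = emeasure (distr circ borel pe) A"
    using nn_integral_circ_reflect[of "\<lambda>s. indicator A (pe s)" x] by (simp add: 1 pe_periodic)
qed simp

lemma
  fixes h :: "real \<Rightarrow> 'b::{banach, second_countable_topology}"
  assumes m [measurable]: "h \<in> borel_measurable borel" and per: "\<And>x. h (x + 2 * pi) = h x"
  shows integrable_circ_reflect: "integrable circ (\<lambda>s. h (x - s)) \<longleftrightarrow> integrable circ h"
    and integral_circ_reflect: "integral\<^sup>L circ (\<lambda>s. h (x - s)) = integral\<^sup>L circ h"
proof -
  have [measurable]: "pe \<in> borel_measurable circ"
    by (rule measurable_circI) measurable
  have [measurable]: "(\<lambda>s. pe (x - s)) \<in> borel_measurable circ"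
    by (rule measurable_circI) measurable
  have pp: "h (pe y) = h y" for y by (rule periodic_pe[of h, OF per])
  show "integrable circ (\<lambda>s. h (x - s)) \<longleftrightarrow> integrable circ h"
    using integrable_distr_eq[of "\<lambda>s. pe (x - s)" circ borel h] integrable_distr_eq[of pe circ borel h]
    by (simp add: distr_circ_reflect pp)
  show "integral\<^sup>L circ (\<lambda>s. h (x - s)) = integral\<^sup>L circ h"
    using integral_distr[of "\<lambda>s. pe (x - s)" circ borel h] integral_distr[of pe circ borel h]
    by (simp add: distr_circ_reflect pp)
qed

text \<open>The line is covered by countably many translates of one period, each carrying the same
  null set. Needed because the final statements are about \<open>lborel\<close>, not about
  \<open>circ\<close>.\<close>

lemma AE_periodic:
  fixes h :: "real \<Rightarrow> real"
  assumes m [measurable]: "h \<in> borel_measurable borel" and per: "\<And>x. h (x + 2 * pi) = h x"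
    and ae: "AE x in circ. h x = 0"
  shows "AE x in lborel. h x = 0"
proof -
  have 0: "(\<integral>\<^sup>+y. ennreal \<bar>h y\<bar> * indicator {-pi..<pi} y \<partial>lborel) = 0"
    unfolding nn_integral_Ico_Icc
    by (rule nn_integral_0_iff_AE[THEN iffD2])
       (use ae in \<open>auto simp: AE_circ_iff indicator_def elim!: eventually_mono\<close>)
  have "AE y in lborel. y \<in> {-pi + 2 * pi * of_int k..<-pi + 2 * pi * of_int k + 2 * pi} \<longrightarrow> h y = 0" for k
  proof -
    have "(\<integral>\<^sup>+y. ennreal \<bar>h y\<bar> * indicator {-pi + 2 * pi * of_int k..<-pi + 2 * pi * of_int k + 2 * pi} y \<partial>lborel) = 0"
      using nn_integral_periodic[of "\<lambda>y. ennreal \<bar>h y\<bar>" "-pi + 2 * pi * of_int k"] 0 per by simp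
    then show ?thesis
      by (subst (asm) nn_integral_0_iff_AE) (auto elim!: eventually_mono simp: indicator_def split: if_splits)
  qed
  then have "AE y in lborel. \<forall>k::int. y \<in> {-pi + 2 * pi * of_int k..<-pi + 2 * pi * of_int k + 2 * pi} \<longrightarrow> h y = 0"
    by (intro AE_all_countable[THEN iffD2] allI)
  then show ?thesis
  proof eventually_elim
    case (elim y)
    have "y \<in> {-pi + 2 * pi * of_int \<lfloor>(y + pi) / (2 * pi)\<rfloor>..<-pi + 2 * pi * of_int \<lfloor>(y + pi) / (2 * pi)\<rfloor> + 2 * pi}"
      using pe_bounds[of y] by (auto simp: pe_def)
    then show ?case using elim by blast
  qed
qed

section \<open>The integrable weight |sin(s/2)|^(-1/2)\<close>

lemma sin_ge_half: "0 \<le> u \<Longrightarrow> u \<le> pi / 2 \<Longrightarrow> u / 2 \<le> sin (u::real)"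
proof -
  assume u: "0 \<le> u" "u \<le> pi / 2"
  have c: "concave_on {0..pi} (\<lambda>x::real. sin x)"
    by (rule f''_le0_imp_concave[where f'=cos and f''="\<lambda>x. - sin x"])
       (auto intro!: derivative_eq_intros sin_ge_zero)
  show ?thesis
  proof -
    define t where "t = u / (pi / 2)"
    have t: "0 \<le> t" "t \<le> 1" using u by (auto simp: t_def field_simps)
    \<comment> \<open>The concave sine lies above its chord from 0 to pi/2, whose slope 2/pi exceeds
      1/2 because pi < 4.\<close>
    have "sin ((1 - t) *\<^sub>R 0 + t *\<^sub>R (pi/2)) \<ge> (1 - t) * sin 0 + t * sin (pi/2)"
      using c t by (intro concave_onD[OF c]) auto
    then have "t \<le> sin u" by (simp add: t_def)
    moreover have "u / 2 \<le> t" using u pi_less_4 mult_left_mono[of pi 4 u] by (simp add: t_def field_simps)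
    ultimately show ?thesis by simp
  qed
qed

lemma abs_sin_half_ge: "\<bar>s\<bar> \<le> pi \<Longrightarrow> \<bar>s\<bar> / 4 \<le> \<bar>sin (s / 2)\<bar>"
proof -
  assume s: "\<bar>s\<bar> \<le> pi"
  have "\<bar>s\<bar> / 4 \<le> sin (\<bar>s\<bar> / 2)" using sin_ge_half[of "\<bar>s\<bar>/2"] s by simp
  also have "\<dots> \<le> \<bar>sin (s / 2)\<bar>" by (cases "s \<ge> 0") auto
  finally show ?thesis .
qed

text \<open>Note that \<open>wk 0 = 0\<close>, because \<open>0 powr a = 0\<close>.\<close>

definition wk :: "real \<Rightarrow> real" where "wk s = \<bar>sin (s / 2)\<bar> powr (- 1 / 2)"

lemma wk_nonneg [simp]: "0 \<le> wk s" by (simp add: wk_def)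

lemma wk_periodic: "wk (s + 2 * pi) = wk s"
proof -
  have "sin ((s + 2 * pi) / 2) = - sin (s / 2)" by (simp add: add_divide_distrib sin_periodic_pi)
  then show ?thesis unfolding wk_def by simp
qed

lemma wk_even: "wk (- s) = wk s"
  by (simp add: wk_def)

lemma wk_commute: "wk (x - y) = wk (y - x)"
  using wk_even[of "x - y"] by simp

lemma wk_measurable [measurable]: "wk \<in> borel_measurable borel"
  unfolding wk_def[abs_def] by measurable

text \<open>Since |sin(s/2)| >= |s|/4, the weight is at most 2 |s|^(-1/2); the power is integrable
  from 0, and the negative half follows by reflection.\<close>

lemma integrable_circ_wk0: "integrable circ wk"
proof -
  have m0: "(\<lambda>x. indicator {0..pi} x * (x powr (-1/2))) \<in> borel_measurable borel" by measurable
  have "((\<lambda>x::real. x powr (-1/2)) has_integral (pi powr (-1/2+1) / (-1/2+1))) {0..pi}"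
    by (rule has_integral_powr_from_0) auto
  then have nn0: "(\<integral>\<^sup>+x. ennreal (x powr (-1/2)) * indicator {0..pi} x \<partial>lborel) = ennreal (pi powr (-1/2+1) / (-1/2+1))"
    by (rule nn_integral_has_integral_lebesgue'[rotated]) auto
  have int0: "integrable lborel (\<lambda>x. indicator {0..pi} x * (x powr (-1/2)))"
  proof (rule integrableI_nonneg)
    have "(\<integral>\<^sup>+x. ennreal (indicator {0..pi} x * x powr (-1/2)) \<partial>lborel) = (\<integral>\<^sup>+x. ennreal (x powr (-1/2)) * indicator {0..pi} x \<partial>lborel)"
      by (rule nn_integral_cong) (auto simp: indicator_def)
    then show "(\<integral>\<^sup>+x. ennreal (indicator {0..pi} x * x powr (-1/2)) \<partial>lborel) < \<infinity>" using nn0 by simp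
  qed (use m0 in auto)
  have "integrable lborel (\<lambda>x. indicator {0..pi} (0 + (-1) * x) * ((0 + (-1) * x) powr (-1/2)))"
    by (rule lborel_integrable_real_affine[OF int0]) simp
  with int0 have "integrable lborel (\<lambda>x. 2 * (indicator {0..pi} x * (x powr (-1/2)) + indicator {0..pi} (0 + (-1) * x) * ((0 + (-1) * x) powr (-1/2))))"
    by (intro integrable_mult_right Bochner_Integration.integrable_add)
  then have "integrable lborel (\<lambda>x. indicator {-pi..pi} x *\<^sub>R wk x)"
  proof (rule Bochner_Integration.integrable_bound)
    show "AE x in lborel. norm (indicator {-pi..pi} x *\<^sub>R wk x) \<le> norm (2 * (indicator {0..pi} x * x powr (- 1 / 2) +
                  indicator {0..pi} (0 + - 1 * x) * (0 + - 1 * x) powr (- 1 / 2)))"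
      using AE_neq[of 0]
    proof eventually_elim
      case (elim x)
      show ?case
      proof (cases "x \<in> {-pi..pi}")
        case True
        then have "\<bar>x\<bar> / 4 \<le> \<bar>sin (x / 2)\<bar>" by (intro abs_sin_half_ge) auto
        then have "wk x \<le> (\<bar>x\<bar> / 4) powr (-1/2)"
          unfolding wk_def using elim by (intro powr_mono2') auto
        also have "\<dots> = 2 * \<bar>x\<bar> powr (-1/2)"
        proof -
          have "(4::real) powr (-1/2) = 1 / 2" by (simp add: powr_minus powr_half_sqrt divide_simps)
          moreover have "(\<bar>x\<bar> / 4) powr (-1/2) = \<bar>x\<bar> powr (-1/2) / 4 powr (-1/2)"
            by (rule powr_divide)
          ultimately have "(\<bar>x\<bar> / 4) powr (-1/2) = \<bar>x\<bar> powr (-1/2) / (1 / 2)" by (simp only:)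
          then show ?thesis by simp
        qed
        finally show ?thesis using True elim by (auto simp: indicator_def)
      qed simp
    qed
  qed measurable
  then show ?thesis by (simp add: integrable_circ_iff set_integrable_def)
qed

lemma integrable_circ_wk: "integrable circ (\<lambda>y. wk (x - y))"
  using integrable_circ_reflect[of wk x] wk_periodic integrable_circ_wk0 by simp

lemma integral_circ_wk: "(\<integral>y. wk (x - y) \<partial>circ) = integral\<^sup>L circ wk"
  using integral_circ_reflect[of wk x] wk_periodic by simp

section \<open>Mean-zero square integrable functions and perturbation of operators\<close>

definition L2 :: "(real \<Rightarrow> real) set" where
  "L2 = {h. h \<in> borel_measurable borel \<and> integrable circ (\<lambda>x. (h x)\<^sup>2)}"

text \<open>The squared L2 norm. Working with squares avoids roots, at the price of a factor 2 on
  each term of every triangle inequality.\<close>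

definition qn :: "(real \<Rightarrow> real) \<Rightarrow> real" where
  "qn h = (\<integral>x. (h x)\<^sup>2 \<partial>circ)"

lemma in_L2_iff: "in_L2 h \<longleftrightarrow> h \<in> L2"
  by (simp add: in_L2_def L2_def integrable_circ_iff)

lemma L2_measurable: "h \<in> L2 \<Longrightarrow> h \<in> borel_measurable borel"
  by (simp add: L2_def)

lemma L2_sq_integrable: "h \<in> L2 \<Longrightarrow> integrable circ (\<lambda>x. (h x)\<^sup>2)"
  by (simp add: L2_def)

lemma qn_nonneg [simp]: "0 \<le> qn h"
  by (simp add: qn_def)

lemma sq_add_le: "(a + b)\<^sup>2 \<le> 2 * a\<^sup>2 + 2 * (b::real)\<^sup>2"
  using zero_le_power2[of "a - b"] by (simp add: power2_eq_square algebra_simps)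

lemma L2_mult_integrable: "u \<in> L2 \<Longrightarrow> v \<in> L2 \<Longrightarrow> integrable circ (\<lambda>x. u x * v x)"
proof (rule Bochner_Integration.integrable_bound[of circ "\<lambda>x. (u x)\<^sup>2 + (v x)\<^sup>2"])
  assume *: "u \<in> L2" "v \<in> L2"
  have [measurable]: "u \<in> borel_measurable borel" "v \<in> borel_measurable borel"
    using * by (simp_all add: L2_measurable)
  show "(\<lambda>x. u x * v x) \<in> borel_measurable circ" by (rule measurable_circI) measurable
  show "AE x in circ. norm (u x * v x) \<le> norm ((u x)\<^sup>2 + (v x)\<^sup>2)"
  proof (rule AE_I2)
    fix x
    have "2 * (\<bar>u x\<bar> * \<bar>v x\<bar>) \<le> (u x)\<^sup>2 + (v x)\<^sup>2"
      using zero_le_power2[of "\<bar>u x\<bar> - \<bar>v x\<bar>"] by (simp add: power2_diff)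
    moreover have "0 \<le> \<bar>u x\<bar> * \<bar>v x\<bar>" by simp
    ultimately have "\<bar>u x\<bar> * \<bar>v x\<bar> \<le> (u x)\<^sup>2 + (v x)\<^sup>2" by linarith
    then show "norm (u x * v x) \<le> norm ((u x)\<^sup>2 + (v x)\<^sup>2)" by (simp add: abs_mult)
  qed
qed (auto simp: L2_sq_integrable)

lemma L2_const: "(\<lambda>x. c) \<in> L2"
  by (simp add: L2_def)

lemma L2_integrable: "u \<in> L2 \<Longrightarrow> integrable circ u"
  using L2_mult_integrable[OF _ L2_const[of 1]] by simp

lemma L2_lincomb:
  assumes "u \<in> L2" "v \<in> L2" shows "(\<lambda>x. a * u x + b * v x) \<in> L2"
proof -
  have [measurable]: "u \<in> borel_measurable borel" "v \<in> borel_measurable borel"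
    using assms by (simp_all add: L2_measurable)
  have "integrable circ (\<lambda>x. a\<^sup>2 * (u x)\<^sup>2 + 2 * a * b * (u x * v x) + b\<^sup>2 * (v x)\<^sup>2)"
    using L2_sq_integrable[OF assms(1)] L2_sq_integrable[OF assms(2)] L2_mult_integrable[OF assms]
    by (intro Bochner_Integration.integrable_add integrable_mult_right)
  then show ?thesis by (simp add: L2_def power2_eq_square algebra_simps)
qed

lemma L2_cmult: "u \<in> L2 \<Longrightarrow> (\<lambda>x. a * u x) \<in> L2"
  using L2_lincomb[of u u a 0] by simp

lemma L2_add: "u \<in> L2 \<Longrightarrow> v \<in> L2 \<Longrightarrow> (\<lambda>x. u x + v x) \<in> L2"
  using L2_lincomb[of u v 1 1] by simp

lemma L2_diff: "u \<in> L2 \<Longrightarrow> v \<in> L2 \<Longrightarrow> (\<lambda>x. u x - v x) \<in> L2"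
  using L2_lincomb[of u v 1 "-1"] by simp

lemma L2_bounded:
  assumes [measurable]: "h \<in> borel_measurable borel" and "\<And>x. x \<in> {-pi..pi} \<Longrightarrow> \<bar>h x\<bar> \<le> B"
  shows "h \<in> L2"
proof -
  have "norm ((h x)\<^sup>2) \<le> B\<^sup>2" if "x \<in> {-pi..pi}" for x
    using power_mono[OF assms(2)[OF that], of 2] by simp
  then show ?thesis unfolding L2_def by (auto intro!: integrable_circ_bounded[where B="B\<^sup>2"])
qed

lemma qn_cong_AE: "u \<in> L2 \<Longrightarrow> v \<in> L2 \<Longrightarrow> AE x in circ. u x = v x \<Longrightarrow> qn u = qn v"
  unfolding qn_def
  by (rule integral_cong_AE) (auto dest: L2_sq_integrable elim!: eventually_mono)

lemma qn_cmult: "qn (\<lambda>x. a * u x) = a\<^sup>2 * qn u"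
  by (simp add: qn_def power_mult_distrib)

lemma qn_uminus: "qn (\<lambda>x. - u x) = qn u"
  by (simp add: qn_def)

lemma qn_add: "u \<in> L2 \<Longrightarrow> v \<in> L2 \<Longrightarrow> qn (\<lambda>x. u x + v x) \<le> 2 * qn u + 2 * qn v"
proof -
  assume *: "u \<in> L2" "v \<in> L2"
  have "qn (\<lambda>x. u x + v x) \<le> (\<integral>x. 2 * (u x)\<^sup>2 + 2 * (v x)\<^sup>2 \<partial>circ)"
    unfolding qn_def
    by (rule integral_mono) (use L2_sq_integrable[OF L2_add[OF *]] * in \<open>auto simp: sq_add_le L2_sq_integrable\<close>)
  also have "\<dots> = 2 * qn u + 2 * qn v"
    using * by (simp add: qn_def L2_sq_integrable)
  finally show ?thesis .
qed

lemma qn_triangle: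
  "u \<in> L2 \<Longrightarrow> v \<in> L2 \<Longrightarrow> w \<in> L2 \<Longrightarrow> qn (\<lambda>x. u x - w x) \<le> 2 * qn (\<lambda>x. u x - v x) + 2 * qn (\<lambda>x. v x - w x)"
  using qn_add[OF L2_diff[of u v] L2_diff[of v w]] by simp

lemma qn_eq_0_iff: "u \<in> L2 \<Longrightarrow> qn u = 0 \<longleftrightarrow> (AE x in circ. u x = 0)"
  unfolding qn_def by (subst integral_nonneg_eq_0_iff_AE) (auto dest: L2_sq_integrable)

text \<open>The quadratic form of the combination \<open>s * u - t * v\<close> is nonnegative;
  keeping both parameters free avoids dividing by a possibly vanishing norm.\<close>

lemma L2_Cauchy_Schwarz:
  assumes "u \<in> L2" "v \<in> L2"
  shows "(\<integral>x. u x * v x \<partial>circ)\<^sup>2 \<le> qn u * qn v"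
proof -
  define b where "b = (\<integral>x. u x * v x \<partial>circ)"
  have quad: "0 \<le> s\<^sup>2 * qn u - 2 * s * t * b + t\<^sup>2 * qn v" for s t
  proof -
    have "0 \<le> qn (\<lambda>x. s * u x + (- t) * v x)" by simp
    also have "\<dots> = (\<integral>x. s\<^sup>2 * (u x)\<^sup>2 - 2 * s * t * (u x * v x) + t\<^sup>2 * (v x)\<^sup>2 \<partial>circ)"
      unfolding qn_def by (simp add: power2_eq_square algebra_simps)
    also have "\<dots> = s\<^sup>2 * qn u - 2 * s * t * b + t\<^sup>2 * qn v"
      unfolding qn_def b_def using assms by (simp add: L2_sq_integrable L2_mult_integrable)
    finally show ?thesis .
  qed
  show ?thesis
  proof (cases "qn v = 0")
    case True
    have "b = 0"
    proof (rule ccontr)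
      assume "b \<noteq> 0"
      \<comment> \<open>With \<open>s = 1\<close> and this \<open>t\<close> the form would take the
        value -1.\<close>
      then have "2 * 1 * ((qn u + 1) / (2 * b)) * b = qn u + 1" by simp
      with quad[of 1 "(qn u + 1) / (2 * b)"] True show False by simp
    qed
    then show ?thesis by (simp add: b_def)
  next
    case False
    then have "qn v > 0" by (simp add: less_le)
    \<comment> \<open>The choice \<open>s = qn v\<close>, \<open>t = b\<close> minimises the form up
      to scaling.\<close>
    have "0 \<le> (qn v)\<^sup>2 * qn u - 2 * qn v * b * b + b\<^sup>2 * qn v" by (rule quad)
    also have "\<dots> = qn v * (qn u * qn v - b\<^sup>2)" by (simp add: power2_eq_square algebra_simps)
    finally have "0 \<le> qn u * qn v - b\<^sup>2" using \<open>qn v > 0\<close> by (simp add: zero_le_mult_iff)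
    then show ?thesis by (simp add: b_def)
  qed
qed

lemma L2_integral_sq_le: "u \<in> L2 \<Longrightarrow> (\<integral>x. u x \<partial>circ)\<^sup>2 \<le> 2 * pi * qn u"
  using L2_Cauchy_Schwarz[OF _ L2_const[of 1], of u] by (simp add: qn_def mult.commute)

text \<open>Completeness for geometrically decaying series. The weights 4^k leave \<open>W\<close>
  integrable against the decay 16^(-k), and they force |u k x| <= sqrt (w x) 2^(-k) almost
  everywhere. So the series converges pointwise and its tails have squares at most 4 w / 4^n. Serves
  both the Neumann series and the Riesz-Fischer theorem.\<close>

lemma L2_series_complete:
  assumes u: "\<And>k. u k \<in> L2" and K: "\<And>k. qn (u k) \<le> K / 16 ^ k"
  shows "\<exists>g\<in>L2. (\<lambda>n. qn (\<lambda>x. g x - (\<Sum>k<n. u k x))) \<longlonglongrightarrow> 0"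
proof -
  have um [measurable]: "u k \<in> borel_measurable borel" for k using u by (simp add: L2_measurable)
  have umc [measurable]: "u k \<in> borel_measurable circ" for k by (rule measurable_circI) measurable
  define W where "W x = (\<Sum>k. ennreal (4 ^ k * (u k x)\<^sup>2))" for x
  have Wm [measurable]: "W \<in> borel_measurable circ" unfolding W_def[abs_def] by measurable
  have Wm' [measurable]: "W \<in> borel_measurable borel" unfolding W_def[abs_def] by measurable
  have "K \<ge> 0" using order_trans[OF qn_nonneg K[of 0]] by simp
  have "(\<integral>\<^sup>+x. W x \<partial>circ) = (\<Sum>k. \<integral>\<^sup>+x. ennreal (4 ^ k * (u k x)\<^sup>2) \<partial>circ)"
    unfolding W_def by (rule nn_integral_suminf) measurable
  also have "\<dots> \<le> (\<Sum>k. ennreal (K * (1 / 4) ^ k))"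
  proof (rule suminf_le)
    fix k
    have "(\<integral>\<^sup>+x. ennreal (4 ^ k * (u k x)\<^sup>2) \<partial>circ) = ennreal (4 ^ k * qn (u k))"
      by (subst nn_integral_eq_integral) (use u in \<open>auto simp: qn_def L2_sq_integrable\<close>)
    also have "4 ^ k * qn (u k) \<le> 4 ^ k * (K / 16 ^ k)"
      using K by (intro mult_left_mono) auto
    also have "4 ^ k * (K / 16 ^ k) = K * (1 / 4) ^ k"
    proof -
      have "(16::real) ^ k = 4 ^ k * 4 ^ k" by (simp flip: power_mult_distrib)
      then show ?thesis by (simp add: power_divide)
    qed
    finally show "(\<integral>\<^sup>+x. ennreal (4 ^ k * (u k x)\<^sup>2) \<partial>circ) \<le> ennreal (K * (1 / 4) ^ k)"
      by (simp add: ennreal_leI)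
  qed auto
  also have "\<dots> < \<infinity>"
  proof -
    have "summable (\<lambda>k. K * (1 / 4 :: real) ^ k)" by (intro summable_mult summable_geometric) simp
    then show ?thesis using \<open>K \<ge> 0\<close> by (subst suminf_ennreal2) auto
  qed
  finally have Wfin: "(\<integral>\<^sup>+x. W x \<partial>circ) < \<infinity>" .
  then have WAE: "AE x in circ. W x \<noteq> \<infinity>" by (intro nn_integral_PInf_AE) auto
  define w where "w x = enn2real (W x)" for x
  have wint: "integrable circ w"
  proof (rule integrableI_nonneg)
    have "(\<integral>\<^sup>+x. ennreal (w x) \<partial>circ) = (\<integral>\<^sup>+x. W x \<partial>circ)"
      by (rule nn_integral_cong_AE) (use WAE in \<open>auto simp: w_def less_top elim!: eventually_mono\<close>)
    then show "(\<integral>\<^sup>+x. ennreal (w x) \<partial>circ) < \<infinity>" using Wfin by simp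
  qed (auto simp: w_def[abs_def])
  define g where "g x = (\<Sum>k. u k x)" for x
  have gm [measurable]: "g \<in> borel_measurable borel" unfolding g_def[abs_def] by measurable
  have tail: "AE x in circ. (g x - (\<Sum>k<n. u k x))\<^sup>2 \<le> 4 * w x / 4 ^ n" for n
    using WAE
  proof eventually_elim
    case (elim x)
    have w0: "0 \<le> w x" by (simp add: w_def)
    have "(u k x)\<^sup>2 \<le> w x / 4 ^ k" for k
    proof -
      have "sum (\<lambda>k. ennreal (4 ^ k * (u k x)\<^sup>2)) {k} \<le> W x"
        unfolding W_def by (rule sum_le_suminf) (rule summableI, rule finite.intros, rule finite.intros, rule zero_le)
      then have "ennreal (4 ^ k * (u k x)\<^sup>2) \<le> W x" by (simp only: sum.insert_remove finite.emptyI) simp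
      also have "W x = ennreal (w x)" using elim by (simp add: w_def less_top)
      finally have "4 ^ k * (u k x)\<^sup>2 \<le> w x" using w0 by (simp add: ennreal_le_iff)
      then show ?thesis by (simp add: field_simps)
    qed
    then have "\<bar>u k x\<bar> \<le> sqrt (w x / 4 ^ k)" for k by (intro real_le_rsqrt) simp
    moreover have "sqrt (w x / 4 ^ k) = sqrt (w x) * (1 / 2) ^ k" for k
    proof -
      have "sqrt ((4::real) ^ k) = 2 ^ k" by (simp add: real_sqrt_power)
      then show ?thesis by (simp add: real_sqrt_divide power_divide)
    qed
    ultimately have ub: "\<bar>u k x\<bar> \<le> sqrt (w x) * (1 / 2) ^ k" for k by metis
    have geo: "summable (\<lambda>k. sqrt (w x) * (1 / 2) ^ k)" by (intro summable_mult summable_geometric) simp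
    have su: "summable (\<lambda>k. u k x)"
      by (rule summable_comparison_test'[OF geo]) (use ub in auto)
    have sun: "summable (\<lambda>k. u (k + n) x)" using su by (subst summable_iff_shift)
    have geon: "summable (\<lambda>k. (sqrt (w x) * (1 / 2) ^ n) * (1 / 2) ^ k)" by (intro summable_mult summable_geometric) simp
    have "g x - (\<Sum>k<n. u k x) = (\<Sum>k. u (k + n) x)"
      using suminf_minus_initial_segment[OF su, of n] by (simp add: g_def)
    moreover have "norm (\<Sum>k. u (k + n) x) \<le> (\<Sum>k. (sqrt (w x) * (1 / 2) ^ n) * (1 / 2) ^ k)"
    proof (rule norm_suminf_le[OF _ geon])
      fix k show "norm (u (k + n) x) \<le> (sqrt (w x) * (1 / 2) ^ n) * (1 / 2) ^ k"
        using ub[of "k + n"] by (simp add: power_add mult_ac)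
    qed
    moreover have "(\<Sum>k. (sqrt (w x) * (1 / 2) ^ n) * (1 / 2) ^ k) = (sqrt (w x) * (1 / 2) ^ n) * 2"
      by (subst suminf_mult) (auto simp: suminf_geometric)
    ultimately have "\<bar>g x - (\<Sum>k<n. u k x)\<bar> \<le> (sqrt (w x) * (1 / 2) ^ n) * 2" by simp
    then have "\<bar>g x - (\<Sum>k<n. u k x)\<bar>\<^sup>2 \<le> ((sqrt (w x) * (1 / 2) ^ n) * 2)\<^sup>2"
      by (intro power_mono) auto
    also have "\<dots> = 4 * w x * ((1 / 2) ^ n)\<^sup>2" using w0 by (simp add: power_mult_distrib)
    also have "((1 / 2 :: real) ^ n)\<^sup>2 = 1 / 4 ^ n" by (simp add: power2_eq_square power_divide flip: power_mult_distrib)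
    finally show ?case by simp
  qed
  have wi: "integrable circ (\<lambda>x. 4 * w x / 4 ^ n)" for n using wint by simp
  have gS: "(\<lambda>x. g x - (\<Sum>k<n. u k x)) \<in> L2" for n
  proof -
    have "integrable circ (\<lambda>x. (g x - (\<Sum>k<n. u k x))\<^sup>2)"
    proof (rule Bochner_Integration.integrable_bound[OF wi])
      show "(\<lambda>x. (g x - (\<Sum>k<n. u k x))\<^sup>2) \<in> borel_measurable circ" by (rule measurable_circI) measurable
      show "AE x in circ. norm ((g x - (\<Sum>k<n. u k x))\<^sup>2) \<le> norm (4 * w x / 4 ^ n)"
        using tail[of n] by eventually_elim (auto simp: w_def)
    qed
    then show ?thesis by (simp add: L2_def)
  qed
  have "qn (\<lambda>x. g x - (\<Sum>k<n. u k x)) \<le> 4 * integral\<^sup>L circ w * (1 / 4) ^ n" for n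
  proof -
    have "qn (\<lambda>x. g x - (\<Sum>k<n. u k x)) \<le> (\<integral>x. 4 * w x / 4 ^ n \<partial>circ)"
      unfolding qn_def by (rule integral_mono_AE) (use gS wi tail in \<open>auto simp: L2_sq_integrable\<close>)
    then show ?thesis by (simp add: power_divide)
  qed
  moreover have "(\<lambda>n. 4 * integral\<^sup>L circ w * (1 / 4) ^ n) \<longlonglongrightarrow> 0"
    by (rule tendsto_mult_right_zero) (rule LIMSEQ_power_zero, simp)
  ultimately have "(\<lambda>n. qn (\<lambda>x. g x - (\<Sum>k<n. u k x))) \<longlonglongrightarrow> 0"
    by (rule_tac tendsto_sandwich[of "\<lambda>n. 0" _ _ "\<lambda>n. 4 * integral\<^sup>L circ w * (1 / 4) ^ n"]) auto
  moreover have "g \<in> L2" using gS[of 0] by simp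
  ultimately show ?thesis by blast
qed

lemma integral_tendsto_L2:
  assumes "\<And>n. s n \<in> L2" "g \<in> L2" "(\<lambda>n. qn (\<lambda>x. g x - s n x)) \<longlonglongrightarrow> 0"
  shows "(\<lambda>n. \<integral>x. s n x \<partial>circ) \<longlonglongrightarrow> (\<integral>x. g x \<partial>circ)"
proof -
  have "(\<lambda>n. 2 * pi * qn (\<lambda>x. g x - s n x)) \<longlonglongrightarrow> 0"
    using assms(3) by (rule tendsto_mult_right_zero)
  moreover have "((\<integral>x. g x \<partial>circ) - (\<integral>x. s n x \<partial>circ))\<^sup>2 \<le> 2 * pi * qn (\<lambda>x. g x - s n x)" for n
    using L2_integral_sq_le[OF L2_diff[OF assms(2) assms(1)], of n]
    by (simp add: L2_integrable assms)
  ultimately have "(\<lambda>n. ((\<integral>x. g x \<partial>circ) - (\<integral>x. s n x \<partial>circ))\<^sup>2) \<longlonglongrightarrow> 0"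
    by (rule_tac tendsto_sandwich[of "\<lambda>n. 0" _ _ "\<lambda>n. 2 * pi * qn (\<lambda>x. g x - s n x)"]) auto
  then have "(\<lambda>n. (\<integral>x. g x \<partial>circ) - (\<integral>x. s n x \<partial>circ)) \<longlonglongrightarrow> 0" by simp
  from tendsto_diff[OF tendsto_const[of "\<integral>x. g x \<partial>circ"] this] show ?thesis by simp
qed

section \<open>Mean-zero functions and bounded operators on them\<close>

definition L2h :: "(real \<Rightarrow> real) set" where
  "L2h = {h \<in> L2. (\<integral>x. h x \<partial>circ) = 0}"

lemma L2h_L2: "u \<in> L2h \<Longrightarrow> u \<in> L2"
  by (simp add: L2h_def)

lemma L2h_lincomb: "u \<in> L2h \<Longrightarrow> v \<in> L2h \<Longrightarrow> (\<lambda>x. a * u x + b * v x) \<in> L2h"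
  by (simp add: L2h_def L2_lincomb L2_integrable)

lemma L2h_cmult: "u \<in> L2h \<Longrightarrow> (\<lambda>x. a * u x) \<in> L2h"
  using L2h_lincomb[of u u a 0] by simp

lemma L2h_uminus: "u \<in> L2h \<Longrightarrow> (\<lambda>x. - u x) \<in> L2h"
  using L2h_cmult[of u "-1"] by simp

lemma L2h_add: "u \<in> L2h \<Longrightarrow> v \<in> L2h \<Longrightarrow> (\<lambda>x. u x + v x) \<in> L2h"
  using L2h_lincomb[of u v 1 1] by simp

lemma L2h_diff: "u \<in> L2h \<Longrightarrow> v \<in> L2h \<Longrightarrow> (\<lambda>x. u x - v x) \<in> L2h"
  using L2h_lincomb[of u v 1 "-1"] by simp

lemma L2h_zero: "(\<lambda>x. 0) \<in> L2h"
  by (simp add: L2h_def L2_const)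

lemma L2h_sum: "(\<And>k. k \<in> I \<Longrightarrow> u k \<in> L2h) \<Longrightarrow> (\<lambda>x. \<Sum>k\<in>I. u k x) \<in> L2h"
  by (induction I rule: infinite_finite_induct) (auto simp: L2h_zero L2h_add)

text \<open>Linearity is required only almost everywhere: an integral operator takes a default value
  wherever its integrand is not integrable, and that null set depends on the argument.
  \<open>K\<close> bounds squared norms.\<close>

locale L2h_operator =
  fixes T :: "(real \<Rightarrow> real) \<Rightarrow> real \<Rightarrow> real" and K :: real
  assumes T_L2h: "u \<in> L2h \<Longrightarrow> T u \<in> L2h"
    and T_lincomb: "u \<in> L2h \<Longrightarrow> v \<in> L2h \<Longrightarrow>
          AE x in circ. T (\<lambda>x. a * u x + b * v x) x = a * T u x + b * T v x"
    and T_bound: "u \<in> L2h \<Longrightarrow> qn (T u) \<le> K * qn u"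
begin

lemma T_diff: "u \<in> L2h \<Longrightarrow> v \<in> L2h \<Longrightarrow> AE x in circ. T (\<lambda>x. u x - v x) x = T u x - T v x"
  using T_lincomb[of u v 1 "-1"] by simp

lemma T_sum:
  fixes u :: "nat \<Rightarrow> real \<Rightarrow> real"
  assumes "\<And>k. u k \<in> L2h"
  shows "AE x in circ. T (\<lambda>x. \<Sum>k<n. u k x) x = (\<Sum>k<n. T (u k) x)"
proof (induction n)
  case 0
  show ?case using T_lincomb[OF L2h_zero L2h_zero, of 0 0] by simp
next
  case (Suc n)
  have "AE x in circ. T (\<lambda>x. 1 * (\<Sum>k<n. u k x) + 1 * u n x) x = 1 * T (\<lambda>x. \<Sum>k<n. u k x) x + 1 * T (u n) x"
    by (rule T_lincomb) (auto intro: L2h_sum assms)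
  with Suc show ?case by eventually_elim simp
qed

end

text \<open>The solution is the Neumann series $\omega_0 + \omega_1 + \dots$ with $S \omega_0 = g$ and
  $S \omega_{n+1} = - E \omega_n$; the partial sums telescope under $S + E$.\<close>

lemma Neumann_perturbation:
  assumes R: "L2h_operator (\<lambda>u x. S u x + E u x) K"
    and S: "\<And>u. u \<in> L2h \<Longrightarrow> S u \<in> L2h" and E: "\<And>u. u \<in> L2h \<Longrightarrow> E u \<in> L2h"
    and surj: "\<And>g. g \<in> L2h \<Longrightarrow> \<exists>u\<in>L2h. AE x in circ. S u x = g x"
    and "C > 0" and lower: "\<And>u. u \<in> L2h \<Longrightarrow> qn u \<le> C * qn (S u)"
    and small: "\<And>u. u \<in> L2h \<Longrightarrow> C * qn (E u) \<le> qn u / 16"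
    and g: "g \<in> L2h"
  shows "\<exists>u\<in>L2h. AE x in circ. S u x + E u x = g x"
proof -
  interpret R: L2h_operator "\<lambda>u x. S u x + E u x" K by (rule R)
  obtain s where s: "\<And>g. g \<in> L2h \<Longrightarrow> s g \<in> L2h" "\<And>g. g \<in> L2h \<Longrightarrow> AE x in circ. S (s g) x = g x"
    using surj by metis
  define w where "w = rec_nat (s g) (\<lambda>_ u. s (\<lambda>x. - E u x))"
  have w0: "w 0 = s g" and wS: "w (Suc n) = s (\<lambda>x. - E (w n) x)" for n
    by (auto simp: w_def)
  have wV: "w n \<in> L2h" for n
    by (induction n) (auto simp: w0 wS intro!: s g L2h_uminus E)
  have Sw: "AE x in circ. S (w (Suc n)) x = - E (w n) x" for n
    unfolding wS by (rule s(2)) (intro L2h_uminus E wV)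
  \<comment> \<open>The 16 in the smallness hypothesis is the decay rate that
    \<open>L2_series_complete\<close> asks for; in terms of norms it is a contraction by
    1/4.\<close>
  have step: "qn (w (Suc n)) \<le> qn (w n) / 16" for n
  proof -
    have "qn (S (w (Suc n))) = qn (\<lambda>x. - E (w n) x)"
      by (rule qn_cong_AE) (auto intro!: Sw L2h_L2 S E wV L2h_uminus)
    then have "qn (w (Suc n)) \<le> C * qn (E (w n))"
      using lower[OF wV[of "Suc n"]] by (simp add: qn_uminus)
    also have "\<dots> \<le> qn (w n) / 16" by (rule small[OF wV])
    finally show ?thesis .
  qed
  have dec: "qn (w n) \<le> qn (w 0) / 16 ^ n" for n
  proof (induction n)
    case (Suc n) then show ?case using step[of n] by simp
  qed simp
  obtain u where u: "u \<in> L2" "(\<lambda>n. qn (\<lambda>x. u x - (\<Sum>k<n. w k x))) \<longlonglongrightarrow> 0"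
    using L2_series_complete[of w, OF L2h_L2[OF wV] dec] by blast
  define p where "p n x = (\<Sum>k<n. w k x)" for n x
  have pV: "p n \<in> L2h" for n unfolding p_def by (intro L2h_sum wV)
  have up: "(\<lambda>n. qn (\<lambda>x. u x - p n x)) \<longlonglongrightarrow> 0" using u(2) by (simp add: p_def)
  have "(\<lambda>n. \<integral>x. p n x \<partial>circ) \<longlonglongrightarrow> (\<integral>x. u x \<partial>circ)"
    by (rule integral_tendsto_L2[OF _ u(1) up]) (intro L2h_L2 pV)
  moreover have "(\<integral>x. p n x \<partial>circ) = 0" for n using pV[of n] by (simp add: L2h_def)
  ultimately have "(\<integral>x. u x \<partial>circ) = 0" by (simp add: LIMSEQ_const_iff)
  then have uV: "u \<in> L2h" using u(1) by (simp add: L2h_def)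
  have Rp: "AE x in circ. S (p (Suc n)) x + E (p (Suc n)) x = g x + E (w n) x" for n
  proof -
    have "AE x in circ. \<forall>n. S (w (Suc n)) x = - E (w n) x" using Sw by (intro AE_all_countable[THEN iffD2] allI)
    moreover have "AE x in circ. S (w 0) x = g x" unfolding w0 by (rule s(2)[OF g])
    moreover have "AE x in circ. S (p (Suc n)) x + E (p (Suc n)) x = (\<Sum>k<Suc n. S (w k) x + E (w k) x)"
      using R.T_sum[of w "Suc n", OF wV] by (simp only: p_def[abs_def])
    ultimately show ?thesis
    proof eventually_elim
      case (elim x)
      have "(\<Sum>k<Suc n. S (w k) x + E (w k) x) = g x + E (w n) x"
      proof (induction n)
        case 0 then show ?case using elim by simp
      next
        case (Suc n)
        then show ?case using elim(1) by simp
      qed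
      then show ?case using elim by simp
    qed
  qed
  \<comment> \<open>The residual of \<open>u\<close> is compared with that of a partial sum: the
    bound of \<open>S + E\<close> controls the difference, and telescoping leaves
    \<open>E (w n)\<close>.\<close>
  have est: "qn (\<lambda>x. (S u x + E u x) - g x) \<le> 2 * (K * qn (\<lambda>x. u x - p (Suc n) x)) + 2 * qn (E (w n))" for n
  proof -
    let ?R = "\<lambda>u x. S u x + E u x"
    have RV: "?R v \<in> L2" if "v \<in> L2h" for v using R.T_L2h[OF that] by (rule L2h_L2)
    have "qn (\<lambda>x. ?R u x - g x) \<le> 2 * qn (\<lambda>x. ?R u x - ?R (p (Suc n)) x) + 2 * qn (\<lambda>x. ?R (p (Suc n)) x - g x)"
      by (rule qn_triangle) (auto intro: RV uV pV L2h_L2 g)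
    also have "qn (\<lambda>x. ?R (p (Suc n)) x - g x) = qn (E (w n))"
      by (rule qn_cong_AE) (use Rp[of n] in \<open>auto intro!: L2_diff[OF RV[OF pV] L2h_L2[OF g]] L2h_L2[OF E[OF wV]] elim!: eventually_mono\<close>)
    also have "qn (\<lambda>x. ?R u x - ?R (p (Suc n)) x) = qn (?R (\<lambda>x. u x - p (Suc n) x))"
      by (rule qn_cong_AE) (use R.T_diff[OF uV pV[of "Suc n"]] in \<open>auto intro!: L2_diff[OF RV RV] RV uV pV L2h_diff elim!: eventually_mono\<close>)
    also have "\<dots> \<le> K * qn (\<lambda>x. u x - p (Suc n) x)"
      by (rule R.T_bound) (intro L2h_diff uV pV)
    finally show ?thesis by simp
  qed
  have Ew0: "(\<lambda>n. qn (E (w n))) \<longlonglongrightarrow> 0"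
  proof -
    have "qn (E (w n)) \<le> qn (w 0) / (16 * C) * (1 / 16) ^ n" for n
    proof -
      have "C * qn (E (w n)) \<le> (qn (w 0) / 16 ^ n) / 16"
        using small[OF wV[of n]] dec[of n] by simp
      then show ?thesis using \<open>C > 0\<close> by (simp add: field_simps power_divide)
    qed
    moreover have "(\<lambda>n. qn (w 0) / (16 * C) * (1 / 16) ^ n) \<longlonglongrightarrow> 0"
      by (rule tendsto_mult_right_zero) (rule LIMSEQ_power_zero, simp)
    ultimately show ?thesis
      by (rule_tac tendsto_sandwich[of "\<lambda>n. 0" _ _ "\<lambda>n. qn (w 0) / (16 * C) * (1 / 16) ^ n"]) auto
  qed
  have "(\<lambda>n. 2 * (K * qn (\<lambda>x. u x - p (Suc n) x)) + 2 * qn (E (w n))) \<longlonglongrightarrow> 0"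
    using tendsto_add[OF tendsto_mult_right_zero[OF tendsto_mult_right_zero[OF LIMSEQ_Suc[OF up], of K], of 2]
        tendsto_mult_right_zero[OF Ew0, of 2]] by simp
  then have "qn (\<lambda>x. (S u x + E u x) - g x) \<le> 0"
    by (rule tendsto_lowerbound) (use est in auto)
  then have "qn (\<lambda>x. (S u x + E u x) - g x) = 0" by (simp add: antisym)
  then have "AE x in circ. (S u x + E u x) - g x = 0"
    using qn_eq_0_iff[OF L2_diff[OF L2h_L2[OF R.T_L2h[OF uV]] L2h_L2[OF g]]] by simp
  then show ?thesis using uV by auto
qed


context L2h_operator
begin

lemma scaled_minus_operator:
  "L2h_operator (\<lambda>u x. c * u x + - T u x) (2 * c\<^sup>2 + 2 * K)"
proof
  fix u v :: "real \<Rightarrow> real" and a b :: real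
  assume u: "u \<in> L2h"
  show "(\<lambda>x. c * u x + - T u x) \<in> L2h"
    using L2h_lincomb[OF u T_L2h[OF u], of c "-1"] by simp
  have "qn (\<lambda>x. c * u x + - T u x) \<le> 2 * qn (\<lambda>x. c * u x) + 2 * qn (\<lambda>x. - T u x)"
    by (rule qn_add) (intro L2h_L2 L2h_cmult L2h_uminus u T_L2h)+
  also have "\<dots> \<le> (2 * c\<^sup>2 + 2 * K) * qn u"
    using T_bound[OF u] by (simp add: qn_cmult qn_uminus algebra_simps)
  finally show "qn (\<lambda>x. c * u x + - T u x) \<le> (2 * c\<^sup>2 + 2 * K) * qn u" .
  assume v: "v \<in> L2h"
  show "AE x in circ. c * (a * u x + b * v x) + - T (\<lambda>x. a * u x + b * v x) x
      = a * (c * u x + - T u x) + b * (c * v x + - T v x)"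
    using T_lincomb[OF u v, of a b] by eventually_elim (simp add: algebra_simps)
qed

text \<open>Method of continuity: $\lambda - T$ is onto for large $\lambda$, and the uniform lower bound
  allows steps of fixed length down to $\lambda = 1$.\<close>

lemma surjective_by_continuity:
  assumes lower: "\<And>lam u. lam \<ge> 1 \<Longrightarrow> u \<in> L2h \<Longrightarrow> qn u \<le> C * qn (\<lambda>x. lam * u x - T u x)"
    and "lam \<ge> 1" "g \<in> L2h"
  shows "\<exists>u\<in>L2h. AE x in circ. lam * u x - T u x = g x"
proof -
  define C' where "C' = max C 1"
  have C': "C' > 0" "C' \<ge> C" by (auto simp: C'_def)
  have lower': "qn u \<le> C' * qn (\<lambda>x. lam * u x + - T u x)" if "lam \<ge> 1" "u \<in> L2h" for lam u
    using lower[OF that] mult_right_mono[OF C'(2), of "qn (\<lambda>x. lam * u x - T u x)"] by simp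
  \<comment> \<open>From \<open>lam >= 1\<close> and \<open>lam >= 16 * K\<close> follows
    \<open>lam^2 >= 16 * K\<close>, so \<open>- T\<close> is a small perturbation of multiplication
    by \<open>lam\<close>.\<close>
  define L where "L = max 1 (16 * K)"
  \<comment> \<open>The longest step for which the perturbation \<open>- d * u\<close> meets the
    smallness hypothesis with constant \<open>C'\<close>.\<close>
  define d where "d = 1 / (4 * sqrt C')"
  have d: "d > 0" "C' * d\<^sup>2 = 1 / 16"
    using C' by (auto simp: d_def power_divide power_mult_distrib)
  have start: "\<exists>u\<in>L2h. AE x in circ. lam * u x + - T u x = g x" if "lam \<ge> L" "g \<in> L2h" for lam g
  proof (rule Neumann_perturbation[where S="\<lambda>u x. lam * u x" and E="\<lambda>u x. - T u x" and C="1 / lam\<^sup>2",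
        OF scaled_minus_operator])
    have lam: "lam \<ge> 1" "lam \<ge> 16 * K" using that by (auto simp: L_def)
    show "1 / lam\<^sup>2 > 0" using lam by simp
    show "\<exists>u\<in>L2h. AE x in circ. lam * u x = g x" if "g \<in> L2h" for g
      by (rule bexI[of _ "\<lambda>x. (1 / lam) * g x"]) (use lam L2h_cmult[OF that, of "1 / lam"] in auto)
    show "qn u \<le> 1 / lam\<^sup>2 * qn (\<lambda>x. lam * u x)" for u
      using lam by (simp add: qn_cmult)
    show "1 / lam\<^sup>2 * qn (\<lambda>x. - T u x) \<le> qn u / 16" if "u \<in> L2h" for u
    proof -
      have "lam \<le> lam\<^sup>2" using lam mult_right_mono[of 1 lam lam] by (simp add: power2_eq_square)
      then have "16 * K \<le> lam\<^sup>2" using lam by linarith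
      then have "16 * K * qn u \<le> lam\<^sup>2 * qn u" by (rule mult_right_mono) simp
      with T_bound[OF that] have "16 * qn (T u) \<le> lam\<^sup>2 * qn u" by simp
      then show ?thesis using lam by (simp add: qn_uminus field_simps)
    qed
    show "(\<lambda>x. lam * u x) \<in> L2h" if "u \<in> L2h" for u
      by (rule L2h_cmult[OF that])
    show "(\<lambda>x. - T u x) \<in> L2h" if "u \<in> L2h" for u
      by (rule L2h_uminus[OF T_L2h[OF that]])
  qed (rule that)
  \<comment> \<open>Induction on the number of steps below \<open>L\<close>; the operator at
    \<open>lam\<close> is that at \<open>lam + d\<close> perturbed by \<open>- d\<close>.\<close>
  have "\<exists>u\<in>L2h. AE x in circ. lam * u x + - T u x = g x" if "lam \<ge> 1" "lam \<ge> L - real n * d" "g \<in> L2h" for lam g n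
    using that
  proof (induction n arbitrary: lam g)
    case 0
    then show ?case using start by simp
  next
    case (Suc n)
    have "\<exists>u\<in>L2h. AE x in circ. ((lam + d) * u x + - T u x) + - d * u x = g x"
    proof (rule Neumann_perturbation[where S="\<lambda>u x. (lam + d) * u x + - T u x" and E="\<lambda>u x. - d * u x" and C=C'])
      have "(\<lambda>u x. ((lam + d) * u x + - T u x) + - d * u x) = (\<lambda>u x. lam * u x + - T u x)"
        by (intro ext) (simp add: algebra_simps)
      then show "L2h_operator (\<lambda>u x. ((lam + d) * u x + - T u x) + - d * u x) (2 * lam\<^sup>2 + 2 * K)"
        using scaled_minus_operator[of lam] by simp
      show "\<exists>u\<in>L2h. AE x in circ. (lam + d) * u x + - T u x = g x" if "g \<in> L2h" for g
        by (rule Suc.IH) (use Suc.prems d that in \<open>auto simp: algebra_simps\<close>)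
      show "qn u \<le> C' * qn (\<lambda>x. (lam + d) * u x + - T u x)" if "u \<in> L2h" for u
        by (rule lower') (use Suc.prems d that in auto)
      show "C' * qn (\<lambda>x. - d * u x) \<le> qn u / 16" for u
        by (simp only: qn_cmult power2_minus mult.assoc[symmetric] d(2))
      show "(\<lambda>x. (lam + d) * u x + - T u x) \<in> L2h" if "u \<in> L2h" for u
        using L2h_operator.T_L2h[OF scaled_minus_operator that] .
      show "(\<lambda>x. - d * u x) \<in> L2h" if "u \<in> L2h" for u
        by (rule L2h_cmult[OF that])
    qed (use Suc.prems C' in auto)
    moreover have "((lam + d) * u x + - T u x) + - d * u x = lam * u x + - T u x" for u x
      by (simp add: algebra_simps)
    ultimately show ?case by (simp only:)
  qed
  moreover obtain n where "L / d \<le> real n" using real_arch_simple by blast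
  then have "lam \<ge> L - real n * d" using d \<open>lam \<ge> 1\<close> by (simp add: field_simps)
  ultimately show ?thesis using assms by auto
qed

end

section \<open>Uniqueness of Fourier coefficients\<close>

lemma fourier_coeff_circ:
  "fourier_coeff h k = (1 / (2 * pi)) * (\<integral>x. complex_of_real (h x) * cis (- (of_int k * x)) \<partial>circ)"
  unfolding fourier_coeff_def integral_circ_eq ..

lemma integrable_circ_cis:
  assumes "integrable circ h"
  shows "integrable circ (\<lambda>x. complex_of_real (h x) * cis (a * x))"
proof (rule Bochner_Integration.integrable_bound[OF assms])
  have "(\<lambda>x. cis (a * x)) \<in> borel_measurable circ"
    by (intro measurable_circI borel_measurable_continuous_onI continuous_intros)
  moreover have "h \<in> borel_measurable circ" using assms by simp
  ultimately show "(\<lambda>x. complex_of_real (h x) * cis (a * x)) \<in> borel_measurable circ" by measurable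
qed (simp add: norm_mult)

lemma integrable_circ_cis': "integrable circ (\<lambda>x. cis (a * x))"
  using integrable_circ_cis[of "\<lambda>x. 1" a] by simp

lemma cis_has_vector_derivative:
  "((\<lambda>x. cis (a * x)) has_vector_derivative (\<i> * of_real a * cis (a * x))) (at x within S)"
  unfolding has_vector_derivative_def
  by (auto intro!: derivative_eq_intros simp: scaleR_conv_of_real mult_ac)

lemma integral_cis_interval:
  assumes "k \<noteq> 0" "a \<le> b"
  shows "(LINT x:{a..b}|lborel. cis (of_int k * x)) = (cis (of_int k * b) - cis (of_int k * a)) / (\<i> * of_int k)"
proof -
  have "set_integrable lborel {a..b} (\<lambda>x. cis (of_int k * x))"
    by (rule borel_integrable_atLeastAtMost') (intro continuous_intros)
  moreover have "((\<lambda>x. cis (of_int k * x) / (\<i> * of_int k)) has_vector_derivative cis (of_int k * x)) (at x)" for x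
    using has_vector_derivative_mult_left[OF cis_has_vector_derivative[of "of_int k" x UNIV], of "1 / (\<i> * of_int k)"] assms
    by simp
  ultimately show ?thesis
    using assms by (subst set_integral_FTC[where S="{}" and F="\<lambda>x. cis (of_int k * x) / (\<i> * of_int k)"])
      (auto intro!: continuous_intros simp: diff_divide_distrib)
qed

lemma cis_int_pi: "cis (of_int k * pi) = cis (- (of_int k * pi))"
  using sin_zero_iff_int2[of "of_int k * pi"] by (simp add: complex_eq_iff)

lemma integral_cis_circ: "(\<integral>x. cis (of_int k * x) \<partial>circ) = (if k = 0 then 2 * pi else 0)"
proof (cases "k = 0")
  case True
  then show ?thesis by (simp add: scaleR_conv_of_real)
next
  case False
  then show ?thesis
    using integral_cis_interval[OF False, of "-pi" pi] cis_int_pi[of k]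
    by (simp add: integral_circ_eq)
qed

text \<open>Closed under sums by construction, with no record of frequencies: orthogonality to all
  characters passes to every such function by rule induction.\<close>

inductive trig_poly :: "(real \<Rightarrow> complex) \<Rightarrow> bool" where
  mono: "trig_poly (\<lambda>x. c * cis (of_int k * x))"
| add: "trig_poly P \<Longrightarrow> trig_poly Q \<Longrightarrow> trig_poly (\<lambda>x. P x + Q x)"

lemma trig_poly_const: "trig_poly (\<lambda>x. c)"
  using trig_poly.mono[of c 0] by simp

lemma trig_poly_mult_mono: "trig_poly Q \<Longrightarrow> trig_poly (\<lambda>x. c * cis (of_int k * x) * Q x)"
proof (induction rule: trig_poly.induct)
  case (mono d l)
  have "c * cis (of_int k * x) * (d * cis (of_int l * x)) = (c * d) * cis (of_int (k + l) * x)" for x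
    by (simp add: cis_mult[symmetric] algebra_simps)
  then show ?case using trig_poly.mono[of "c * d" "k + l"] by (simp only:)
next
  case (add P Q)
  then show ?case using trig_poly.add by (simp add: distrib_left)
qed

lemma trig_poly_mult: "trig_poly P \<Longrightarrow> trig_poly Q \<Longrightarrow> trig_poly (\<lambda>x. P x * Q x)"
proof (induction rule: trig_poly.induct)
  case (mono c k)
  then show ?case by (rule trig_poly_mult_mono)
next
  case (add P1 P2)
  then show ?case using trig_poly.add by (simp add: distrib_right)
qed

text \<open>Real polynomial functions on the plane are generated by real-linear functionals and
  constants. A functional at \<open>cis x\<close> is a combination of cos x and sin x, hence by
  Euler of the frequencies 1 and -1.\<close>

lemma trig_poly_of_real_polynomial:
  fixes g :: "complex \<Rightarrow> real"
  shows "real_polynomial_function g \<Longrightarrow> trig_poly (\<lambda>x. of_real (g (cis x)))"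
proof (induction rule: real_polynomial_function.induct)
  case (linear f)
  interpret bounded_linear f by (rule linear)
  have "complex_of_real (f (cis x)) = ((of_real (f 1) - \<i> * of_real (f \<i>)) / 2) * cis (of_int 1 * x)
      + ((of_real (f 1) + \<i> * of_real (f \<i>)) / 2) * cis (of_int (- 1) * x)" for x
  proof -
    have "cis x = cos x *\<^sub>R 1 + sin x *\<^sub>R \<i>" by (simp add: complex_eq_iff)
    then have "f (cis x) = cos x * f 1 + sin x * f \<i>" by (simp only: add scaleR) simp
    then show ?thesis by (simp add: complex_eq_iff field_simps)
  qed
  then show ?case using trig_poly.add[OF trig_poly.mono trig_poly.mono] by (simp only:)
next
  case (const c)
  then show ?case by (simp add: trig_poly_const)
next
  case (add f g)
  then show ?case using trig_poly.add by simp
next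
  case (mult f g)
  then show ?case using trig_poly_mult by simp
qed

lemma integral_trig_poly_eq_0:
  assumes h: "integrable circ h" and z: "\<And>k. fourier_coeff h k = 0"
  shows "trig_poly P \<Longrightarrow> integrable circ (\<lambda>x. complex_of_real (h x) * P x)
      \<and> (\<integral>x. complex_of_real (h x) * P x \<partial>circ) = 0"
proof (induction rule: trig_poly.induct)
  case (mono c k)
  have "integrable circ (\<lambda>x. c * (complex_of_real (h x) * cis (of_int k * x)))"
    by (intro integrable_mult_right integrable_circ_cis h)
  moreover have "(\<integral>x. complex_of_real (h x) * cis (of_int k * x) \<partial>circ) = 0"
    using z[of "-k"] by (simp add: fourier_coeff_circ)
  ultimately show ?case by (simp add: mult.left_commute[of _ c])
next
  case (add P Q)
  then show ?case by (simp add: distrib_left)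
qed

text \<open>\<open>Arg\<close> jumps at -1, so continuity of \<open>F\<close> is proved through
  closed sets: each preimage is the \<open>cis\<close>-image of a compact set. The condition
  \<open>h (-pi) = h pi\<close> reconciles the two arguments of -1.\<close>

lemma continuous_circle_lift:
  fixes h :: "real \<Rightarrow> real"
  assumes "continuous_on {-pi..pi} h" "h (-pi) = h pi"
  obtains F where "continuous_on (sphere (0::complex) 1) F" "\<And>x. x \<in> {-pi..pi} \<Longrightarrow> F (cis x) = h x"
proof
  define F where "F w = h (Arg w)" for w
  show Fc: "F (cis x) = h x" if "x \<in> {-pi..pi}" for x
  proof (cases "x = -pi")
    case True
    have "Arg (cis (-pi)) = pi" by (rule Arg_unique[of 1]) (auto simp: complex_eq_iff)
    then show ?thesis using True assms(2) by (simp add: F_def)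
  next
    case False
    then have "Arg (cis x) = x" using that by (intro Arg_unique[of 1]) (auto simp: cis_conv_exp)
    then show ?thesis by (simp add: F_def)
  qed
  have "closed (F -` B \<inter> sphere 0 1)" if "closed B" for B
  proof -
    have "F -` B \<inter> sphere 0 1 = cis ` ({-pi..pi} \<inter> h -` B)"
    proof (intro set_eqI iffI)
      fix w assume w: "w \<in> F -` B \<inter> sphere 0 1"
      then have "cis (Arg w) = w" using rcis_cmod_Arg[of w] by (simp add: rcis_def)
      moreover have "Arg w \<in> {-pi..pi}" using Arg_bounded[of w] by auto
      ultimately show "w \<in> cis ` ({-pi..pi} \<inter> h -` B)"
        using w by (intro image_eqI[of _ _ "Arg w"]) (auto simp: F_def)
    next
      fix w assume "w \<in> cis ` ({-pi..pi} \<inter> h -` B)"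
      then show "w \<in> F -` B \<inter> sphere 0 1" using Fc by auto
    qed
    moreover have "compact ({-pi..pi} \<inter> h -` B)"
    proof -
      have "closed (h -` B \<inter> {-pi..pi})"
        using assms(1) that by (subst (asm) continuous_on_closed_vimage) auto
      from closed_Int_compact[OF this compact_Icc[of "-pi" pi]] show ?thesis
        by (simp add: Int_ac)
    qed
    ultimately show ?thesis
      using compact_imp_closed[OF compact_continuous_image[of "{-pi..pi} \<inter> h -` B" cis]]
      by (simp add: continuous_intros)
  qed
  then show "continuous_on (sphere 0 1) F" by (subst continuous_on_closed_vimage) auto
qed

text \<open>By Stone-Weierstrass on the unit circle \<open>h\<close> is uniformly within
  \<open>e\<close> of a trigonometric polynomial, to which it is orthogonal. Hence the integral of
  h^2 is at most \<open>e\<close> times that of |h|, for every \<open>e\<close>.\<close>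

lemma fourier_unique_continuous:
  fixes h :: "real \<Rightarrow> real"
  assumes c: "continuous_on {-pi..pi} h" and p: "h (-pi) = h pi" and z: "\<And>k. fourier_coeff h k = 0"
    and x: "x \<in> {-pi..pi}"
  shows "h x = 0"
proof -
  have hi: "integrable circ h"
    unfolding integrable_circ_iff by (rule borel_integrable_atLeastAtMost'[OF c])
  have h2i: "integrable circ (\<lambda>x. (h x)\<^sup>2)"
    unfolding integrable_circ_iff by (rule borel_integrable_atLeastAtMost') (intro continuous_intros c)
  obtain F where F: "continuous_on (sphere (0::complex) 1) F" "\<And>x. x \<in> {-pi..pi} \<Longrightarrow> F (cis x) = h x"
    using continuous_circle_lift[OF c p] by blast
  have "(\<integral>x. (h x)\<^sup>2 \<partial>circ) \<le> e * (\<integral>x. \<bar>h x\<bar> \<partial>circ)" if e: "e > 0" for e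
  proof -
    obtain g where g: "real_polynomial_function g" "\<And>w. w \<in> sphere 0 1 \<Longrightarrow> \<bar>F w - g w\<bar> < e"
      by (rule Stone_Weierstrass_real_polynomial_function[OF compact_sphere F(1) e]) (rule that)
    have gi: "integrable circ (\<lambda>x. complex_of_real (h x * g (cis x)))"
      and g0: "(\<integral>x. complex_of_real (h x * g (cis x)) \<partial>circ) = 0"
      using integral_trig_poly_eq_0[OF hi z trig_poly_of_real_polynomial[OF g(1)]] by auto
    have gi': "integrable circ (\<lambda>x. h x * g (cis x))"
      using integrable_Re[OF gi] by simp
    have g0': "(\<integral>x. h x * g (cis x) \<partial>circ) = 0" using g0 by (simp only: integral_complex_of_real) simp
    have "(\<integral>x. (h x)\<^sup>2 \<partial>circ) = (\<integral>x. (h x)\<^sup>2 - h x * g (cis x) \<partial>circ)"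
      using g0' by (simp add: h2i gi')
    also have "\<dots> \<le> (\<integral>x. e * \<bar>h x\<bar> \<partial>circ)"
    proof (rule integral_mono)
      fix x assume "x \<in> space circ"
      then have "\<bar>h x - g (cis x)\<bar> < e" using g(2)[of "cis x"] F(2)[of x] by simp
      then have "\<bar>h x\<bar> * \<bar>h x - g (cis x)\<bar> \<le> \<bar>h x\<bar> * e" by (intro mult_left_mono) auto
      then show "(h x)\<^sup>2 - h x * g (cis x) \<le> e * \<bar>h x\<bar>"
        by (simp add: power2_eq_square algebra_simps abs_mult[symmetric])
    qed (use h2i gi' hi in auto)
    finally show ?thesis by simp
  qed
  note small = this
  define I where "I = (\<integral>x. \<bar>h x\<bar> \<partial>circ)"
  have "I \<ge> 0" by (simp add: I_def)
  have "(\<integral>x. (h x)\<^sup>2 \<partial>circ) \<le> 0"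
  proof (rule field_le_epsilon)
    fix e :: real assume "e > 0"
    have "(\<integral>x. (h x)\<^sup>2 \<partial>circ) \<le> e / (I + 1) * I"
      unfolding I_def by (rule small) (use \<open>I \<ge> 0\<close> \<open>e > 0\<close> in \<open>auto simp flip: I_def\<close>)
    also have "\<dots> \<le> e" using \<open>I \<ge> 0\<close> \<open>e > 0\<close> by (simp add: field_simps)
    finally show "(\<integral>x. (h x)\<^sup>2 \<partial>circ) \<le> 0 + e" by simp
  qed
  then have "(\<integral>x. (h x)\<^sup>2 \<partial>circ) = 0" by (simp add: antisym)
  then have "integral {-pi..pi} (\<lambda>x. (h x)\<^sup>2) = 0"
    using set_borel_integral_eq_integral(2)[OF h2i[unfolded integrable_circ_iff]] by (simp add: integral_circ_eq)
  moreover have "continuous_on {-pi..pi} (\<lambda>x. (h x)\<^sup>2)" by (intro continuous_intros c)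
  ultimately show ?thesis using x by (subst (asm) integral_eq_0_iff) auto
qed

section \<open>Antiderivatives and uniqueness of Fourier coefficients for integrable
  functions\<close>

definition anti :: "(real \<Rightarrow> real) \<Rightarrow> real \<Rightarrow> real" where
  "anti g x = (LINT u:{-pi..x}|lborel. g u)"

lemma anti_eq_circ:
  assumes "x \<le> pi"
  shows "anti g x = (\<integral>u. indicator {-pi..x} u * g u \<partial>circ)"
  unfolding anti_def integral_circ_eq set_lebesgue_integral_def
  by (rule Bochner_Integration.integral_cong) (use assms in \<open>auto simp: indicator_def\<close>)

lemma anti_minus_pi [simp]: "anti g (-pi) = 0"
proof -
  have "AE u in lborel. indicat_real {-pi..-pi} u *\<^sub>R g u = 0"
    using AE_neq[of "-pi"] by eventually_elim auto
  then show ?thesis unfolding anti_def set_lebesgue_integral_def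
    by (rule integral_eq_zero_AE)
qed

lemma anti_pi: "anti g pi = (\<integral>u. g u \<partial>circ)"
  by (simp add: anti_def integral_circ_eq)

lemma continuous_anti:
  assumes "integrable circ g" shows "continuous_on {-pi..pi} (anti g)"
proof -
  have si: "set_integrable lborel {-pi..pi} g" using assms by (simp add: integrable_circ_iff)
  have "anti g x = integral {-pi..x} g" if "x \<in> {-pi..pi}" for x
    unfolding anti_def
    by (rule set_borel_integral_eq_integral(2), rule set_integrable_subset[OF si]) (use that in auto)
  moreover have "continuous_on {-pi..pi} (\<lambda>x. integral {-pi..x} g)"
    by (rule indefinite_integral_continuous_1) (rule set_borel_integral_eq_integral(1)[OF si])
  ultimately show ?thesis using continuous_on_cong[OF refl, of "{-pi..pi}" "anti g" "\<lambda>x. integral {-pi..x} g"] by blast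
qed

text \<open>A vanishing antiderivative says that the positive and negative parts of \<open>g\<close>
  have equal integrals over all half-lines. The measures with these densities then coincide, hence
  so do the densities, without a differentiation theorem.\<close>

lemma anti_eq_0_imp_AE:
  assumes gi: "integrable circ g" and z: "\<And>x. x \<in> {-pi..pi} \<Longrightarrow> anti g x = 0"
  shows "AE x in circ. g x = 0"
proof -
  define G where "G x = indicator {-pi..pi} x * g x" for x
  have Gi: "integrable lborel G" using gi
    by (simp add: integrable_restrict_space G_def[abs_def])
  then have Gm [measurable]: "G \<in> borel_measurable borel" by auto
  define p where "p x = max 0 (G x)" for x
  define q where "q x = max 0 (- G x)" for x
  have [measurable]: "p \<in> borel_measurable borel" "q \<in> borel_measurable borel"
    by (auto simp: p_def[abs_def] q_def[abs_def])
  have pi': "integrable lborel p" "integrable lborel q"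
    using Gi by (auto simp: p_def[abs_def] q_def[abs_def])
  have G: "G x = p x - q x" for x by (auto simp: p_def q_def)
  have 0: "(\<integral>u. indicator {x<..} u * G u \<partial>lborel) = 0" for x
  proof -
    have i1: "integrable lborel (\<lambda>u. indicator {..x} u * G u)"
      using integrable_mult_indicator[OF _ Gi, of "{..x}"] by simp
    have "(\<integral>u. indicator {x<..} u * G u \<partial>lborel) = (\<integral>u. G u - indicator {..x} u * G u \<partial>lborel)"
      by (rule Bochner_Integration.integral_cong) (auto simp: indicator_def)
    also have "\<dots> = (\<integral>u. G u \<partial>lborel) - (\<integral>u. indicator {..x} u * G u \<partial>lborel)"
      using Gi i1 by (rule Bochner_Integration.integral_diff)
    also have "(\<integral>u. G u \<partial>lborel) = anti g pi"
      by (simp add: anti_def G_def[abs_def] set_lebesgue_integral_def)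
    \<comment> \<open>\<open>G\<close> vanishes off the circle, so a cut point outside it may be
      clamped to the nearest end.\<close>
    also have "(\<integral>u. indicator {..x} u * G u \<partial>lborel) = anti g (max (-pi) (min x pi))"
    proof (cases "x < -pi")
      case True
      then have "(\<lambda>u. indicator {..x} u * G u) = (\<lambda>u. 0)" by (auto simp: G_def indicator_def)
      moreover have "max (-pi) (min x pi) = -pi" using True by simp
      ultimately show ?thesis by simp
    next
      case False
      then show ?thesis unfolding anti_def set_lebesgue_integral_def
        by (intro Bochner_Integration.integral_cong) (auto simp: G_def indicator_def)
    qed
    finally show ?thesis using z by auto
  qed
  have em: "emeasure (density lborel (\<lambda>x. ennreal (r x))) {x<..} = ennreal (\<integral>u. indicator {x<..} u * r u \<partial>lborel)"
    if [measurable]: "r \<in> borel_measurable borel" and ri: "integrable lborel r" and "\<And>x. r x \<ge> 0"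
    for r :: "real \<Rightarrow> real" and x
  proof -
    have "emeasure (density lborel (\<lambda>x. ennreal (r x))) {x<..} = (\<integral>\<^sup>+u. ennreal (indicator {x<..} u * r u) \<partial>lborel)"
      by (subst emeasure_density) (auto intro!: nn_integral_cong simp: indicator_def)
    also have "\<dots> = ennreal (\<integral>u. indicator {x<..} u * r u \<partial>lborel)"
      by (rule nn_integral_eq_integral) (use integrable_mult_indicator[OF _ ri, of "{x<..}"] that greaterThan_borel[of x] in auto)
    finally show ?thesis .
  qed
  have "density lborel (\<lambda>x. ennreal (p x)) = density lborel (\<lambda>x. ennreal (q x))"
  proof (rule measure_eqI_lessThan)
    fix x
    have i: "integrable lborel (\<lambda>u. indicator {x<..} u * p u)" "integrable lborel (\<lambda>u. indicator {x<..} u * q u)"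
      using integrable_mult_indicator[OF _ pi'(1), of "{x<..}"] integrable_mult_indicator[OF _ pi'(2), of "{x<..}"] by auto
    have "(\<integral>u. indicator {x<..} u * p u \<partial>lborel) - (\<integral>u. indicator {x<..} u * q u \<partial>lborel) = 0"
      using 0[of x] i by (simp add: G right_diff_distrib)
    then show "emeasure (density lborel (\<lambda>x. ennreal (p x))) {x<..} = emeasure (density lborel (\<lambda>x. ennreal (q x))) {x<..}"
      by (subst (1 2) em) (auto simp: pi' p_def q_def)
    show "emeasure (density lborel (\<lambda>x. ennreal (p x))) {x<..} < \<infinity>"
      by (subst em) (auto simp: pi' p_def)
  qed auto
  then have "AE x in lborel. ennreal (p x) = ennreal (q x)"
    by (subst (asm) sigma_finite_measure.density_unique_iff[OF sigma_finite_lborel]) auto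
  then have "AE x in lborel. G x = 0"
    by eventually_elim (auto simp: p_def q_def max_def split: if_splits)
  then show ?thesis unfolding AE_circ_iff
    by eventually_elim (auto simp: G_def)
qed

text \<open>Integration by parts, carried out as Fubini on the triangle \<open>u <= x\<close>. The
  boundary term at \<open>pi\<close> is proportional to the mean of \<open>g\<close> and disappears
  on \<open>L2h\<close>.\<close>

lemma fourier_coeff_anti:
  assumes gi: "integrable circ g" and k: "k \<noteq> 0"
  shows "fourier_coeff (anti g) k = (fourier_coeff g k - cis (- (of_int k * pi)) * fourier_coeff g 0) / (\<i> * of_int k)"
proof -
  define D where "D x u = cis (- (of_int k * x)) * (if u \<le> x then complex_of_real (g u) else 0)" for x u
  have gm [measurable]: "g \<in> borel_measurable circ" using gi by simp
  have c1: "(\<lambda>x. cis (- (of_int k * x))) \<in> borel_measurable circ"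
    by (intro measurable_circI borel_measurable_continuous_onI continuous_intros)
  have m1: "(\<lambda>p. cis (- (of_int k * fst p))) \<in> borel_measurable (circ \<Otimes>\<^sub>M circ)"
    by (rule measurable_compose[OF measurable_fst c1])
  have m2: "(\<lambda>p. complex_of_real (g (snd p))) \<in> borel_measurable (circ \<Otimes>\<^sub>M circ)"
    by (rule measurable_compose[OF measurable_snd]) measurable
  have m3: "(\<lambda>p. if snd p \<le> fst p then 1 else 0 :: complex) \<in> borel_measurable (circ \<Otimes>\<^sub>M circ)"
    by (rule measurable_circ_pair) measurable
  have "(\<lambda>p. cis (- (of_int k * fst p)) * ((if snd p \<le> fst p then 1 else 0) * complex_of_real (g (snd p)))) \<in> borel_measurable (circ \<Otimes>\<^sub>M circ)"
    by (intro borel_measurable_times m1 m2 m3)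
  then have Dm: "(\<lambda>(x, u). D x u) \<in> borel_measurable (circ \<Otimes>\<^sub>M circ)"
    by (rule measurable_cong[THEN iffD1, rotated]) (auto simp: D_def)
  have Di: "integrable (circ \<Otimes>\<^sub>M circ) (\<lambda>(x, u). D x u)"
  proof (rule Bochner_Integration.integrable_bound[OF _ Dm])
    show "integrable (circ \<Otimes>\<^sub>M circ) (\<lambda>p. norm (g (snd p)))"
    proof (rule circ_circ.Fubini_integrable)
      show "(\<lambda>p. norm (g (snd p))) \<in> borel_measurable (circ \<Otimes>\<^sub>M circ)"
        by (rule measurable_compose[OF measurable_snd]) measurable
    qed (use gi in auto)
  qed (auto simp: D_def norm_mult)
  have in1: "(\<integral>u. D x u \<partial>circ) = cis (- (of_int k * x)) * complex_of_real (anti g x)" if "x \<in> space circ" for x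
  proof -
    have "(\<integral>u. D x u \<partial>circ) = (\<integral>u. cis (- (of_int k * x)) * complex_of_real (indicator {-pi..x} u * g u) \<partial>circ)"
      by (rule Bochner_Integration.integral_cong) (auto simp: D_def indicator_def)
    also have "\<dots> = cis (- (of_int k * x)) * (\<integral>u. complex_of_real (indicator {-pi..x} u * g u) \<partial>circ)"
      by simp
    also have "(\<integral>u. complex_of_real (indicator {-pi..x} u * g u) \<partial>circ) = complex_of_real (anti g x)"
      using that by (subst integral_complex_of_real) (simp add: anti_eq_circ)
    finally show ?thesis .
  qed
  have in2: "(\<integral>x. D x u \<partial>circ) = complex_of_real (g u) * ((cis (- (of_int k * u)) - cis (- (of_int k * pi))) / (\<i> * of_int k))"
    if "u \<in> space circ" for u
  proof -
    have "(\<integral>x. D x u \<partial>circ) = complex_of_real (g u) * (\<integral>x. indicator {u..pi} x *\<^sub>R cis (of_int (-k) * x) \<partial>circ)"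
      by (subst integral_mult_right_zero[symmetric], rule Bochner_Integration.integral_cong) (auto simp: D_def indicator_def)
    also have "(\<integral>x. indicator {u..pi} x *\<^sub>R cis (of_int (-k) * x) \<partial>circ) = (LINT x:{u..pi}|lborel. cis (of_int (-k) * x))"
      unfolding integral_circ_eq set_lebesgue_integral_def
      by (rule Bochner_Integration.integral_cong) (use that in \<open>auto simp: indicator_def\<close>)
    also have "\<dots> = (cis (- (of_int k * u)) - cis (- (of_int k * pi))) / (\<i> * of_int k)"
      using k that by (subst integral_cis_interval) (auto simp: field_simps)
    finally show ?thesis .
  qed
  have "(\<integral>x. complex_of_real (anti g x) * cis (- (of_int k * x)) \<partial>circ) = (\<integral>x. \<integral>u. D x u \<partial>circ \<partial>circ)"
    by (rule Bochner_Integration.integral_cong) (auto simp: in1 mult.commute)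
  also have "\<dots> = (\<integral>u. \<integral>x. D x u \<partial>circ \<partial>circ)"
    using circ_circ.Fubini_integral[OF Di] by simp
  also have "\<dots> = (\<integral>u. (complex_of_real (g u) * cis (- (of_int k * u)) - complex_of_real (g u) * cis (- (of_int k * pi))) / (\<i> * of_int k) \<partial>circ)"
    by (rule Bochner_Integration.integral_cong) (auto simp: in2 algebra_simps)
  also have "\<dots> = ((\<integral>u. complex_of_real (g u) * cis (- (of_int k * u)) \<partial>circ) - (\<integral>u. complex_of_real (g u) \<partial>circ) * cis (- (of_int k * pi))) / (\<i> * of_int k)"
  proof -
    have "integrable circ (\<lambda>u. complex_of_real (g u) * cis (- (of_int k * u)))"
      using integrable_circ_cis[OF gi, of "- of_int k"] by simp
    moreover have "integrable circ (\<lambda>u. complex_of_real (g u))" using gi by simp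
    ultimately show ?thesis by simp
  qed
  finally show ?thesis
    unfolding fourier_coeff_circ by (simp add: field_simps)
qed

lemma fourier_coeff_0: "fourier_coeff h 0 = complex_of_real ((1 / (2 * pi)) * (\<integral>x. h x \<partial>circ))"
  by (simp add: fourier_coeff_circ)

lemma fourier_coeff_lincomb:
  assumes "integrable circ u" "integrable circ v"
  shows "fourier_coeff (\<lambda>x. a * u x + b * v x) k = of_real a * fourier_coeff u k + of_real b * fourier_coeff v k"
proof -
  have "integrable circ (\<lambda>x. complex_of_real (u x) * cis (- (of_int k * x)))" "integrable circ (\<lambda>x. complex_of_real (v x) * cis (- (of_int k * x)))"
    using integrable_circ_cis[OF assms(1), of "- of_int k"] integrable_circ_cis[OF assms(2), of "- of_int k"] by simp_all
  then have "(\<integral>x. of_real a * (complex_of_real (u x) * cis (- (of_int k * x))) + of_real b * (complex_of_real (v x) * cis (- (of_int k * x))) \<partial>circ)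
    = of_real a * (\<integral>x. complex_of_real (u x) * cis (- (of_int k * x)) \<partial>circ) + of_real b * (\<integral>x. complex_of_real (v x) * cis (- (of_int k * x)) \<partial>circ)"
    by simp
  then show ?thesis unfolding fourier_coeff_circ by (simp add: algebra_simps)
qed

lemma fourier_coeff_const: "fourier_coeff (\<lambda>x. c) k = (if k = 0 then of_real c else 0)"
proof -
  have "(\<integral>x. complex_of_real c * cis (of_int (- k) * x) \<partial>circ) = complex_of_real c * (if k = 0 then 2 * pi else 0)"
    unfolding integral_mult_right_zero integral_cis_circ by simp
  then have "(\<integral>x. complex_of_real c * cis (- (of_int k * x)) \<partial>circ) = complex_of_real c * (if k = 0 then 2 * pi else 0)"
    by simp
  then show ?thesis unfolding fourier_coeff_circ by (simp only:) simp
qed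

lemma fourier_coeff_cong_AE:
  assumes "integrable circ u" "integrable circ v" "AE x in circ. u x = v x"
  shows "fourier_coeff u k = fourier_coeff v k"
proof -
  have "(\<integral>x. complex_of_real (u x) * cis (- (of_int k * x)) \<partial>circ) = (\<integral>x. complex_of_real (v x) * cis (- (of_int k * x)) \<partial>circ)"
    using integrable_circ_cis[OF assms(1), of "- of_int k"] integrable_circ_cis[OF assms(2), of "- of_int k"] assms(3)
    by (intro integral_cong_AE) (auto elim!: eventually_mono)
  then show ?thesis by (simp add: fourier_coeff_circ)
qed

text \<open>By integration by parts the antiderivative, minus its mean, also has vanishing coefficients;
  being continuous it is constant.\<close>

lemma fourier_unique:
  assumes hi: "integrable circ h" and z: "\<And>k. fourier_coeff h k = 0"
  shows "AE x in circ. h x = 0"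
proof -
  have Hi: "integrable circ (anti h)"
    unfolding integrable_circ_iff by (rule borel_integrable_atLeastAtMost'[OF continuous_anti[OF hi]])
  define c where "c = (1 / (2 * pi)) * (\<integral>x. anti h x \<partial>circ)"
  define H where "H x = 1 * anti h x + (-1) * c" for x
  have Hz: "fourier_coeff H k = 0" for k
    unfolding H_def[abs_def] using z
    by (subst fourier_coeff_lincomb[OF Hi, of "\<lambda>x. c"])
       (cases "k = 0", auto simp: fourier_coeff_const fourier_coeff_anti[OF hi] fourier_coeff_0[of "anti h"] c_def)
  have "(\<integral>x. h x \<partial>circ) = 0" using z[of 0] by (simp add: fourier_coeff_0)
  then have Hp: "H (-pi) = H pi" by (simp add: H_def anti_pi)
  have Hc: "continuous_on {-pi..pi} H" unfolding H_def[abs_def] by (intro continuous_intros continuous_anti hi)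
  have H0: "H x = 0" if "x \<in> {-pi..pi}" for x
    by (rule fourier_unique_continuous[OF Hc Hp Hz that])
  have "c = 0" using H0[of "-pi"] by (simp add: H_def)
  then show ?thesis using H0 by (intro anti_eq_0_imp_AE[OF hi]) (simp add: H_def)
qed

section \<open>Riesz-Fischer theorem and weak derivatives\<close>

definition tp :: "int set \<Rightarrow> (int \<Rightarrow> complex) \<Rightarrow> real \<Rightarrow> complex" where
  "tp I c x = (\<Sum>k\<in>I. c k * cis (of_int k * x))"

lemma tp_measurable [measurable]: "tp I c \<in> borel_measurable borel"
  unfolding tp_def[abs_def]
  by (intro borel_measurable_continuous_onI continuous_intros)

lemma norm_tp_le: "cmod (tp I c x) \<le> (\<Sum>k\<in>I. cmod (c k))"
  unfolding tp_def by (rule order_trans[OF norm_sum]) (simp add: norm_mult)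

lemma L2_Re_tp: "(\<lambda>x. Re (tp I c x)) \<in> L2"
  by (rule L2_bounded[where B="\<Sum>k\<in>I. cmod (c k)"])
     (auto intro: order_trans[OF abs_Re_le_cmod norm_tp_le])

lemma integral_tp_cis:
  fixes c :: "int \<Rightarrow> complex"
  assumes "finite I"
  shows "(\<integral>x. tp I c x * cis (- (of_int k * x)) \<partial>circ) = (if k \<in> I then 2 * pi * c k else 0)"
proof -
  have "tp I c x * cis (- (of_int k * x)) = (\<Sum>j\<in>I. c j * cis (of_int (j - k) * x))" for x
    by (simp add: tp_def sum_distrib_right cis_mult mult.assoc left_diff_distrib)
  then have "(\<integral>x. tp I c x * cis (- (of_int k * x)) \<partial>circ) = (\<Sum>j\<in>I. c j * of_real (if j - k = 0 then 2 * pi else 0))"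
    by (simp only:) (subst Bochner_Integration.integral_sum,
      auto intro!: sum.cong integrable_mult_right integrable_circ_cis' simp only: integral_mult_right_zero integral_cis_circ)
  also have "\<dots> = (\<Sum>j\<in>I. if k = j then c j * of_real (2 * pi) else 0)"
    by (rule sum.cong) auto
  also have "\<dots> = (if k \<in> I then 2 * pi * c k else 0)"
    using assms by (simp add: sum.delta' mult.commute)
  finally show ?thesis .
qed

text \<open>The coefficients \<open>c\<close> are arbitrary on purpose: the Fourier coefficients of
  \<open>h\<close> give Bessel's inequality, and \<open>h = 0\<close> gives the norm of the
  polynomial itself.\<close>

lemma
  assumes h: "h \<in> L2" and I: "finite I"
  shows integrable_L2_minus_tp: "integrable circ (\<lambda>x. (cmod (complex_of_real (h x) - tp I c x))\<^sup>2)"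
    and integral_L2_minus_tp: "(\<integral>x. (cmod (complex_of_real (h x) - tp I c x))\<^sup>2 \<partial>circ)
      = qn h - 4 * pi * (\<Sum>k\<in>I. Re (cnj (c k) * fourier_coeff h k)) + 2 * pi * (\<Sum>k\<in>I. (cmod (c k))\<^sup>2)"
proof -
  have eq: "(cmod (complex_of_real (h x) - tp I c x))\<^sup>2
      = (h x)\<^sup>2 - 2 * Re (\<Sum>k\<in>I. cnj (c k) * (complex_of_real (h x) * cis (- (of_int k * x))))
        + Re (\<Sum>k\<in>I. cnj (c k) * (tp I c x * cis (- (of_int k * x))))" for x
  proof -
    have ct: "cnj (tp I c x) = (\<Sum>k\<in>I. cnj (c k) * cis (- (of_int k * x)))"
      by (simp add: tp_def cis_cnj)
    have "(\<Sum>k\<in>I. cnj (c k) * (complex_of_real (h x) * cis (- (of_int k * x)))) = complex_of_real (h x) * cnj (tp I c x)"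
      unfolding ct sum_distrib_left by (rule sum.cong) (auto simp: mult_ac)
    moreover have "(\<Sum>k\<in>I. cnj (c k) * (tp I c x * cis (- (of_int k * x)))) = tp I c x * cnj (tp I c x)"
      unfolding ct sum_distrib_left by (rule sum.cong) (auto simp: mult_ac)
    ultimately show ?thesis
      by (simp only: cmod_power2) (simp add: power2_eq_square algebra_simps)
  qed
  have hi: "integrable circ (\<lambda>x. complex_of_real (h x) * cis (- (of_int k * x)))" for k
    using integrable_circ_cis[OF L2_integrable[OF h], of "- of_int k"] by simp
  have ti: "integrable circ (\<lambda>x. tp I c x * cis (- (of_int k * x)))" for k
  proof (rule integrable_circ_bounded)
    have "(\<lambda>x. cis (- (of_int k * x))) \<in> borel_measurable borel"
      by (intro borel_measurable_continuous_onI continuous_intros)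
    then show "(\<lambda>x. tp I c x * cis (- (of_int k * x))) \<in> borel_measurable borel" by measurable
    show "norm (tp I c x * cis (- (of_int k * x))) \<le> (\<Sum>k\<in>I. cmod (c k))" for x
      by (simp add: norm_mult norm_tp_le)
  qed
  have i1: "integrable circ (\<lambda>x. \<Sum>k\<in>I. cnj (c k) * (complex_of_real (h x) * cis (- (of_int k * x))))"
    by (intro Bochner_Integration.integrable_sum integrable_mult_right hi)
  have i2: "integrable circ (\<lambda>x. \<Sum>k\<in>I. cnj (c k) * (tp I c x * cis (- (of_int k * x))))"
    by (intro Bochner_Integration.integrable_sum integrable_mult_right ti)
  show "integrable circ (\<lambda>x. (cmod (complex_of_real (h x) - tp I c x))\<^sup>2)"
    unfolding eq by (intro Bochner_Integration.integrable_add Bochner_Integration.integrable_diff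
        integrable_mult_right integrable_Re L2_sq_integrable h i1 i2)
  have "(\<integral>x. (cmod (complex_of_real (h x) - tp I c x))\<^sup>2 \<partial>circ)
      = qn h - 2 * Re (\<integral>x. (\<Sum>k\<in>I. cnj (c k) * (complex_of_real (h x) * cis (- (of_int k * x)))) \<partial>circ)
        + Re (\<integral>x. (\<Sum>k\<in>I. cnj (c k) * (tp I c x * cis (- (of_int k * x)))) \<partial>circ)"
    unfolding eq
    using L2_sq_integrable[OF h] integrable_Re[OF i1] integrable_Re[OF i2] integral_Re[OF i1] integral_Re[OF i2]
    by (simp add: qn_def del: Re_sum)
  also have "(\<integral>x. (\<Sum>k\<in>I. cnj (c k) * (complex_of_real (h x) * cis (- (of_int k * x)))) \<partial>circ)
      = (\<Sum>k\<in>I. cnj (c k) * (2 * pi * fourier_coeff h k))"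
    by (subst Bochner_Integration.integral_sum)
       (auto intro!: integrable_mult_right hi sum.cong simp: fourier_coeff_circ)
  also have "(\<integral>x. (\<Sum>k\<in>I. cnj (c k) * (tp I c x * cis (- (of_int k * x)))) \<partial>circ)
      = (\<Sum>k\<in>I. cnj (c k) * (2 * pi * c k))"
    by (subst Bochner_Integration.integral_sum)
       (auto intro!: integrable_mult_right ti sum.cong simp: integral_tp_cis[OF I])
  also have "Re (\<Sum>k\<in>I. cnj (c k) * (2 * pi * fourier_coeff h k)) = 2 * pi * (\<Sum>k\<in>I. Re (cnj (c k) * fourier_coeff h k))"
    unfolding Re_sum sum_distrib_left by (rule sum.cong) (auto simp: algebra_simps)
  also have "Re (\<Sum>k\<in>I. cnj (c k) * (2 * pi * c k)) = 2 * pi * (\<Sum>k\<in>I. (cmod (c k))\<^sup>2)"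
    unfolding Re_sum sum_distrib_left cmod_power2 by (rule sum.cong) (auto simp: algebra_simps power2_eq_square)
  finally show "(\<integral>x. (cmod (complex_of_real (h x) - tp I c x))\<^sup>2 \<partial>circ)
      = qn h - 4 * pi * (\<Sum>k\<in>I. Re (cnj (c k) * fourier_coeff h k)) + 2 * pi * (\<Sum>k\<in>I. (cmod (c k))\<^sup>2)"
    by simp
qed

lemma Re_cnj_self: "Re (cnj z * z) = (cmod z)\<^sup>2"
  by (simp only: cmod_power2) (simp add: power2_eq_square)

lemma Bessel:
  assumes h: "h \<in> L2" and I: "finite I"
  shows "2 * pi * (\<Sum>k\<in>I. (cmod (fourier_coeff h k))\<^sup>2) \<le> qn h"
proof -
  have "0 \<le> (\<integral>x. (cmod (complex_of_real (h x) - tp I (fourier_coeff h) x))\<^sup>2 \<partial>circ)" by simp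
  then show ?thesis unfolding integral_L2_minus_tp[OF h I] Re_cnj_self by simp
qed

text \<open>The expansion above with \<open>h = 0\<close>; passing to the real part can only lower
  the norm.\<close>

lemma qn_Re_tp_le:
  assumes "finite I" shows "qn (\<lambda>x. Re (tp I c x)) \<le> 2 * pi * (\<Sum>k\<in>I. (cmod (c k))\<^sup>2)"
proof -
  have "qn (\<lambda>x. Re (tp I c x)) \<le> (\<integral>x. (cmod (complex_of_real 0 - tp I c x))\<^sup>2 \<partial>circ)"
    unfolding qn_def
    using integrable_L2_minus_tp[OF L2_const[of 0] assms, of c] L2_sq_integrable[OF L2_Re_tp, of I c]
    by (intro integral_mono) (auto simp: cmod_power2)
  also have "\<dots> = 2 * pi * (\<Sum>k\<in>I. (cmod (c k))\<^sup>2)"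
    using integral_L2_minus_tp[OF L2_const[of 0] assms, of c] by (simp add: qn_def fourier_coeff_const cong: if_cong)
  finally show ?thesis .
qed

text \<open>The condition under which a trigonometric polynomial over a symmetric set of frequencies
  is real-valued.\<close>

definition conj_symm :: "(int \<Rightarrow> complex) \<Rightarrow> bool" where
  "conj_symm c \<longleftrightarrow> (\<forall>k. c (- k) = cnj (c k))"

lemma conj_symm_fourier_coeff: "conj_symm (fourier_coeff h)"
proof -
  have "cnj (\<integral>x. complex_of_real (h x) * cis (- (of_int k * x)) \<partial>circ) = (\<integral>x. complex_of_real (h x) * cis (of_int k * x) \<partial>circ)" for k
    by (subst Bochner_Integration.integral_cnj[symmetric]) (simp add: cis_cnj)
  then show ?thesis unfolding conj_symm_def fourier_coeff_circ by simp
qed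

lemma tp_real:
  assumes "conj_symm c" "uminus ` I = I"
  shows "complex_of_real (Re (tp I c x)) = tp I c x"
proof -
  have "cnj (tp I c x) = (\<Sum>k\<in>I. c (- k) * cis (of_int (- k) * x))"
    using assms(1) by (simp add: tp_def cis_cnj conj_symm_def)
  also have "\<dots> = (\<Sum>k\<in>uminus ` I. c k * cis (of_int k * x))"
    by (subst sum.reindex) auto
  finally have "cnj (tp I c x) = tp I c x" by (simp add: assms(2) tp_def)
  then show ?thesis by (metis Reals_cnj_iff of_real_Re)
qed

lemma fourier_coeff_Re_tp:
  assumes "conj_symm c" "uminus ` I = I" "finite I"
  shows "fourier_coeff (\<lambda>x. Re (tp I c x)) k = (if k \<in> I then c k else 0)"
  unfolding fourier_coeff_circ tp_real[OF assms(1,2)] integral_tp_cis[OF assms(3)] by simp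

lemma qn_minus_Re_tp:
  assumes "h \<in> L2" "conj_symm c" "uminus ` I = I" "finite I"
  shows "qn (\<lambda>x. h x - Re (tp I c x)) = qn h - 4 * pi * (\<Sum>k\<in>I. Re (cnj (c k) * fourier_coeff h k)) + 2 * pi * (\<Sum>k\<in>I. (cmod (c k))\<^sup>2)"
proof -
  have "(cmod (complex_of_real (h x) - tp I c x))\<^sup>2 = (h x - Re (tp I c x))\<^sup>2" for x
    by (subst tp_real[OF assms(2,3), symmetric]) (simp only: of_real_diff[symmetric] norm_of_real power2_abs)
  then show ?thesis
    using integral_L2_minus_tp[OF assms(1,4), of c] by (simp add: qn_def)
qed

abbreviation band :: "nat \<Rightarrow> int set" where "band N \<equiv> {- int N..int N}"

lemma uminus_band: "uminus ` band N = band N"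
  by (auto simp: image_iff intro!: bexI[of _ "- x" for x])

lemma finite_subset_band: "finite I \<Longrightarrow> \<exists>N. I \<subseteq> band N"
proof (induction rule: finite_induct)
  case (insert k I)
  then obtain N where "I \<subseteq> band N" by blast
  then have "insert k I \<subseteq> band (max N (nat \<bar>k\<bar>))" by (auto simp: subset_iff) 
  then show ?case by blast
qed auto

text \<open>Cutting the frequencies into blocks of energy at most 16^(-j) makes
  \<open>L2_series_complete\<close> applicable and yields a limit along a subsequence. Its
  coefficients are then identified, and the error of the symmetric partial sums is seen to decrease,
  so the whole sequence converges.\<close>

lemma Riesz_Fischer:
  assumes s: "(\<lambda>k. (cmod (c k))\<^sup>2) summable_on UNIV" and sy: "conj_symm c"
  shows "\<exists>g\<in>L2. (\<forall>k. fourier_coeff g k = c k) \<and> (\<lambda>N. qn (\<lambda>x. g x - Re (tp (band N) c x))) \<longlonglongrightarrow> 0"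
proof -
  define S where "S = (\<Sum>\<^sub>\<infinity>k. (cmod (c k))\<^sup>2)"
  have fin_le: "(\<Sum>k\<in>I. (cmod (c k))\<^sup>2) \<le> S" if "finite I" for I
    unfolding S_def by (rule finite_sum_le_infsum[OF s that]) auto
  have "\<exists>N. \<forall>I. finite I \<and> I \<inter> band N = {} \<longrightarrow> (\<Sum>k\<in>I. (cmod (c k))\<^sup>2) \<le> 1 / 16 ^ j" for j :: nat
  proof -
    have "(1::real) / 16 ^ j > 0" by simp
    then obtain F where F: "finite F" "dist (\<Sum>k\<in>F. (cmod (c k))\<^sup>2) S \<le> 1 / 16 ^ j"
      using infsum_finite_approximation[OF s, of "1 / 16 ^ j"] by (auto simp: S_def)
    obtain N where N: "F \<subseteq> band N" using finite_subset_band[OF F(1)] by blast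
    have "(\<Sum>k\<in>I. (cmod (c k))\<^sup>2) \<le> 1 / 16 ^ j" if I: "finite I" "I \<inter> band N = {}" for I
    proof -
      have "(\<Sum>k\<in>I. (cmod (c k))\<^sup>2) + (\<Sum>k\<in>F. (cmod (c k))\<^sup>2) = (\<Sum>k\<in>I \<union> F. (cmod (c k))\<^sup>2)"
        using I F(1) N by (subst sum.union_disjoint) auto
      also have "\<dots> \<le> S" using I F by (intro fin_le) auto
      finally show ?thesis using F(2) by (auto simp: dist_real_def)
    qed
    then show ?thesis by blast
  qed
  then obtain N0 where N0: "\<And>j I. finite I \<Longrightarrow> I \<inter> band (N0 j) = {} \<Longrightarrow> (\<Sum>k\<in>I. (cmod (c k))\<^sup>2) \<le> 1 / 16 ^ j"
    by metis
  \<comment> \<open>The sum makes the cut-offs monotone and at least \<open>N0 j\<close>; adding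
    \<open>j\<close> makes them exhaust all frequencies.\<close>
  define N where "N j = (\<Sum>i\<le>j. N0 i) + j" for j
  have NN0: "N0 j \<le> N j" for j
    unfolding N_def by (rule trans_le_add1) (rule member_le_sum, auto)
  have Nmono: "N j \<le> N (Suc j)" for j by (simp add: N_def)
  have Nj: "j \<le> N j" for j by (simp add: N_def)
  define p where "p j x = Re (tp (band (N j)) c x)" for j x
  have pL2: "p j \<in> L2" for j unfolding p_def by (rule L2_Re_tp)
  define u where "u j x = (case j of 0 \<Rightarrow> p 0 x | Suc i \<Rightarrow> p (Suc i) x - p i x)" for j x
  have uS: "u (Suc j) = (\<lambda>x. Re (tp (band (N (Suc j)) - band (N j)) c x))" for j
  proof
    fix x
    have "tp (band (N (Suc j)) - band (N j)) c x = tp (band (N (Suc j))) c x - tp (band (N j)) c x"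
      unfolding tp_def by (rule sum_diff) (use Nmono[of j] in auto)
    then show "u (Suc j) x = Re (tp (band (N (Suc j)) - band (N j)) c x)" by (simp add: u_def p_def)
  qed
  have usum: "(\<Sum>j<Suc n. u j x) = p n x" for n x
    by (induction n) (auto simp: u_def)
  have uL2: "u j \<in> L2" for j
    by (cases j) (auto simp: u_def[abs_def] intro: pL2 L2_diff[OF pL2 pL2])
  \<comment> \<open>\<open>S\<close> covers the initial block; the 16 compensates the index shift,
    as block \<open>Suc i\<close> is only known to have energy 16^(-i).\<close>
  have uq: "qn (u j) \<le> (2 * pi * (S + 16)) / 16 ^ j" for j
  proof (cases j)
    case 0
    have "u 0 = (\<lambda>x. Re (tp (band (N 0)) c x))" by (simp add: u_def p_def fun_eq_iff)
    then have "qn (u 0) \<le> 2 * pi * (\<Sum>k\<in>band (N 0). (cmod (c k))\<^sup>2)" using qn_Re_tp_le[of "band (N 0)" c] by simp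
    also have "\<dots> \<le> 2 * pi * (S + 16)" using fin_le[of "band (N 0)"] by (intro mult_left_mono) auto
    finally show ?thesis using 0 by simp
  next
    case (Suc i)
    have "qn (u j) \<le> 2 * pi * (\<Sum>k\<in>band (N (Suc i)) - band (N i). (cmod (c k))\<^sup>2)"
      unfolding Suc uS by (rule qn_Re_tp_le) simp
    also have "\<dots> \<le> 2 * pi * (1 / 16 ^ i)"
      by (intro mult_left_mono N0) (use NN0[of i] in auto)
    also have "\<dots> = (2 * pi * 16) / 16 ^ j" using Suc by simp
    also have "\<dots> \<le> (2 * pi * (S + 16)) / 16 ^ j"
      using fin_le[of "{}"] by (intro divide_right_mono mult_left_mono) auto
    finally show ?thesis .
  qed
  obtain g where g: "g \<in> L2" "(\<lambda>n. qn (\<lambda>x. g x - (\<Sum>j<n. u j x))) \<longlonglongrightarrow> 0"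
    using L2_series_complete[OF uL2 uq] by blast
  have gp: "(\<lambda>n. qn (\<lambda>x. g x - p n x)) \<longlonglongrightarrow> 0"
    using LIMSEQ_Suc[OF g(2)] by (simp only: usum)
  have gc: "fourier_coeff g k = c k" for k
  proof -
    \<comment> \<open>Bessel's inequality at the single frequency \<open>k\<close>, once the partial
      sum contains it.\<close>
    have le: "2 * pi * (cmod (fourier_coeff g k - c k))\<^sup>2 \<le> qn (\<lambda>x. g x - p n x)" if "n \<ge> nat \<bar>k\<bar>" for n
    proof -
      have "fourier_coeff (\<lambda>x. 1 * g x + (-1) * p n x) k = fourier_coeff g k - fourier_coeff (p n) k"
        by (subst fourier_coeff_lincomb) (auto intro: L2_integrable g pL2)
      also have "fourier_coeff (p n) k = c k"
        unfolding p_def[abs_def] using that Nj[of n]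
        by (subst fourier_coeff_Re_tp[OF sy uminus_band]) auto
      finally show ?thesis
        using Bessel[OF L2_diff[OF g(1) pL2[of n]], of "{k}"] by simp
    qed
    have "2 * pi * (cmod (fourier_coeff g k - c k))\<^sup>2 \<le> 0"
      by (rule tendsto_lowerbound[OF gp]) (use le in \<open>auto simp: eventually_sequentially\<close>)
    then show ?thesis using pi_gt_zero by (auto simp: mult_le_0_iff)
  qed
  have form: "qn (\<lambda>x. g x - Re (tp (band n) c x)) = qn g - 2 * pi * (\<Sum>k\<in>band n. (cmod (c k))\<^sup>2)" for n
    by (subst qn_minus_Re_tp[OF g(1) sy uminus_band]) (simp, simp only: gc Re_cnj_self)
  \<comment> \<open>Monotonicity of the error upgrades convergence along the cut-offs
    \<open>N n\<close> to convergence of the full sequence.\<close>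
  have dec: "qn (\<lambda>x. g x - Re (tp (band m) c x)) \<le> qn (\<lambda>x. g x - Re (tp (band n) c x))" if "n \<le> m" for n m
    unfolding form using that by (auto intro!: sum_mono2)
  have "(\<lambda>n. qn (\<lambda>x. g x - Re (tp (band n) c x))) \<longlonglongrightarrow> 0"
  proof (rule LIMSEQ_I)
    fix e :: real assume "e > 0"
    then obtain n where "qn (\<lambda>x. g x - p n x) < e"
      using LIMSEQ_D[OF gp, of e] by auto
    then have "norm (qn (\<lambda>x. g x - Re (tp (band m) c x)) - 0) < e" if "m \<ge> N n" for m
      using dec[OF that] by (simp add: p_def)
    then show "\<exists>no. \<forall>n\<ge>no. norm (qn (\<lambda>x. g x - Re (tp (band n) c x)) - 0) < e" by blast
  qed
  then show ?thesis using g(1) gc by blast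
qed

lemma summable_fourier_coeff:
  assumes "h \<in> L2" shows "(\<lambda>k. (cmod (fourier_coeff h k))\<^sup>2) summable_on UNIV"
proof (rule nonneg_bounded_partial_sums_imp_summable_on)
  show "\<forall>\<^sub>F F in finite_subsets_at_top UNIV. (\<Sum>k\<in>F. (cmod (fourier_coeff h k))\<^sup>2) \<le> qn h / (2 * pi)"
    using Bessel[OF assms] by (intro eventually_finite_subsets_at_top_weakI) (simp add: field_simps)
qed auto

lemma fourier_series_converges:
  assumes h: "h \<in> L2"
  shows "(\<lambda>N. qn (\<lambda>x. h x - Re (tp (band N) (fourier_coeff h) x))) \<longlonglongrightarrow> 0"
proof -
  obtain g where g: "g \<in> L2" "\<And>k. fourier_coeff g k = fourier_coeff h k"
    "(\<lambda>N. qn (\<lambda>x. g x - Re (tp (band N) (fourier_coeff h) x))) \<longlonglongrightarrow> 0"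
    using Riesz_Fischer[OF summable_fourier_coeff[OF h] conj_symm_fourier_coeff] by blast
  have "AE x in circ. 1 * g x + (-1) * h x = 0"
  proof (rule fourier_unique)
    show "integrable circ (\<lambda>x. 1 * g x + (-1) * h x)" by (simp add: L2_integrable g h)
    show "fourier_coeff (\<lambda>x. 1 * g x + (-1) * h x) k = 0" for k
      by (subst fourier_coeff_lincomb) (simp_all add: L2_integrable g h)
  qed
  then have ae: "AE x in circ. g x = h x" by eventually_elim simp
  have "qn (\<lambda>x. h x - Re (tp (band N) (fourier_coeff h) x)) = qn (\<lambda>x. g x - Re (tp (band N) (fourier_coeff h) x))" for N
    by (rule qn_cong_AE) (use ae in \<open>auto intro!: L2_diff L2_Re_tp h g(1) elim!: eventually_mono\<close>)
  then show ?thesis using g(3) by simp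
qed

lemma Parseval:
  assumes h: "h \<in> L2" shows "2 * pi * (\<Sum>\<^sub>\<infinity>k. (cmod (fourier_coeff h k))\<^sup>2) = qn h"
proof (rule antisym)
  have "(\<Sum>\<^sub>\<infinity>k. (cmod (fourier_coeff h k))\<^sup>2) \<le> qn h / (2 * pi)"
    by (rule infsum_le_finite_sums[OF summable_fourier_coeff[OF h]])
       (use Bessel[OF h] in \<open>simp add: field_simps\<close>)
  then show "2 * pi * (\<Sum>\<^sub>\<infinity>k. (cmod (fourier_coeff h k))\<^sup>2) \<le> qn h" by (simp add: field_simps)
  have "qn h - 2 * pi * (\<Sum>\<^sub>\<infinity>k. (cmod (fourier_coeff h k))\<^sup>2) \<le> qn (\<lambda>x. h x - Re (tp (band N) (fourier_coeff h) x))" for N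
  proof -
    have "(\<Sum>k\<in>band N. (cmod (fourier_coeff h k))\<^sup>2) \<le> (\<Sum>\<^sub>\<infinity>k. (cmod (fourier_coeff h k))\<^sup>2)"
      by (rule finite_sum_le_infsum[OF summable_fourier_coeff[OF h]]) auto
    then show ?thesis
      by (subst qn_minus_Re_tp[OF h conj_symm_fourier_coeff uminus_band]) (simp, simp only: Re_cnj_self, simp)
  qed
  then have "qn h - 2 * pi * (\<Sum>\<^sub>\<infinity>k. (cmod (fourier_coeff h k))\<^sup>2) \<le> 0"
    by (intro tendsto_lowerbound[OF fourier_series_converges[OF h]]) auto
  then show "qn h \<le> 2 * pi * (\<Sum>\<^sub>\<infinity>k. (cmod (fourier_coeff h k))\<^sup>2)" by simp
qed

text \<open>H^1 in antiderivative form, so that Fubini replaces test functions. Mean zero of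
  \<open>g\<close> encodes periodicity: it makes \<open>anti g\<close> return to 0 at
  \<open>pi\<close>.\<close>

definition weak_deriv :: "(real \<Rightarrow> real) \<Rightarrow> (real \<Rightarrow> real) \<Rightarrow> bool" where
  "weak_deriv \<xi> g \<longleftrightarrow> \<xi> \<in> L2 \<and> g \<in> L2h \<and> (\<exists>c. AE x in circ. \<xi> x = c + anti g x)"

lemma integrable_anti: "integrable circ g \<Longrightarrow> integrable circ (anti g)"
  unfolding integrable_circ_iff by (rule borel_integrable_atLeastAtMost'[OF continuous_anti]) (simp add: integrable_circ_iff)

lemma fourier_coeff_anti_L2h:
  assumes "g \<in> L2h" "k \<noteq> 0"
  shows "fourier_coeff (anti g) k = fourier_coeff g k / (\<i> * of_int k)"
  using assms by (simp add: fourier_coeff_anti L2_integrable L2h_def fourier_coeff_0)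

lemma fourier_coeff_weak_deriv:
  assumes "weak_deriv \<xi> g" shows "fourier_coeff g k = \<i> * of_int k * fourier_coeff \<xi> k"
proof (cases "k = 0")
  case True
  then show ?thesis using assms by (simp add: weak_deriv_def L2h_def fourier_coeff_0)
next
  case False
  obtain c where c: "AE x in circ. \<xi> x = 1 * c + 1 * anti g x" using assms by (auto simp: weak_deriv_def)
  have g: "integrable circ g" "g \<in> L2h" and x: "integrable circ \<xi>"
    using assms by (auto simp: weak_deriv_def L2h_def L2_integrable)
  have "fourier_coeff \<xi> k = fourier_coeff (\<lambda>x. 1 * c + 1 * anti g x) k"
    by (rule fourier_coeff_cong_AE[OF x _ c]) (use integrable_anti[OF g(1)] in auto)
  also have "\<dots> = fourier_coeff g k / (\<i> * of_int k)"
    by (subst fourier_coeff_lincomb) (use False integrable_anti[OF g(1)] in \<open>auto simp: fourier_coeff_const fourier_coeff_anti_L2h g\<close>)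
  finally show ?thesis using False by simp
qed

text \<open>Riesz-Fischer supplies \<open>g\<close> with the coefficients of the formal derivative;
  uniqueness of Fourier coefficients then shows that \<xi> minus \<open>anti g\<close> is almost
  everywhere constant.\<close>

lemma weak_deriv_exists:
  assumes x: "\<xi> \<in> L2" and s: "(\<lambda>k. (of_int k)\<^sup>2 * (cmod (fourier_coeff \<xi> k))\<^sup>2) summable_on UNIV"
  shows "\<exists>g. weak_deriv \<xi> g"
proof -
  have "(cmod (\<i> * of_int k * fourier_coeff \<xi> k))\<^sup>2 = (of_int k)\<^sup>2 * (cmod (fourier_coeff \<xi> k))\<^sup>2" for k
    by (simp add: norm_mult power_mult_distrib)
  then have "(\<lambda>k. (cmod (\<i> * of_int k * fourier_coeff \<xi> k))\<^sup>2) summable_on UNIV" using s by simp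
  moreover have "conj_symm (\<lambda>k. \<i> * of_int k * fourier_coeff \<xi> k)"
    using conj_symm_fourier_coeff[of \<xi>] by (simp add: conj_symm_def)
  ultimately obtain g where g: "g \<in> L2" "\<And>k. fourier_coeff g k = \<i> * of_int k * fourier_coeff \<xi> k"
    using Riesz_Fischer[of "\<lambda>k. \<i> * of_int k * fourier_coeff \<xi> k"] by blast
  have "(\<integral>x. g x \<partial>circ) = 0" using g(2)[of 0] by (simp add: fourier_coeff_0)
  then have gh: "g \<in> L2h" using g by (simp add: L2h_def)
  have ai: "integrable circ (anti g)" by (rule integrable_anti[OF L2_integrable[OF g(1)]])
  \<comment> \<open>The difference of the means, so that the zeroth coefficient cancels too.\<close>
  define c where "c = (1 / (2 * pi)) * (\<integral>x. \<xi> x \<partial>circ) - (1 / (2 * pi)) * (\<integral>x. anti g x \<partial>circ)"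
  have i1: "integrable circ (\<lambda>x. 1 * \<xi> x + (-1) * anti g x)" using L2_integrable[OF x] ai by simp
  have "AE x in circ. 1 * (1 * \<xi> x + (-1) * anti g x) + (-1) * c = 0"
  proof (rule fourier_unique)
    show "integrable circ (\<lambda>x. 1 * (1 * \<xi> x + (-1) * anti g x) + (-1) * c)" using i1 by simp
    show "fourier_coeff (\<lambda>x. 1 * (1 * \<xi> x + (-1) * anti g x) + (-1) * c) k = 0" for k
    proof -
      have *: "fourier_coeff (\<lambda>x. 1 * \<xi> x + (-1) * anti g x) k
          = of_real 1 * fourier_coeff \<xi> k + of_real (-1) * fourier_coeff (anti g) k"
        by (rule fourier_coeff_lincomb[OF L2_integrable[OF x] ai])
      have "fourier_coeff (\<lambda>x. 1 * (1 * \<xi> x + (-1) * anti g x) + (-1) * c) k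
          = of_real 1 * fourier_coeff (\<lambda>x. 1 * \<xi> x + (-1) * anti g x) k + of_real (-1) * fourier_coeff (\<lambda>x. c) k"
        by (rule fourier_coeff_lincomb[OF i1]) simp
      also have "\<dots> = 0"
        unfolding * fourier_coeff_const
        by (cases "k = 0") (auto simp: fourier_coeff_0 c_def g fourier_coeff_anti_L2h[OF gh])
      finally show ?thesis .
    qed
  qed
  then have "AE x in circ. \<xi> x = c + anti g x" by eventually_elim simp
  then show ?thesis using x gh by (auto simp: weak_deriv_def)
qed

lemma weak_deriv_norm:
  assumes w: "weak_deriv \<xi> g"
  shows "sob_weight 1 \<xi> summable_on UNIV" "(Hs_norm 1 \<xi>)\<^sup>2 = qn \<xi> + qn g"
proof -
  have x: "\<xi> \<in> L2" "g \<in> L2" using w by (auto simp: weak_deriv_def L2h_def)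
  have eq: "sob_weight 1 \<xi> = (\<lambda>k. (cmod (fourier_coeff \<xi> k))\<^sup>2 + (cmod (fourier_coeff g k))\<^sup>2)"
    by (auto simp: sob_weight_def fourier_coeff_weak_deriv[OF w] norm_mult power_mult_distrib algebra_simps)
  show s: "sob_weight 1 \<xi> summable_on UNIV"
    unfolding eq by (intro summable_on_add summable_fourier_coeff x)
  have "(\<Sum>\<^sub>\<infinity>k. sob_weight 1 \<xi> k) \<ge> 0" by (rule infsum_nonneg) (simp add: sob_weight_def)
  then have "(Hs_norm 1 \<xi>)\<^sup>2 = 2 * pi * (\<Sum>\<^sub>\<infinity>k. sob_weight 1 \<xi> k)"
    by (simp add: Hs_norm_def)
  also have "\<dots> = qn \<xi> + qn g"
    unfolding eq Parseval[OF x(1), symmetric] Parseval[OF x(2), symmetric]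
    by (subst infsum_add) (auto intro: summable_fourier_coeff x simp: distrib_left)
  finally show "(Hs_norm 1 \<xi>)\<^sup>2 = qn \<xi> + qn g" .
qed

text \<open>Differentiation multiplies the coefficient at \<open>k\<close> by a factor of modulus
  |k|, which is at least 1 off the excluded frequency 0.\<close>

lemma Poincare:
  assumes w: "weak_deriv \<xi> g" and z: "(\<integral>x. \<xi> x \<partial>circ) = 0"
  shows "qn \<xi> \<le> qn g"
proof -
  have x: "\<xi> \<in> L2" "g \<in> L2" using w by (auto simp: weak_deriv_def L2h_def)
  have "(cmod (fourier_coeff \<xi> k))\<^sup>2 \<le> (cmod (fourier_coeff g k))\<^sup>2" for k
  proof (cases "k = 0")
    case True then show ?thesis using z by (simp add: fourier_coeff_0)
  next
    case False
    then have "1 \<le> \<bar>real_of_int k\<bar>" by simp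
    then have "1 * cmod (fourier_coeff \<xi> k) \<le> \<bar>real_of_int k\<bar> * cmod (fourier_coeff \<xi> k)" by (rule mult_right_mono) simp
    then show ?thesis by (intro power_mono) (auto simp: fourier_coeff_weak_deriv[OF w] norm_mult)
  qed
  then have "(\<Sum>\<^sub>\<infinity>k. (cmod (fourier_coeff \<xi> k))\<^sup>2) \<le> (\<Sum>\<^sub>\<infinity>k. (cmod (fourier_coeff g k))\<^sup>2)"
    by (intro infsum_mono summable_fourier_coeff x)
  then show ?thesis unfolding Parseval[OF x(1), symmetric] Parseval[OF x(2), symmetric] by simp
qed

lemma Hs_1_weak_deriv:
  assumes "\<xi> \<in> Hs 1" shows "\<exists>g. weak_deriv \<xi> g"
proof (rule weak_deriv_exists)
  show "\<xi> \<in> L2" using assms by (simp add: Hs_def in_L2_iff)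
  show "(\<lambda>k. (of_int k)\<^sup>2 * (cmod (fourier_coeff \<xi> k))\<^sup>2) summable_on UNIV"
  proof (rule summable_on_comparison_test)
    show "sob_weight 1 \<xi> summable_on UNIV" using assms by (simp add: Hs_def)
  qed (auto simp: sob_weight_def algebra_simps)
qed

lemma weak_deriv_Hs_1: "weak_deriv \<xi> g \<Longrightarrow> periodic2pi \<xi> \<Longrightarrow> \<xi> \<in> Hs 1"
  using weak_deriv_norm(1)[of \<xi> g] unfolding Hs_def in_L2_iff weak_deriv_def by blast

lemma Hs_norm_nonneg [simp]: "0 \<le> Hs_norm r h"
  unfolding Hs_norm_def sob_weight_def by (intro real_sqrt_ge_zero mult_nonneg_nonneg infsum_nonneg) auto

lemma in_Hhat_iff: "h \<in> Hhat r \<longleftrightarrow> h \<in> Hs r \<and> (\<integral>x. h x \<partial>circ) = 0"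
  by (simp add: Hhat_def integral_circ_eq)

section \<open>Weakly singular kernels\<close>

text \<open>The kernel denominator, 2 |sin((s + i d)/2)|^2, as a sum of squares; this exhibits its
  sign, its zeros and the lower bound 2 sin^2(s/2).\<close>

lemma half_angle_denominator:
  "cosh d - cos s = 2 * ((sin (s / 2))\<^sup>2 + (sinh (d / 2))\<^sup>2)" for d s :: real
proof -
  have "cos s = 1 - 2 * (sin (s / 2))\<^sup>2" using cos_double_sin[of "s / 2"] by simp
  moreover have "cosh d = 1 + 2 * (sinh (d / 2))\<^sup>2"
    using cosh_double[of "d / 2"] cosh_square_eq[of "d / 2"] by simp
  ultimately show ?thesis by simp
qed

lemma measurable_pair_comp:
  fixes k :: "real \<Rightarrow> real \<Rightarrow> 'b::topological_space"
  assumes "(\<lambda>p. k (fst p) (snd p)) \<in> borel_measurable (borel \<Otimes>\<^sub>M borel)"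
    and "a \<in> M \<rightarrow>\<^sub>M borel" "b \<in> M \<rightarrow>\<^sub>M borel"
  shows "(\<lambda>x. k (a x) (b x)) \<in> borel_measurable M"
  using measurable_compose[OF measurable_Pair[OF assms(2,3)] assms(1)] by simp

locale weak_kernel =
  fixes k :: "real \<Rightarrow> real \<Rightarrow> real" and C :: real
  assumes k_measurable: "(\<lambda>p. k (fst p) (snd p)) \<in> borel_measurable (borel \<Otimes>\<^sub>M borel)"
    and k_le: "\<bar>k x y\<bar> \<le> C * wk (x - y)"
begin

lemma C_nonneg: "0 \<le> C"
  using k_le[of pi 0] by (simp add: wk_def)

lemma k_measurable1: "(\<lambda>x. k x y) \<in> borel_measurable borel"
  using k_measurable by (rule measurable_pair_comp) auto

lemma integrable_k1: "integrable circ (\<lambda>x. k x y)"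
proof (rule Bochner_Integration.integrable_bound[OF integrable_mult_right[OF integrable_circ_wk, of C y]])
  show "(\<lambda>x. k x y) \<in> borel_measurable circ" by (rule measurable_circI[OF k_measurable1])
  have "\<bar>k x y\<bar> \<le> \<bar>C * wk (y - x)\<bar>" for x
    using k_le[of x y] by (simp add: wk_commute[of x y])
  then show "AE x in circ. norm (k x y) \<le> norm (C * wk (y - x))" by simp
qed

text \<open>Fubini's criterion is applied with \<open>y\<close> outermost: integrating |k x y| over
  \<open>x\<close> first gives a bound uniform in \<open>y\<close>, which integrability of
  \<open>u\<close> then absorbs.\<close>

lemma integrable_k_pair:
  assumes u: "integrable circ u"
  shows "integrable (circ \<Otimes>\<^sub>M circ) (\<lambda>p. k (fst p) (snd p) * u (snd p))"
proof -
  have um: "u \<in> borel_measurable circ" using u by simp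
  have "integrable (circ \<Otimes>\<^sub>M circ) (\<lambda>p. k (snd p) (fst p) * u (fst p))"
  proof (rule circ_circ.Fubini_integrable)
    have "(\<lambda>p. k (snd p) (fst p)) \<in> borel_measurable (circ \<Otimes>\<^sub>M circ)"
      by (rule measurable_pair_comp[OF k_measurable])
         (auto intro: measurable_compose[OF measurable_fst measurable_circ_id] measurable_compose[OF measurable_snd measurable_circ_id])
    moreover have "(\<lambda>p. u (fst p)) \<in> borel_measurable (circ \<Otimes>\<^sub>M circ)"
      by (rule measurable_compose[OF measurable_fst um])
    ultimately show m: "(\<lambda>p. k (snd p) (fst p) * u (fst p)) \<in> borel_measurable (circ \<Otimes>\<^sub>M circ)"
      by (rule borel_measurable_times)
    show "AE y in circ. integrable circ (\<lambda>x. k (snd (y, x)) (fst (y, x)) * u (fst (y, x)))"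
      by (simp add: integrable_k1)
    show "integrable circ (\<lambda>y. \<integral>x. norm (k (snd (y, x)) (fst (y, x)) * u (fst (y, x))) \<partial>circ)"
    proof (rule Bochner_Integration.integrable_bound[of _ "\<lambda>y. C * integral\<^sup>L circ wk * u y"])
      show "(\<lambda>y. \<integral>x. norm (k (snd (y, x)) (fst (y, x)) * u (fst (y, x))) \<partial>circ) \<in> borel_measurable circ"
        by (rule circ.borel_measurable_lebesgue_integral) (use m in \<open>auto simp: split_beta'\<close>)
      have "norm (\<integral>x. norm (k x y * u y) \<partial>circ) \<le> norm (C * integral\<^sup>L circ wk * u y)" for y
      proof -
        have "(\<integral>x. \<bar>k x y\<bar> \<partial>circ) \<le> (\<integral>x. C * wk (y - x) \<partial>circ)"
          using integrable_k1[of y] integrable_circ_wk[of y] k_le[of _ y]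
          by (intro integral_mono) (auto simp: wk_commute[of _ y])
        also have "\<dots> = C * integral\<^sup>L circ wk" by (simp add: integral_circ_wk)
        finally have "(\<integral>x. \<bar>k x y\<bar> \<partial>circ) * \<bar>u y\<bar> \<le> C * integral\<^sup>L circ wk * \<bar>u y\<bar>"
          by (rule mult_right_mono) simp
        then show ?thesis using C_nonneg by (simp add: abs_mult)
      qed
      then show "AE y in circ. norm (\<integral>x. norm (k (snd (y, x)) (fst (y, x)) * u (fst (y, x))) \<partial>circ) \<le> norm (C * integral\<^sup>L circ wk * u y)"
        by simp
    qed (use u in auto)
  qed
  then show ?thesis using circ_circ.integrable_product_swap[of "\<lambda>p. k (snd p) (fst p) * u (fst p)"]
    by (simp add: split_beta')
qed

text \<open>The value defaults to 0 where the integrand is not integrable; for integrable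
  \<open>u\<close> this concerns a null set of \<open>x\<close>.\<close>

definition op :: "(real \<Rightarrow> real) \<Rightarrow> real \<Rightarrow> real" where
  "op u x = (\<integral>y. k x y * u y \<partial>circ)"

lemma AE_integrable_op: "integrable circ u \<Longrightarrow> AE x in circ. integrable circ (\<lambda>y. k x y * u y)"
  using circ_circ.AE_integrable_fst'[OF integrable_k_pair] by simp

lemma op_measurable: "u \<in> borel_measurable borel \<Longrightarrow> op u \<in> borel_measurable borel"
proof -
  assume u: "u \<in> borel_measurable borel"
  have "(\<lambda>p. k (fst p) (snd p)) \<in> borel_measurable (borel \<Otimes>\<^sub>M circ)"
    by (rule measurable_pair_comp[OF k_measurable])
       (auto intro: measurable_compose[OF measurable_snd measurable_circ_id])
  moreover have "(\<lambda>p. u (snd p)) \<in> borel_measurable (borel \<Otimes>\<^sub>M circ)"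
    by (rule measurable_compose[OF measurable_snd measurable_circI[OF u]])
  ultimately have "(\<lambda>p. k (fst p) (snd p) * u (snd p)) \<in> borel_measurable (borel \<Otimes>\<^sub>M circ)"
    by (rule borel_measurable_times)
  then show ?thesis unfolding op_def[abs_def]
    by (intro circ.borel_measurable_lebesgue_integral) (simp add: split_beta')
qed

lemma integrable_op: "integrable circ u \<Longrightarrow> integrable circ (op u)"
  using circ_circ.integrable_fst'[OF integrable_k_pair] by (simp add: op_def[abs_def])

text \<open>Lets the kernel be integrated in its first variable. With \<open>A = UNIV\<close> it
  yields means and the final step of Schur's test, with an interval the antiderivative of an
  image.\<close>

lemma integral_op_indicator:
  assumes u: "integrable circ u" and "A \<in> sets borel"
  shows "(\<integral>x. indicator A x * op u x \<partial>circ) = (\<integral>y. (\<integral>x. indicator A x * k x y \<partial>circ) * u y \<partial>circ)"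
proof -
  have im: "(\<lambda>p. indicator A (fst p) :: real) \<in> borel_measurable (circ \<Otimes>\<^sub>M circ)"
    by (rule measurable_compose[OF measurable_fst measurable_circI]) (use assms in auto)
  have "integrable (circ \<Otimes>\<^sub>M circ) (\<lambda>p. indicator A (fst p) * (k (fst p) (snd p) * u (snd p)))"
  proof (rule Bochner_Integration.integrable_bound[OF integrable_k_pair[OF u]])
    show "(\<lambda>p. indicator A (fst p) * (k (fst p) (snd p) * u (snd p))) \<in> borel_measurable (circ \<Otimes>\<^sub>M circ)"
      using im integrable_k_pair[OF u] by (intro borel_measurable_times[of _ _ "\<lambda>p. k (fst p) (snd p) * u (snd p)"]) auto
  qed (auto simp: indicator_def)
  then have i: "integrable (circ \<Otimes>\<^sub>M circ) (\<lambda>(x, y). indicator A x * (k x y * u y))"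
    by (simp add: split_beta')
  have "(\<integral>x. indicator A x * op u x \<partial>circ) = (\<integral>x. \<integral>y. indicator A x * (k x y * u y) \<partial>circ \<partial>circ)"
    by (simp add: op_def)
  also have "\<dots> = (\<integral>y. \<integral>x. indicator A x * (k x y * u y) \<partial>circ \<partial>circ)"
    using circ_circ.Fubini_integral[OF i] by simp
  also have "\<dots> = (\<integral>y. (\<integral>x. indicator A x * k x y \<partial>circ) * u y \<partial>circ)"
    by (simp flip: mult.assoc)
  finally show ?thesis .
qed

text \<open>Schur's test, with the weight \<open>wk\<close> split as a product of square roots.\<close>

lemma op_bound:
  assumes u: "u \<in> L2"
  shows "op u \<in> L2" "qn (op u) \<le> (C * integral\<^sup>L circ wk)\<^sup>2 * qn u"
proof -
  define W where "W = integral\<^sup>L circ wk"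
  have W0: "0 \<le> W" by (simp add: W_def)
  \<comment> \<open>The weight is itself an admissible kernel; its operator applied to u^2 is the
    integrable majorant of the squared image.\<close>
  interpret w: weak_kernel "\<lambda>x y. wk (x - y)" 1
    by unfold_locales (auto intro!: measurable_compose[OF _ wk_measurable])
  have um [measurable]: "u \<in> borel_measurable borel" using u by (rule L2_measurable)
  have u2: "integrable circ (\<lambda>y. (u y)\<^sup>2)" by (rule L2_sq_integrable[OF u])
  have ae: "AE x in circ. integrable circ (\<lambda>y. wk (x - y) * (u y)\<^sup>2)" by (rule w.AE_integrable_op[OF u2])
  have est: "AE x in circ. (op u x)\<^sup>2 \<le> C\<^sup>2 * W * w.op (\<lambda>y. (u y)\<^sup>2) x"
    using ae AE_integrable_op[OF L2_integrable[OF u]]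
  proof eventually_elim
    case (elim x)
    have [measurable]: "(\<lambda>y. wk (x - y)) \<in> borel_measurable borel" by measurable
    have v1: "(\<lambda>y. sqrt (wk (x - y))) \<in> L2"
      unfolding L2_def using integrable_circ_wk[of x] by simp
    have v2: "(\<lambda>y. sqrt (wk (x - y)) * \<bar>u y\<bar>) \<in> L2"
      unfolding L2_def using elim(1) by (simp add: power_mult_distrib)
    have prod: "sqrt (wk (x - y)) * (sqrt (wk (x - y)) * \<bar>u y\<bar>) = wk (x - y) * \<bar>u y\<bar>" for y
      by (simp flip: mult.assoc)
    have CS: "(\<integral>y. wk (x - y) * \<bar>u y\<bar> \<partial>circ)\<^sup>2 \<le> W * w.op (\<lambda>y. (u y)\<^sup>2) x"
      using L2_Cauchy_Schwarz[OF v1 v2]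
      by (simp add: prod qn_def power_mult_distrib integral_circ_wk W_def w.op_def)
    have wi: "integrable circ (\<lambda>y. wk (x - y) * \<bar>u y\<bar>)"
      using L2_mult_integrable[OF v1 v2] by (simp add: prod)
    have "\<bar>op u x\<bar> \<le> (\<integral>y. \<bar>k x y * u y\<bar> \<partial>circ)"
      unfolding op_def by (rule integral_abs_bound)
    also have "\<dots> \<le> (\<integral>y. C * (wk (x - y) * \<bar>u y\<bar>) \<partial>circ)"
    proof (rule integral_mono)
      show "\<bar>k x y * u y\<bar> \<le> C * (wk (x - y) * \<bar>u y\<bar>)" for y
        using mult_right_mono[OF k_le[of x y], of "\<bar>u y\<bar>"] by (simp add: abs_mult mult_ac)
    qed (use elim wi in auto)
    finally have "\<bar>op u x\<bar> \<le> C * (\<integral>y. wk (x - y) * \<bar>u y\<bar> \<partial>circ)" by simp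
    then have "\<bar>op u x\<bar>\<^sup>2 \<le> (C * (\<integral>y. wk (x - y) * \<bar>u y\<bar> \<partial>circ))\<^sup>2" by (intro power_mono) auto
    also have "\<dots> \<le> C\<^sup>2 * (W * w.op (\<lambda>y. (u y)\<^sup>2) x)"
      unfolding power_mult_distrib by (intro mult_left_mono CS) auto
    finally show ?case by (simp add: mult.assoc)
  qed
  have wi: "integrable circ (\<lambda>x. C\<^sup>2 * W * w.op (\<lambda>y. (u y)\<^sup>2) x)"
    by (intro integrable_mult_right w.integrable_op u2)
  have oi: "integrable circ (\<lambda>x. (op u x)\<^sup>2)"
  proof (rule Bochner_Integration.integrable_bound[OF wi])
    show "(\<lambda>x. (op u x)\<^sup>2) \<in> borel_measurable circ"
      using op_measurable[OF um] by (intro measurable_circI) simp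
    show "AE x in circ. norm ((op u x)\<^sup>2) \<le> norm (C\<^sup>2 * W * w.op (\<lambda>y. (u y)\<^sup>2) x)"
      using est by eventually_elim auto
  qed
  show "op u \<in> L2" using oi op_measurable[OF um] by (simp add: L2_def)
  have "qn (op u) \<le> (\<integral>x. C\<^sup>2 * W * w.op (\<lambda>y. (u y)\<^sup>2) x \<partial>circ)"
    unfolding qn_def by (rule integral_mono_AE[OF oi wi est])
  also have "\<dots> = C\<^sup>2 * W * (\<integral>x. indicator UNIV x * w.op (\<lambda>y. (u y)\<^sup>2) x \<partial>circ)" by simp
  also have "(\<integral>x. indicator UNIV x * w.op (\<lambda>y. (u y)\<^sup>2) x \<partial>circ) = W * qn u"
    by (subst w.integral_op_indicator[OF u2])
       (simp_all add: wk_commute[of _ y for y] integral_circ_wk W_def qn_def)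
  finally show "qn (op u) \<le> (C * integral\<^sup>L circ wk)\<^sup>2 * qn u"
    by (simp add: power2_eq_square W_def mult_ac)
qed

lemma op_lincomb:
  assumes "integrable circ u" "integrable circ v"
  shows "AE x in circ. op (\<lambda>x. a * u x + b * v x) x = a * op u x + b * op v x"
  using AE_integrable_op[OF assms(1)] AE_integrable_op[OF assms(2)]
proof eventually_elim
  case (elim x)
  have "op (\<lambda>x. a * u x + b * v x) x = (\<integral>y. a * (k x y * u y) + b * (k x y * v y) \<partial>circ)"
    unfolding op_def by (rule Bochner_Integration.integral_cong) (auto simp: algebra_simps)
  then show ?case using elim by (simp add: op_def)
qed

end

text \<open>Exactly what an H^2 graph provides. The final estimate depends on \<open>m\<close>
  alone; \<open>H\<close> only serves to make the kernels weakly singular.\<close>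

locale periodic_graph =
  fixes f f' :: "real \<Rightarrow> real" and m H :: real
  assumes f_periodic: "f (x + 2 * pi) = f x"
    and f_deriv: "(f has_real_derivative f' x) (at x)"
    and f'_le: "\<bar>f' x\<bar> \<le> m"
    and f'_Holder: "\<bar>f' x - f' y\<bar> \<le> H * sqrt \<bar>x - y\<bar>"
begin

lemma m_nonneg: "0 \<le> m" using f'_le[of 0] by linarith

lemma H_nonneg: "0 \<le> H" using f'_Holder[of 1 0] by simp

lemma f_deriv' [derivative_intros]:
  "(g has_real_derivative g') (at x within S) \<Longrightarrow> ((\<lambda>x. f (g x)) has_real_derivative f' (g x) * g') (at x within S)"
  by (rule DERIV_chain2[OF f_deriv])

lemma f_continuous [continuous_intros]: "continuous_on S g \<Longrightarrow> continuous_on S (\<lambda>x. f (g x))"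
  using continuous_on_compose2[of UNIV f S g] f_deriv DERIV_isCont continuous_at_imp_continuous_on by blast

lemma f'_isCont: "isCont f' x"
proof -
  have "((\<lambda>y. H * sqrt \<bar>y - x\<bar>) \<longlongrightarrow> H * sqrt \<bar>x - x\<bar>) (at x)" by (intro tendsto_intros)
  then have "((\<lambda>y. H * sqrt \<bar>y - x\<bar>) \<longlongrightarrow> 0) (at x)" by simp
  moreover have "\<forall>\<^sub>F y in at x. norm (f' y - f' x) \<le> H * sqrt \<bar>y - x\<bar>"
    using f'_Holder by (simp add: always_eventually)
  ultimately have "((\<lambda>y. f' y - f' x) \<longlongrightarrow> 0) (at x)" by (rule Lim_null_comparison[rotated])
  then show ?thesis unfolding isCont_def using Lim_null by blast
qed

lemma f'_continuous [continuous_intros]: "continuous_on S g \<Longrightarrow> continuous_on S (\<lambda>x. f' (g x))"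
  using continuous_on_compose2[of UNIV f' S g] f'_isCont continuous_at_imp_continuous_on by blast

lemma f_measurable [measurable]: "f \<in> borel_measurable borel"
  using f_continuous[OF continuous_on_id, of UNIV] by (rule borel_measurable_continuous_onI)

lemma f'_measurable [measurable]: "f' \<in> borel_measurable borel"
  using f'_continuous[OF continuous_on_id, of UNIV] by (rule borel_measurable_continuous_onI)

lemma f'_periodic: "f' (x + 2 * pi) = f' x"
proof -
  have "((\<lambda>x. f (x + 2 * pi)) has_real_derivative f' (x + 2 * pi)) (at x)"
    by (auto intro!: derivative_eq_intros)
  then have "(f has_real_derivative f' (x + 2 * pi)) (at x)" by (simp add: f_periodic)
  then show ?thesis using f_deriv DERIV_unique by blast
qed

lemma f_Lipschitz: "\<bar>f x - f y\<bar> \<le> m * \<bar>x - y\<bar>"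
proof -
  have "norm (f x - f y) \<le> m * norm (x - y)"
    by (rule field_differentiable_bound[of UNIV f f']) (auto intro: f_deriv f'_le)
  then show ?thesis by simp
qed

text \<open>The imaginary part of z'(x) cot((z(x) - z(y))/2) for z(x) = x + i f(x). In this form the
  half-angle tangents of the original kernel are cleared.\<close>

definition ker :: "real \<Rightarrow> real \<Rightarrow> real" where
  "ker x y = (f' x * sin (x - y) - sinh (f x - f y)) / (cosh (f x - f y) - cos (x - y))"

lemma ker_periodic1: "ker (x + 2 * pi) y = ker x y"
proof -
  have "x + 2 * pi - y = (x - y) + 2 * pi" by simp
  then show ?thesis unfolding ker_def f_periodic f'_periodic by (simp only: sin_periodic cos_periodic)
qed

lemma ker_periodic2: "ker x (y + 2 * pi) = ker x y"
proof -
  have "x - y = (x - (y + 2 * pi)) + 2 * pi" by simp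
  then have "sin (x - (y + 2 * pi)) = sin (x - y)" "cos (x - (y + 2 * pi)) = cos (x - y)"
    by (metis sin_periodic, metis cos_periodic)
  then show ?thesis unfolding ker_def f_periodic by simp
qed

text \<open>The bracket is the constant \<open>A\<close> of the mean value estimate for the
  numerator. The 4 is 8/2: passing from |s| to 4 |sin(s/2)| costs 4^(3/2) = 8, and the denominator
  is at least 2 sin^2(s/2).\<close>

definition kC :: real where
  "kC = 4 * (H * cosh (m * pi) + m * (2 + 2 * m * cosh (m * pi)))"

lemma cosh_le_mpi: "\<bar>d\<bar> \<le> m * pi \<Longrightarrow> cosh d \<le> cosh (m * pi)"
  using cosh_real_nonneg_le_iff[of "\<bar>d\<bar>" "m * pi"] m_nonneg by simp

lemma abs_cosh_minus_1: "\<bar>d\<bar> \<le> m * pi \<Longrightarrow> \<bar>cosh d - 1\<bar> \<le> cosh (m * pi) * \<bar>d\<bar>"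
proof -
  assume d: "\<bar>d\<bar> \<le> m * pi"
  have "norm (cosh d - cosh 0) \<le> cosh (m * pi) * norm (d - 0)"
  proof (rule field_differentiable_bound[of "{- m * pi..m * pi}" cosh sinh])
    show "norm (sinh z) \<le> cosh (m * pi)" if "z \<in> {- m * pi..m * pi}" for z
    proof -
      have "\<bar>sinh z\<bar> \<le> cosh z"
        using sinh_less_cosh_real[of z] sinh_less_cosh_real[of "-z"] by (simp add: abs_le_iff)
      also have "\<dots> \<le> cosh (m * pi)" by (rule cosh_le_mpi) (use that in auto)
      finally show ?thesis by simp
    qed
  qed (use d m_nonneg in \<open>auto intro!: derivative_eq_intros\<close>)
  then show ?thesis by simp
qed

text \<open>The numerator vanishes at \<open>y = x\<close>, and by the mean value theorem it is
  \<open>O(\<bar>x - y\<bar>\<^bsup>3/2\<^esup>)\<close>.\<close>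

lemma ker_bound_aux:
  assumes s: "\<bar>s\<bar> \<le> pi"
  shows "\<bar>ker x (x - s)\<bar> \<le> kC * wk s"
proof (cases "s = 0")
  case True
  then show ?thesis by (simp add: ker_def wk_def)
next
  case False
  define N where "N t = f' x * sin t - sinh (f x - f (x - t))" for t
  define A where "A = H * cosh (m * pi) + m * (2 + 2 * m * cosh (m * pi))"
  have "cosh (m * pi) \<ge> 0" by (rule cosh_real_nonneg)
  then have A0: "A \<ge> 0" using m_nonneg H_nonneg by (simp add: A_def)
  have "norm (N s - N 0) \<le> (A * sqrt \<bar>s\<bar>) * norm (s - 0)"
  proof (rule field_differentiable_bound[of "{- \<bar>s\<bar>..\<bar>s\<bar>}"])
    fix t assume t: "t \<in> {- \<bar>s\<bar>..\<bar>s\<bar>}"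
    show "(N has_field_derivative (f' x * cos t - cosh (f x - f (x - t)) * f' (x - t))) (at t within {- \<bar>s\<bar>..\<bar>s\<bar>})"
      unfolding N_def[abs_def] by (auto intro!: derivative_eq_intros)
    define d where "d = f x - f (x - t)"
    have dt: "\<bar>d\<bar> \<le> m * \<bar>t\<bar>" using f_Lipschitz[of x "x - t"] by (simp add: d_def)
    have ts: "\<bar>t\<bar> \<le> \<bar>s\<bar>" using t by auto
    then have dpi: "\<bar>d\<bar> \<le> m * pi" using dt s m_nonneg by (meson mult_left_mono order_trans)
    have st: "sqrt \<bar>t\<bar> \<le> sqrt \<bar>s\<bar>" using ts by simp
    \<comment> \<open>As |t| <= pi < 4, a linear bound in |t| may be weakened to one in the square
      root, matching the Hoelder term.\<close>
    have "sqrt \<bar>t\<bar> \<le> 2" using ts s pi_less_4 by (intro real_le_lsqrt) auto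
    then have "sqrt \<bar>t\<bar> * sqrt \<bar>t\<bar> \<le> 2 * sqrt \<bar>s\<bar>" using st by (intro mult_mono) auto
    then have ts2: "\<bar>t\<bar> \<le> 2 * sqrt \<bar>s\<bar>" by simp
    \<comment> \<open>The derivative of the numerator, regrouped into differences that vanish at
      \<open>t = 0\<close>: a Hoelder difference of the slope, and the deviations of cos and cosh
      from 1.\<close>
    have "f' x * cos t - cosh d * f' (x - t) = cosh d * (f' x - f' (x - t)) + f' x * ((cos t - 1) - (cosh d - 1))"
      by (simp add: algebra_simps)
    also have "\<bar>\<dots>\<bar> \<le> cosh (m * pi) * (H * sqrt \<bar>s\<bar>) + m * (2 * sqrt \<bar>s\<bar> + cosh (m * pi) * (m * (2 * sqrt \<bar>s\<bar>)))"
    proof (rule order_trans[OF abs_triangle_ineq], rule add_mono)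
      show "\<bar>cosh d * (f' x - f' (x - t))\<bar> \<le> cosh (m * pi) * (H * sqrt \<bar>s\<bar>)"
        unfolding abs_mult
      proof (rule mult_mono)
        show "\<bar>cosh d\<bar> \<le> cosh (m * pi)" using cosh_le_mpi[OF dpi] by simp
        have "\<bar>f' x - f' (x - t)\<bar> \<le> H * sqrt \<bar>t\<bar>" using f'_Holder[of x "x - t"] by simp
        also have "\<dots> \<le> H * sqrt \<bar>s\<bar>" using st H_nonneg by (rule mult_left_mono)
        finally show "\<bar>f' x - f' (x - t)\<bar> \<le> H * sqrt \<bar>s\<bar>" .
      qed auto
      have "\<bar>cos t - cos 0\<bar> \<le> 1 * \<bar>t - 0\<bar>"
        using field_differentiable_bound[of UNIV cos "\<lambda>x. - sin x" 1 t 0]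
        by (auto intro!: derivative_eq_intros)
      then have c1: "\<bar>cos t - 1\<bar> \<le> 2 * sqrt \<bar>s\<bar>" using ts2 by simp
      have "\<bar>cosh d - 1\<bar> \<le> cosh (m * pi) * \<bar>d\<bar>" by (rule abs_cosh_minus_1[OF dpi])
      also have "\<dots> \<le> cosh (m * pi) * (m * (2 * sqrt \<bar>s\<bar>))"
        using order_trans[OF dt mult_left_mono[OF ts2 m_nonneg]] by (intro mult_left_mono) auto
      finally have "\<bar>(cos t - 1) - (cosh d - 1)\<bar> \<le> 2 * sqrt \<bar>s\<bar> + cosh (m * pi) * (m * (2 * sqrt \<bar>s\<bar>))"
        using c1 by linarith
      then show "\<bar>f' x * ((cos t - 1) - (cosh d - 1))\<bar> \<le> m * (2 * sqrt \<bar>s\<bar> + cosh (m * pi) * (m * (2 * sqrt \<bar>s\<bar>)))"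
        unfolding abs_mult using f'_le[of x] m_nonneg by (intro mult_mono) auto
    qed
    also have "\<dots> = A * sqrt \<bar>s\<bar>" by (simp add: A_def algebra_simps)
    finally show "norm (f' x * cos t - cosh (f x - f (x - t)) * f' (x - t)) \<le> A * sqrt \<bar>s\<bar>" by (simp add: d_def)
  qed auto
  then have N: "\<bar>N s\<bar> \<le> A * sqrt \<bar>s\<bar> * \<bar>s\<bar>" by (simp add: N_def)
  define \<sigma> where "\<sigma> = \<bar>sin (s / 2)\<bar>"
  have s4: "\<bar>s\<bar> \<le> 4 * \<sigma>" using abs_sin_half_ge[OF s] by (simp add: \<sigma>_def)
  then have \<sigma>: "\<sigma> > 0" using False by (simp add: zero_less_abs_iff[symmetric] del: zero_less_abs_iff)
  have "sqrt \<bar>s\<bar> \<le> 2 * sqrt \<sigma>"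
    using real_sqrt_le_mono[OF s4] by (simp add: real_sqrt_mult)
  then have "sqrt \<bar>s\<bar> * \<bar>s\<bar> \<le> (2 * sqrt \<sigma>) * (4 * \<sigma>)" using s4 \<sigma> by (intro mult_mono) auto
  then have "A * (sqrt \<bar>s\<bar> * \<bar>s\<bar>) \<le> A * ((2 * sqrt \<sigma>) * (4 * \<sigma>))" by (rule mult_left_mono[OF _ A0])
  with N have N': "\<bar>N s\<bar> \<le> 8 * A * sqrt \<sigma> * \<sigma>" by (simp add: algebra_simps)
  have D: "2 * \<sigma>\<^sup>2 \<le> cosh (f x - f (x - s)) - cos s"
    unfolding half_angle_denominator by (simp add: \<sigma>_def)
  have "\<bar>ker x (x - s)\<bar> = \<bar>N s\<bar> / \<bar>cosh (f x - f (x - s)) - cos s\<bar>" by (simp add: ker_def N_def)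
  also have "\<dots> \<le> (8 * A * sqrt \<sigma> * \<sigma>) / (2 * \<sigma>\<^sup>2)"
    using D \<sigma> N' A0 by (intro frac_le) auto
  also have "\<dots> = 4 * A / sqrt \<sigma>"
    using \<sigma> by (simp add: field_simps power2_eq_square)
  also have "\<dots> = kC * wk s"
  proof -
    have "\<sigma> powr (- 1 / 2) = inverse (\<sigma> powr (1 / 2))" by (simp flip: powr_minus)
    then have "wk s = inverse (sqrt \<sigma>)"
      unfolding wk_def \<sigma>_def[symmetric] using \<sigma> by (simp only: powr_half_sqrt)
    then show ?thesis by (simp add: kC_def A_def divide_inverse)
  qed
  finally show ?thesis .
qed

lemma ker_bound: "\<bar>ker x y\<bar> \<le> kC * wk (x - y)"
proof -
  have per: "ker x (x - (s + 2 * pi)) = ker x (x - s)" for s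
    using ker_periodic2[of x "x - (s + 2 * pi)"] by simp
  have "ker x y = ker x (x - pe (x - y))"
    using periodic_pe[of "\<lambda>s. ker x (x - s)" "x - y"] per by simp
  moreover have "wk (x - y) = wk (pe (x - y))" using periodic_pe[of wk] wk_periodic by simp
  moreover have "\<bar>pe (x - y)\<bar> \<le> pi" using pe_bounds[of "x - y"] by auto
  ultimately show ?thesis using ker_bound_aux by metis
qed

lemma ker_measurable: "(\<lambda>p. ker (fst p) (snd p)) \<in> borel_measurable (borel \<Otimes>\<^sub>M borel)"
  unfolding ker_def sinh_def cosh_def by measurable

sublocale K: weak_kernel ker kC
  by unfold_locales (auto intro: ker_measurable ker_bound)

text \<open>Twice the argument of $\sin((z(x) - z(y))/2)$ for $z(x) = x + i f(x)$, with its removable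
  singularity filled in.\<close>

definition \<Theta> :: "real \<Rightarrow> real \<Rightarrow> real" where
  "\<Theta> x y = 2 * arctan (if sin ((x - y) / 2) = 0 then f' x
                       else tanh ((f x - f y) / 2) * cos ((x - y) / 2) / sin ((x - y) / 2))"

lemma abs_Theta_le: "\<bar>\<Theta> x y\<bar> \<le> pi"
  unfolding \<Theta>_def using arctan_bounded[of "if sin ((x - y) / 2) = 0 then f' x
                       else tanh ((f x - f y) / 2) * cos ((x - y) / 2) / sin ((x - y) / 2)"] by linarith

lemma sin_half_zero: "sin ((x - y) / 2) = 0 \<Longrightarrow> \<exists>n::int. x = y + 2 * pi * of_int n"
  by (auto simp: sin_zero_iff_int2 field_simps)

text \<open>The tanh and sine factors are both odd and cos is even, so the quotient is even; on the
  diagonal periodicity of \<open>f'\<close> decides. The symmetry lets one potential serve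
  \<open>A\<close> and its adjoint.\<close>

lemma Theta_commute: "\<Theta> x y = \<Theta> y x"
proof -
  have s: "sin ((y - x) / 2) = - sin ((x - y) / 2)" "cos ((y - x) / 2) = cos ((x - y) / 2)"
    "tanh ((f y - f x) / 2) = - tanh ((f x - f y) / 2)"
    using sin_minus[of "(x - y) / 2"] cos_minus[of "(x - y) / 2"] tanh_minus[of "(f x - f y) / 2"]
    by (simp_all add: minus_divide_left del: sin_minus cos_minus tanh_minus)
  have "f' x = f' y" if z: "sin ((x - y) / 2) = 0"
  proof -
    obtain n :: int where "x = y + 2 * pi * of_int n" using sin_half_zero[OF z] by blast
    then show ?thesis using periodic2pi_int[of f' y n] f'_periodic by simp
  qed
  then show ?thesis unfolding \<Theta>_def s by auto
qed

lemma Theta_periodic: "\<Theta> (x + 2 * pi) y = \<Theta> x y"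
proof -
  have e: "(x + 2 * pi - y) / 2 = (x - y) / 2 + pi" by (simp add: field_simps)
  show ?thesis unfolding \<Theta>_def e f_periodic f'_periodic by (simp add: sin_periodic_pi cos_periodic_pi)
qed

text \<open>\<open>S\<close>, \<open>C\<close>, \<open>s\<close>, \<open>c\<close> stand for sinh,
  cosh, sin, cos of the half increments and \<open>p\<close> for the slope. The crux is C^2 s^2 +
  S^2 c^2 = s^2 + S^2, the squared modulus of the complex sine.\<close>

lemma Theta_deriv_algebra:
  fixes S C s c p :: real
  assumes "C\<^sup>2 = 1 + S\<^sup>2" "c\<^sup>2 = 1 - s\<^sup>2" "s \<noteq> 0" "C \<noteq> 0"
  shows "2 * (inverse (1 + (S / C * c / s)\<^sup>2) * (((1 - (S / C)\<^sup>2) * (p / 2) * c * s - S / C * (s * s / 2 + c * c / 2)) / (s * s)))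
       = (p * (2 * s * c) - 2 * S * C) / (2 * (s\<^sup>2 + S\<^sup>2))"
proof -
  define Q where "Q = s\<^sup>2 + S\<^sup>2"
  have Q: "Q > 0" using assms by (simp add: Q_def add_pos_nonneg)
  have "(1 - (S / C)\<^sup>2) = (C\<^sup>2 - S\<^sup>2) / C\<^sup>2" using assms(4) by (simp add: power_divide diff_divide_distrib)
  moreover have "C\<^sup>2 - S\<^sup>2 = 1" using assms(1) by simp
  ultimately have 1: "(1 - (S / C)\<^sup>2) = 1 / (C * C)" by (simp only: power2_eq_square[of C])
  have "c * c = 1 - s * s" using assms(2) by (simp add: power2_eq_square)
  then have 2: "s * s / 2 + c * c / 2 = 1 / 2" by (simp add: diff_divide_distrib)
  have "1 + (S / C * c / s)\<^sup>2 = (C\<^sup>2 * s\<^sup>2 + S\<^sup>2 * c\<^sup>2) / (C\<^sup>2 * s\<^sup>2)"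
    using assms(3,4) by (simp add: power_divide power_mult_distrib add_divide_distrib)
  also have "C\<^sup>2 * s\<^sup>2 + S\<^sup>2 * c\<^sup>2 = Q" unfolding assms(1,2) Q_def by (simp add: algebra_simps)
  finally have 3: "1 + (S / C * c / s)\<^sup>2 = Q / (C * C * (s * s))" by (simp add: power2_eq_square)
  show ?thesis unfolding 1 2 3 Q_def[symmetric] using assms(3,4) Q by (simp add: field_simps)
qed

lemma Theta_deriv:
  assumes s: "sin ((x - y) / 2) \<noteq> 0"
  shows "((\<lambda>x. \<Theta> x y) has_real_derivative ker x y) (at x)"
proof -
  let ?R = "\<lambda>x. tanh ((f x - f y) / 2) * cos ((x - y) / 2) / sin ((x - y) / 2)"
  have e: "2 * ((x - y) / 2) = x - y" "2 * ((f x - f y) / 2) = f x - f y" by simp_all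
  have ker: "ker x y = (f' x * (2 * sin ((x - y) / 2) * cos ((x - y) / 2)) - 2 * sinh ((f x - f y) / 2) * cosh ((f x - f y) / 2))
      / (2 * ((sin ((x - y) / 2))\<^sup>2 + (sinh ((f x - f y) / 2))\<^sup>2))"
    unfolding ker_def half_angle_denominator
    using sin_double[of "(x - y) / 2"] sinh_double[of "(f x - f y) / 2"] by (simp only: e)
  have c0: "cosh ((f x - f y) / 2) \<noteq> 0" by (rule cosh_real_nonzero)
  have D: "((\<lambda>x. 2 * arctan (?R x)) has_real_derivative ker x y) (at x)"
  proof -
    let ?T = "tanh ((f x - f y) / 2)"
    have T: "((\<lambda>x. tanh ((f x - f y) / 2)) has_real_derivative (1 - ?T\<^sup>2) * (f' x / 2)) (at x)"
    proof -
      have "((\<lambda>x. (f x - f y) / 2) has_real_derivative f' x / 2) (at x)"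
        by (auto intro!: derivative_eq_intros f_deriv)
      then show ?thesis by (auto intro!: derivative_eq_intros cosh_real_nonzero)
    qed
    have c: "((\<lambda>x. cos ((x - y) / 2)) has_real_derivative - sin ((x - y) / 2) / 2) (at x)"
      by (auto intro!: derivative_eq_intros)
    have sn: "((\<lambda>x. sin ((x - y) / 2)) has_real_derivative cos ((x - y) / 2) / 2) (at x)"
      by (auto intro!: derivative_eq_intros)
    have R: "(?R has_real_derivative
        ((1 - ?T\<^sup>2) * (f' x / 2) * cos ((x - y) / 2) * sin ((x - y) / 2)
          - ?T * (sin ((x - y) / 2) * sin ((x - y) / 2) / 2 + cos ((x - y) / 2) * cos ((x - y) / 2) / 2))
         / (sin ((x - y) / 2) * sin ((x - y) / 2))) (at x)"
      by (rule DERIV_cong[OF DERIV_divide[OF DERIV_mult[OF T c] sn s]]) (simp add: algebra_simps)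
    show ?thesis
      unfolding ker
      by (rule DERIV_cong[OF DERIV_cmult[OF DERIV_chain2[OF DERIV_arctan R]]])
         (unfold tanh_def, rule Theta_deriv_algebra[OF _ _ s c0], simp_all add: cosh_square_eq cos_squared_eq)
  qed
  have "isCont (\<lambda>x. sin ((x - y) / 2)) x" by (intro continuous_intros) auto
  then have "\<forall>\<^sub>F t in nhds x. sin ((t - y) / 2) \<noteq> 0"
    using s by (simp add: eventually_nhds_conv_at isCont_def tendsto_imp_eventually_ne)
  then have "\<forall>\<^sub>F t in nhds x. \<Theta> t y = 2 * arctan (?R t)"
    by eventually_elim (simp add: \<Theta>_def)
  then show ?thesis using D by (subst DERIV_cong_ev[OF refl _ refl])
qed

text \<open>Dividing the tanh and sine terms by \<open>x - y\<close> turns them into difference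
  quotients with limits \<open>f' y / 2\<close> and 1/2; their ratio is the value filled in on the
  diagonal.\<close>

lemma Theta_isCont_diag: "isCont (\<lambda>x. \<Theta> x y) y"
proof -
  let ?R = "\<lambda>x. tanh ((f x - f y) / 2) * cos ((x - y) / 2) / sin ((x - y) / 2)"
  have 1: "((\<lambda>x. tanh ((f x - f y) / 2) / (x - y)) \<longlongrightarrow> f' y / 2) (at y)"
  proof -
    have "((\<lambda>x. tanh ((f x - f y) / 2)) has_real_derivative f' y / 2) (at y)"
      by (rule derivative_eq_intros refl f_deriv cosh_real_nonzero | simp)+
    then show ?thesis unfolding has_field_derivative_iff by simp
  qed
  have 2: "((\<lambda>x. sin ((x - y) / 2) / (x - y)) \<longlongrightarrow> 1 / 2) (at y)"
  proof -
    have "((\<lambda>x. sin ((x - y) / 2)) has_real_derivative 1 / 2) (at y)"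
      by (rule derivative_eq_intros refl | simp)+
    then show ?thesis unfolding has_field_derivative_iff by simp
  qed
  have 3: "((\<lambda>x. cos ((x - y) / 2)) \<longlongrightarrow> cos ((y - y) / 2)) (at y)" by (intro tendsto_intros) auto
  have "((\<lambda>x. (tanh ((f x - f y) / 2) / (x - y)) * cos ((x - y) / 2) / (sin ((x - y) / 2) / (x - y))) \<longlongrightarrow>
      f' y / 2 * cos ((y - y) / 2) / (1 / 2)) (at y)"
    by (rule tendsto_divide[OF tendsto_mult[OF 1 3] 2]) simp
  then have lim: "(?R \<longlongrightarrow> f' y) (at y)"
  proof -
    assume l: "((\<lambda>x. (tanh ((f x - f y) / 2) / (x - y)) * cos ((x - y) / 2) / (sin ((x - y) / 2) / (x - y))) \<longlongrightarrow>
      f' y / 2 * cos ((y - y) / 2) / (1 / 2)) (at y)"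
    have "\<forall>\<^sub>F x in at y. (tanh ((f x - f y) / 2) / (x - y)) * cos ((x - y) / 2) / (sin ((x - y) / 2) / (x - y)) = ?R x"
      using eventually_neq_at_within[of y y UNIV] by eventually_elim simp
    from tendsto_cong[OF this] l show ?thesis by simp
  qed
  have "((\<lambda>x. if sin ((x - y) / 2) = 0 then f' x else ?R x) \<longlongrightarrow> f' y) (at y)"
  proof (rule filterlim_If)
    show "(f' \<longlongrightarrow> f' y) (inf (at y) (principal {x. sin ((x - y) / 2) = 0}))"
      using f'_isCont[of y] unfolding isCont_def by (rule tendsto_mono[rotated]) simp
    show "(?R \<longlongrightarrow> f' y) (inf (at y) (principal {x. \<not> sin ((x - y) / 2) = 0}))"
      using lim by (rule tendsto_mono[rotated]) simp
  qed
  then have "((\<lambda>x. \<Theta> x y) \<longlongrightarrow> 2 * arctan (f' y)) (at y)"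
    unfolding \<Theta>_def by (intro tendsto_intros)
  then show ?thesis unfolding isCont_def by (simp add: \<Theta>_def)
qed

lemma Theta_isCont: "isCont (\<lambda>x. \<Theta> x y) x"
proof (cases "sin ((x - y) / 2) = 0")
  case False
  then show ?thesis using Theta_deriv DERIV_isCont by blast
next
  case True
  then obtain n :: int where n: "x = y + 2 * pi * of_int n" using sin_half_zero by blast
  have "\<Theta> t y = \<Theta> (t - 2 * pi * of_int n) y" for t
    using periodic2pi_int[of "\<lambda>t. \<Theta> t y" t "-n"] Theta_periodic by simp
  moreover have "isCont (\<lambda>t. \<Theta> (t - 2 * pi * of_int n) y) x"
  proof -
    have "isCont (\<lambda>t. t - 2 * pi * of_int n) x" by (intro continuous_intros)
    moreover have "isCont (\<lambda>t. \<Theta> t y) (x - 2 * pi * of_int n)" using Theta_isCont_diag[of y] n by simp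
    ultimately show ?thesis by (rule isCont_o2)
  qed
  ultimately show ?thesis by simp
qed

text \<open>The fundamental theorem for \<open>\<Theta>\<close>, which is continuous across the
  diagonal. Within the circle its singular points are \<open>y\<close> and possibly
  \<open>y + 2 * pi\<close> and \<open>y - 2 * pi\<close>.\<close>

lemma integral_ker_interval:
  assumes "- pi \<le> a" "a \<le> b" "b \<le> pi" and y: "y \<in> {-pi..pi}"
  shows "(\<integral>x. indicator {a..b} x * ker x y \<partial>circ) = \<Theta> b y - \<Theta> a y"
proof -
  have si: "set_integrable lborel {a..b} (\<lambda>x. ker x y)"
    by (rule set_integrable_subset[of _ "{-pi..pi}"]) (use K.integrable_k1[of y] assms in \<open>auto simp: integrable_circ_iff\<close>)
  have "(LINT x:{a..b}|lborel. ker x y) = \<Theta> b y - \<Theta> a y"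
  proof (rule set_integral_FTC[OF \<open>a \<le> b\<close> _ _ _ si])
    show "finite {y, y + 2 * pi, y - 2 * pi}" by simp
    show "continuous_on {a..b} (\<lambda>x. \<Theta> x y)"
      using Theta_isCont by (intro continuous_at_imp_continuous_on) auto
    fix x assume x: "x \<in> {a<..<b} - {y, y + 2 * pi, y - 2 * pi}"
    have "sin ((x - y) / 2) \<noteq> 0"
    proof
      assume "sin ((x - y) / 2) = 0"
      then obtain n :: int where n: "x = y + 2 * pi * of_int n" using sin_half_zero by blast
      have "\<bar>x - y\<bar> < 4 * pi" using x y assms by (auto simp: abs_less_iff)
      then have "\<bar>of_int n :: real\<bar> < 2" by (simp add: n abs_mult)
      then have "\<bar>n\<bar> < 2" by linarith
      then have "n = -1 \<or> n = 0 \<or> n = 1" by arith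
      then show False using x n by auto
    qed
    then show "((\<lambda>x. \<Theta> x y) has_vector_derivative ker x y) (at x)"
      using Theta_deriv by (simp add: has_real_derivative_iff_has_vector_derivative)
  qed
  moreover have "(\<integral>x. indicator {a..b} x * ker x y \<partial>circ) = (LINT x:{a..b}|lborel. ker x y)"
    unfolding integral_circ_eq set_lebesgue_integral_def
    by (rule Bochner_Integration.integral_cong) (use assms in \<open>auto simp: indicator_def\<close>)
  ultimately show ?thesis by simp
qed

lemma Theta_pi: "\<Theta> pi y = \<Theta> (-pi) y"
  using Theta_periodic[of "-pi" y] by simp

text \<open>\<open>\<Theta>\<close> is single-valued and periodic, so its increment over a period
  vanishes. This puts the range of \<open>A\<close> into \<open>L2h\<close> and makes constants drop
  out of the double layer potential.\<close>

lemma integral_ker_0: "y \<in> {-pi..pi} \<Longrightarrow> (\<integral>x. ker x y \<partial>circ) = 0"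
proof -
  assume y: "y \<in> {-pi..pi}"
  have "(\<integral>x. ker x y \<partial>circ) = (\<integral>x. indicator {-pi..pi} x * ker x y \<partial>circ)"
    by (rule Bochner_Integration.integral_cong) auto
  then show ?thesis using integral_ker_interval[of "-pi" pi y] y Theta_pi by simp
qed

definition A :: "(real \<Rightarrow> real) \<Rightarrow> real \<Rightarrow> real" where
  "A u x = (1 / (2 * pi)) * K.op u x"

lemma A_L2h: assumes u: "u \<in> L2" shows "A u \<in> L2h"
proof -
  have "(\<integral>x. indicator UNIV x * K.op u x \<partial>circ) = 0"
    by (subst K.integral_op_indicator[OF L2_integrable[OF u]])
       (auto intro!: integral_eq_zero_AE AE_I2 simp: integral_ker_0)
  then show ?thesis
    using L2_cmult[OF K.op_bound(1)[OF u], of "1 / (2 * pi)"] by (simp add: L2h_def A_def[abs_def])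
qed

lemma A_operator: "L2h_operator A ((1 / (2 * pi))\<^sup>2 * (kC * integral\<^sup>L circ wk)\<^sup>2)"
proof
  fix u assume u: "u \<in> L2h"
  show "A u \<in> L2h" using A_L2h[OF L2h_L2[OF u]] .
  show "qn (A u) \<le> (1 / (2 * pi))\<^sup>2 * (kC * integral\<^sup>L circ wk)\<^sup>2 * qn u"
    unfolding A_def[abs_def] qn_cmult mult.assoc
    by (intro mult_left_mono) (use K.op_bound(2)[OF L2h_L2[OF u]] in \<open>auto simp: mult.assoc\<close>)
  fix v a b assume v: "v \<in> L2h"
  show "AE x in circ. A (\<lambda>x. a * u x + b * v x) x = a * A u x + b * A v x"
    using K.op_lincomb[OF L2_integrable[OF L2h_L2[OF u]] L2_integrable[OF L2h_L2[OF v]], of a b]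
    by eventually_elim (simp add: A_def algebra_simps)
qed

end

section \<open>The derivative of the double layer potential\<close>

lemma integrable_circ_times:
  fixes u v :: "real \<Rightarrow> real"
  assumes u: "integrable circ u" and v: "integrable circ v"
  shows "integrable (circ \<Otimes>\<^sub>M circ) (\<lambda>p. u (fst p) * v (snd p))"
proof (rule circ_circ.Fubini_integrable)
  have um: "u \<in> borel_measurable circ" "v \<in> borel_measurable circ" using u v by auto
  show "(\<lambda>p. u (fst p) * v (snd p)) \<in> borel_measurable (circ \<Otimes>\<^sub>M circ)"
    by (rule borel_measurable_times; rule measurable_compose[OF _ um(1)] measurable_compose[OF _ um(2)]) auto
qed (use u v in \<open>auto simp: abs_mult\<close>)

lemma anti_bounded:
  assumes "integrable circ g"
  obtains B where "\<And>x. x \<in> {-pi..pi} \<Longrightarrow> \<bar>anti g x\<bar> \<le> B"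
proof -
  have "compact (anti g ` {-pi..pi})" by (rule compact_continuous_image[OF continuous_anti[OF assms]]) simp
  then obtain B where "\<forall>y\<in>anti g ` {-pi..pi}. norm y \<le> B" using compact_imp_bounded bounded_iff by metis
  then show ?thesis using that[of B] by auto
qed

context periodic_graph
begin

lemma deriv_f: "deriv f x = f' x"
  by (rule DERIV_imp_deriv[OF f_deriv])

text \<open>The adjoint has the transposed kernel: the slope is taken at the integration point
  \<open>x - s\<close>. For |s| < pi the cosine of the half angle is positive, so the tangent may be
  cleared.\<close>

lemma Astar_kernel_eq:
  assumes "\<bar>s\<bar> < pi"
  shows "Astar_kernel f x s = ker (x - s) x"
proof -
  define sn cs sh ch where "sn = sin (s / 2)" and "cs = cos (s / 2)"
    and "sh = sinh ((f x - f (x - s)) / 2)" and "ch = cosh ((f x - f (x - s)) / 2)"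
  define p where "p = f' (x - s)"
  have cs: "cs > 0" unfolding cs_def using assms by (intro cos_gt_zero_pi) auto
  have ch: "ch > 0" unfolding ch_def by (rule cosh_real_pos)
  have c2: "cs\<^sup>2 = 1 - sn\<^sup>2" "ch\<^sup>2 = 1 + sh\<^sup>2"
    by (auto simp: cs_def sn_def ch_def sh_def cos_squared_eq cosh_square_eq)
  have 1: "1 + (sn / cs)\<^sup>2 = 1 / cs\<^sup>2"
  proof -
    have "1 + (sn / cs)\<^sup>2 = (cs\<^sup>2 + sn\<^sup>2) / cs\<^sup>2" using cs by (simp add: power_divide add_divide_distrib)
    moreover have "cs\<^sup>2 + sn\<^sup>2 = 1" using c2 by simp
    ultimately show ?thesis by (simp only:)
  qed
  have 2: "1 - (sh / ch)\<^sup>2 = 1 / ch\<^sup>2"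
  proof -
    have "1 - (sh / ch)\<^sup>2 = (ch\<^sup>2 - sh\<^sup>2) / ch\<^sup>2" using ch by (simp add: power_divide diff_divide_distrib)
    moreover have "ch\<^sup>2 - sh\<^sup>2 = 1" using c2 by simp
    ultimately show ?thesis by (simp only:)
  qed
  have 3: "(sn / cs)\<^sup>2 + (sh / ch)\<^sup>2 = (sn\<^sup>2 + sh\<^sup>2) / (cs\<^sup>2 * ch\<^sup>2)"
  proof -
    have "(sn / cs)\<^sup>2 + (sh / ch)\<^sup>2 = (sn\<^sup>2 * ch\<^sup>2 + sh\<^sup>2 * cs\<^sup>2) / (cs\<^sup>2 * ch\<^sup>2)"
      using cs ch by (simp add: power_divide add_divide_distrib)
    also have "sn\<^sup>2 * ch\<^sup>2 + sh\<^sup>2 * cs\<^sup>2 = sn\<^sup>2 + sh\<^sup>2" unfolding c2 by (simp add: algebra_simps)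
    finally show ?thesis .
  qed
  have "Astar_kernel f x s = ((1 + (sn / cs)\<^sup>2) * (sh / ch) - p * (sn / cs) * (1 - (sh / ch)\<^sup>2)) / ((sn / cs)\<^sup>2 + (sh / ch)\<^sup>2)"
    unfolding Astar_kernel_def Let_def deriv_f sn_def cs_def sh_def ch_def p_def tan_def tanh_def ..
  also have "\<dots> = (2 * sh * ch - p * (2 * sn * cs)) / (2 * (sn\<^sup>2 + sh\<^sup>2))"
  proof -
    define Q where "Q = sn\<^sup>2 + sh\<^sup>2"
    have "((1 / cs\<^sup>2) * (sh / ch) - p * (sn / cs) * (1 / ch\<^sup>2)) = (sh * ch - p * sn * cs) / (cs\<^sup>2 * ch\<^sup>2)"
      using cs ch by (simp add: field_simps power2_eq_square)
    moreover have "(2 * sh * ch - p * (2 * sn * cs)) / (2 * Q) = (sh * ch - p * sn * cs) / Q"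
    proof -
      have N: "2 * sh * ch - p * (2 * sn * cs) = 2 * (sh * ch - p * sn * cs)" by simp
      show ?thesis unfolding N by (rule mult_divide_mult_cancel_left) simp
    qed
    ultimately show ?thesis unfolding 1 2 3 Q_def[symmetric] using cs ch by simp
  qed
  also have "\<dots> = ker (x - s) x"
  proof -
    have e: "2 * (s / 2) = s" "2 * ((f x - f (x - s)) / 2) = f x - f (x - s)" by simp_all
    have "2 * sh * ch = sinh (f x - f (x - s))" "2 * sn * cs = sin s"
      using sinh_double[of "(f x - f (x - s)) / 2"] sin_double[of "s / 2"]
      by (simp_all only: sh_def ch_def sn_def cs_def e)
    moreover have "2 * (sn\<^sup>2 + sh\<^sup>2) = cosh (f x - f (x - s)) - cos s"
      by (simp only: half_angle_denominator sn_def sh_def)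
    moreover have "sinh (f (x - s) - f x) = - sinh (f x - f (x - s))"
      "cosh (f (x - s) - f x) = cosh (f x - f (x - s))"
      using sinh_minus[of "f x - f (x - s)"] cosh_minus[of "f x - f (x - s)"] by simp_all
    ultimately show ?thesis by (simp add: ker_def p_def)
  qed
  finally show ?thesis .
qed

definition double_layer :: "(real \<Rightarrow> real) \<Rightarrow> real \<Rightarrow> real" where
  "double_layer \<xi> x = (\<integral>y. ker y x * \<xi> y \<partial>circ)"

lemma weak_deriv_bounded:
  assumes "weak_deriv \<xi> g"
  obtains B where "AE x in circ. \<bar>\<xi> x\<bar> \<le> B"
proof -
  obtain c where c: "AE x in circ. \<xi> x = c + anti g x" using assms by (auto simp: weak_deriv_def)
  have gi: "integrable circ g" using assms by (auto simp: weak_deriv_def L2h_def L2_integrable)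
  obtain B where B: "\<And>x. x \<in> {-pi..pi} \<Longrightarrow> \<bar>anti g x\<bar> \<le> B" using anti_bounded[OF gi] by blast
  have "AE x in circ. \<bar>\<xi> x\<bar> \<le> \<bar>c\<bar> + B"
    using c AE_space
  proof eventually_elim
    case (elim x)
    then show ?case using B[of x] by simp
  qed
  then show ?thesis using that by blast
qed

text \<open>Holds for every \<open>x\<close>, not merely almost every one: an H^1 density is
  essentially bounded, so integrability of the kernel alone suffices.\<close>

lemma double_layer_integrable:
  assumes w: "weak_deriv \<xi> g"
  shows "integrable circ (\<lambda>y. ker y x * \<xi> y)"
proof -
  obtain B where B: "AE y in circ. \<bar>\<xi> y\<bar> \<le> B" using weak_deriv_bounded[OF w] by blast
  have xm: "\<xi> \<in> borel_measurable borel" using w by (auto simp: weak_deriv_def L2_measurable)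
  show ?thesis
  proof (rule Bochner_Integration.integrable_bound[OF integrable_mult_right[OF K.integrable_k1, of B x]])
    show "(\<lambda>y. ker y x * \<xi> y) \<in> borel_measurable circ"
      by (intro measurable_circI borel_measurable_times K.k_measurable1 xm)
    show "AE y in circ. norm (ker y x * \<xi> y) \<le> norm (B * ker y x)"
      using B
    proof eventually_elim
      case (elim y)
      then have "\<bar>\<xi> y\<bar> * \<bar>ker y x\<bar> \<le> \<bar>B\<bar> * \<bar>ker y x\<bar>" by (intro mult_right_mono) auto
      then show ?case by (simp add: abs_mult mult.commute)
    qed
  qed
qed

text \<open>The kernel being weakly singular, the principal value is an ordinary Lebesgue integral.
  At \<open>s = \<plusminus> pi\<close> the kernel takes a junk value (\<open>tan (pi / 2) = 0\<close>), on a null set only.\<close>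

lemma Astar_eq_double_layer:
  assumes w: "weak_deriv \<xi> g" and p: "periodic2pi \<xi>"
  shows "Astar f \<xi> x = (1 / (2 * pi)) * double_layer \<xi> x"
proof -
  have xm [measurable]: "\<xi> \<in> borel_measurable borel" using w by (auto simp: weak_deriv_def L2_measurable)
  define h where "h y = ker y x * \<xi> y" for y
  have hm: "h \<in> borel_measurable borel"
    unfolding h_def[abs_def] by (intro borel_measurable_times K.k_measurable1 xm)
  have hp: "h (y + 2 * pi) = h y" for y using p by (simp add: h_def ker_periodic1 periodic2pi_def)
  have hi: "integrable circ h" unfolding h_def[abs_def] by (rule double_layer_integrable[OF w])
  define G where "G s = h (x - s)" for s
  have Gi: "integrable circ G" unfolding G_def[abs_def] using hi by (simp only: integrable_circ_reflect[OF hm hp])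
  have Gint: "integral\<^sup>L circ G = double_layer \<xi> x"
    unfolding G_def[abs_def] integral_circ_reflect[OF hm hp] by (simp add: double_layer_def h_def[abs_def])
  have trunc: "(LINT s:{s. \<epsilon> < \<bar>s\<bar> \<and> \<bar>s\<bar> \<le> pi}|lborel. Astar_kernel f x s * \<xi> (x - s))
      = (\<integral>s. indicator {s. \<epsilon> < \<bar>s\<bar>} s * G s \<partial>circ)" for \<epsilon>
  proof -
    have eq: "Astar_kernel f x s * \<xi> (x - s) = G s" if "\<bar>s\<bar> < pi" for s
      using Astar_kernel_eq[OF that] by (simp add: G_def h_def)
    have ae: "AE s in lborel. indicat_real {s. \<epsilon> < \<bar>s\<bar> \<and> \<bar>s\<bar> \<le> pi} s *\<^sub>R (Astar_kernel f x s * \<xi> (x - s))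
        = indicat_real {-pi..pi} s *\<^sub>R (indicator {s. \<epsilon> < \<bar>s\<bar>} s * G s)"
      using AE_neq[of pi] AE_neq[of "-pi"]
    proof eventually_elim
      case (elim s)
      show ?case
      proof (cases "\<bar>s\<bar> \<le> pi")
        case True
        then have "\<bar>s\<bar> < pi" using elim by (auto simp: abs_if split: if_splits)
        moreover have "- pi \<le> s" "s \<le> pi" using True by (auto simp: abs_le_iff)
        ultimately show ?thesis by (simp add: eq indicator_def)
      qed (auto simp: indicator_def)
    qed
    have Gm: "(\<lambda>s. indicator {s. \<epsilon> < \<bar>s\<bar>} s * G s) \<in> borel_measurable borel"
      unfolding G_def using hm by measurable
    have Am: "(\<lambda>s. Astar_kernel f x s * \<xi> (x - s)) \<in> borel_measurable borel"
      unfolding Astar_kernel_def Let_def deriv_f tanh_def sinh_def cosh_def tan_def by measurable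
    show ?thesis unfolding integral_circ_eq set_lebesgue_integral_def
      by (rule integral_cong_AE[OF _ _ ae]) (use Gm Am in measurable)
  qed
  \<comment> \<open>The truncation radius is written as \<open>inverse t\<close> because dominated
    convergence is applied along \<open>at_top\<close>.\<close>
  have "((\<lambda>t. \<integral>s. indicator {s. inverse t < \<bar>s\<bar>} s * G s \<partial>circ) \<longlongrightarrow> integral\<^sup>L circ G) at_top"
  proof (rule integral_dominated_convergence_at_top[where w="\<lambda>s. \<bar>G s\<bar>"])
    show "G \<in> borel_measurable circ" using Gi by simp
    show "(\<lambda>s. indicator {s. inverse t < \<bar>s\<bar>} s * G s) \<in> borel_measurable circ" for t
    proof (rule borel_measurable_times)
      show "(\<lambda>s. indicat_real {s. inverse t < \<bar>s\<bar>} s) \<in> borel_measurable circ"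
        by (rule measurable_circI) measurable
    qed (use Gi in simp)
    show "AE s in circ. ((\<lambda>t. indicator {s. inverse t < \<bar>s\<bar>} s * G s) \<longlongrightarrow> G s) at_top"
      using AE_circ_neq[of 0]
    proof eventually_elim
      case (elim s)
      have "\<forall>\<^sub>F t in at_top. inverse t < \<bar>s\<bar>"
        using tendsto_inverse_0_at_top[OF filterlim_ident] elim by (auto simp: order_tendsto_iff)
      then have "\<forall>\<^sub>F t in at_top. indicator {s. inverse t < \<bar>s\<bar>} s * G s = G s"
        by eventually_elim simp
      then show ?case by (rule tendsto_eventually)
    qed
  qed (use Gi in \<open>auto simp: indicator_def\<close>)
  then have "((\<lambda>\<epsilon>. \<integral>s. indicator {s. \<epsilon> < \<bar>s\<bar>} s * G s \<partial>circ) \<longlongrightarrow> integral\<^sup>L circ G) (at_right 0)"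
    by (subst filterlim_at_right_to_top)
  then have "Lim (at_right 0) (\<lambda>\<epsilon>. LINT s:{s. \<epsilon> < \<bar>s\<bar> \<and> \<bar>s\<bar> \<le> pi}|lborel. Astar_kernel f x s * \<xi> (x - s)) = double_layer \<xi> x"
    unfolding trunc Gint by (intro tendsto_Lim) auto
  then show ?thesis by (simp only: Astar_def)
qed

text \<open>Integration by parts, as Fubini on the triangle \<open>u <= y\<close>. The constant part
  of \<xi> drops since the kernel integrates to 0 in its first variable, and the boundary term at
  \<open>pi\<close> drops since \<open>g\<close> has mean zero.\<close>

lemma double_layer_eq:
  assumes w: "weak_deriv \<xi> g" and x: "x \<in> {-pi..pi}"
  shows "double_layer \<xi> x = - (\<integral>u. \<Theta> u x * g u \<partial>circ)" "integrable circ (\<lambda>u. \<Theta> u x * g u)"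
proof -
  obtain c where c: "AE x in circ. \<xi> x = c + anti g x" using w by (auto simp: weak_deriv_def)
  have gi: "integrable circ g" and g0: "(\<integral>u. g u \<partial>circ) = 0"
    using w by (auto simp: weak_deriv_def L2h_def L2_integrable)
  have gm: "g \<in> borel_measurable borel" using w by (auto simp: weak_deriv_def L2h_def L2_measurable)
  have Tm: "(\<lambda>u. \<Theta> u x) \<in> borel_measurable borel"
    by (rule borel_measurable_continuous_onI) (simp add: continuous_at_imp_continuous_on Theta_isCont)
  show Ti: "integrable circ (\<lambda>u. \<Theta> u x * g u)"
  proof (rule Bochner_Integration.integrable_bound[OF integrable_mult_right[OF gi, of pi]])
    show "(\<lambda>u. \<Theta> u x * g u) \<in> borel_measurable circ"
      by (intro measurable_circI borel_measurable_times Tm gm)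
    show "AE u in circ. norm (\<Theta> u x * g u) \<le> norm (pi * g u)"
      by (rule AE_I2) (use mult_right_mono[OF abs_Theta_le] in \<open>auto simp: abs_mult\<close>)
  qed
  define D where "D y u = ker y x * (if u \<le> y then g u else 0)" for y u
  have Di: "integrable (circ \<Otimes>\<^sub>M circ) (\<lambda>(y, u). D y u)"
  proof (rule Bochner_Integration.integrable_bound[OF integrable_circ_times[OF K.integrable_k1[of x] gi]])
    have "(\<lambda>p. (ker (fst p) x * g (snd p)) * (if snd p \<le> fst p then 1 else 0)) \<in> borel_measurable (circ \<Otimes>\<^sub>M circ)"
    proof (rule borel_measurable_times)
      show "(\<lambda>p. ker (fst p) x * g (snd p)) \<in> borel_measurable (circ \<Otimes>\<^sub>M circ)"
        using integrable_circ_times[OF K.integrable_k1[of x] gi] by simp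
      show "(\<lambda>p. if snd p \<le> fst p then 1 else 0 :: real) \<in> borel_measurable (circ \<Otimes>\<^sub>M circ)"
        by (rule measurable_circ_pair) measurable
    qed
    then show "(\<lambda>(y, u). D y u) \<in> borel_measurable (circ \<Otimes>\<^sub>M circ)"
      by (rule measurable_cong[THEN iffD1, rotated]) (auto simp: D_def)
  qed (auto simp: D_def abs_mult)
  have in1: "(\<integral>u. D y u \<partial>circ) = ker y x * anti g y" if "y \<in> space circ" for y
  proof -
    have "(\<integral>u. D y u \<partial>circ) = (\<integral>u. ker y x * (indicator {-pi..y} u * g u) \<partial>circ)"
      by (rule Bochner_Integration.integral_cong) (auto simp: D_def indicator_def)
    then show ?thesis using that by (simp add: anti_eq_circ)
  qed
  have in2: "(\<integral>y. D y u \<partial>circ) = \<Theta> pi x * g u - \<Theta> u x * g u" if "u \<in> space circ" for u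
  proof -
    have "(\<integral>y. D y u \<partial>circ) = (\<integral>y. (indicator {u..pi} y * ker y x) * g u \<partial>circ)"
      by (rule Bochner_Integration.integral_cong) (auto simp: D_def indicator_def)
    then show ?thesis using that integral_ker_interval[of u pi x] x by (simp add: left_diff_distrib)
  qed
  have ai: "integrable circ (\<lambda>y. ker y x * anti g y)"
    using circ_circ.integrable_fst'[OF Di] by (subst (asm) Bochner_Integration.integrable_cong[OF refl, of _ _ "\<lambda>y. ker y x * anti g y"]) (auto simp: in1)
  have "double_layer \<xi> x = (\<integral>y. c * ker y x + ker y x * anti g y \<partial>circ)"
    unfolding double_layer_def
  proof (rule integral_cong_AE)
    show "(\<lambda>y. ker y x * \<xi> y) \<in> borel_measurable circ" using double_layer_integrable[OF w, of x] by simp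
    show "(\<lambda>y. c * ker y x + ker y x * anti g y) \<in> borel_measurable circ"
      by (rule borel_measurable_integrable) (intro Bochner_Integration.integrable_add integrable_mult_right K.integrable_k1 ai)
    show "AE y in circ. ker y x * \<xi> y = c * ker y x + ker y x * anti g y"
      using c by eventually_elim (simp add: algebra_simps)
  qed
  also have "\<dots> = (\<integral>y. ker y x * anti g y \<partial>circ)"
    using K.integrable_k1[of x] ai integral_ker_0[OF x] by simp
  also have "\<dots> = (\<integral>y. \<integral>u. D y u \<partial>circ \<partial>circ)"
    by (rule Bochner_Integration.integral_cong) (auto simp: in1)
  also have "\<dots> = (\<integral>u. \<integral>y. D y u \<partial>circ \<partial>circ)"
    using circ_circ.Fubini_integral[OF Di] by simp
  also have "\<dots> = (\<integral>u. \<Theta> pi x * g u - \<Theta> u x * g u \<partial>circ)"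
    by (rule Bochner_Integration.integral_cong) (auto simp: in2)
  also have "\<dots> = - (\<integral>u. \<Theta> u x * g u \<partial>circ)"
    using gi Ti g0 by simp
  finally show "double_layer \<xi> x = - (\<integral>u. \<Theta> u x * g u \<partial>circ)" .
qed

text \<open>By symmetry the increment of \<open>\<Theta> u\<close> from -pi to \<open>x\<close> is
  an integral of \<open>ker t u\<close> over \<open>t\<close>; Fubini exchanges it with the integral
  against \<open>g\<close>, producing \<open>A g\<close>.\<close>

lemma double_layer_anti:
  assumes w: "weak_deriv \<xi> g" and x: "x \<in> {-pi..pi}"
  shows "double_layer \<xi> x = double_layer \<xi> (-pi) + 2 * pi * anti (\<lambda>x. - A g x) x"
proof -
  have gi: "integrable circ g" using w by (auto simp: weak_deriv_def L2h_def L2_integrable)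
  have mp: "-pi \<in> {-pi..pi}" by simp
  have "double_layer \<xi> x - double_layer \<xi> (-pi) = - (\<integral>u. (\<Theta> u x - \<Theta> u (-pi)) * g u \<partial>circ)"
    using double_layer_eq[OF w x] double_layer_eq[OF w mp] by (simp add: left_diff_distrib)
  also have "(\<integral>u. (\<Theta> u x - \<Theta> u (-pi)) * g u \<partial>circ) = (\<integral>u. (\<integral>t. indicator {-pi..x} t * ker t u \<partial>circ) * g u \<partial>circ)"
    by (rule Bochner_Integration.integral_cong)
       (use x integral_ker_interval[of "-pi" x] in \<open>auto simp: Theta_commute[of _ x] Theta_commute[of _ "-pi"]\<close>)
  also have "\<dots> = (\<integral>t. indicator {-pi..x} t * K.op g t \<partial>circ)"
    by (rule K.integral_op_indicator[OF gi, symmetric]) simp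
  also have "\<dots> = 2 * pi * anti (A g) x"
    using x by (simp add: anti_eq_circ A_def mult.left_commute)
  finally have "double_layer \<xi> x - double_layer \<xi> (-pi) = - (2 * pi * anti (A g) x)" .
  moreover have "anti (\<lambda>x. - A g x) x = - anti (A g) x"
    unfolding anti_def set_lebesgue_integral_def by simp
  ultimately show ?thesis by simp
qed

lemma Astar_weak_deriv:
  assumes w: "weak_deriv \<xi> g" and p: "periodic2pi \<xi>"
  shows "weak_deriv (Astar f \<xi>) (\<lambda>x. - A g x)" "periodic2pi (Astar f \<xi>)"
proof -
  have As: "Astar f \<xi> = (\<lambda>x. (1 / (2 * pi)) * double_layer \<xi> x)"
    using Astar_eq_double_layer[OF w p] by blast
  have "ker y (x + 2 * pi) = ker y x" for x y by (rule ker_periodic2)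
  then show "periodic2pi (Astar f \<xi>)" by (simp add: As periodic2pi_def double_layer_def)
  have gL: "(\<lambda>x. - A g x) \<in> L2h" using A_L2h[of g] w by (intro L2h_uminus) (auto simp: weak_deriv_def L2h_def)
  \<comment> \<open>The transposed kernel obeys the same bound; it is brought in to obtain
    measurability of the potential on the whole line.\<close>
  interpret K': weak_kernel "\<lambda>x y. ker y x" kC
  proof
    show "(\<lambda>p. ker (snd p) (fst p)) \<in> borel_measurable (borel \<Otimes>\<^sub>M borel)"
      by (rule measurable_pair_comp[OF ker_measurable]) auto
    show "\<bar>ker y x\<bar> \<le> kC * wk (x - y)" for x y using ker_bound[of y x] by (simp add: wk_commute)
  qed
  have "double_layer \<xi> = K'.op \<xi>" by (simp add: double_layer_def[abs_def] K'.op_def[abs_def])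
  then have dm: "double_layer \<xi> \<in> borel_measurable borel"
    using K'.op_measurable[of \<xi>] w by (auto simp: weak_deriv_def L2_measurable)
  have eq: "Astar f \<xi> x = (1 / (2 * pi)) * double_layer \<xi> (-pi) + anti (\<lambda>x. - A g x) x" if "x \<in> {-pi..pi}" for x
    unfolding As double_layer_anti[OF w that] by (simp add: field_simps)
  obtain B where B: "\<And>x. x \<in> {-pi..pi} \<Longrightarrow> \<bar>anti (\<lambda>x. - A g x) x\<bar> \<le> B"
    using anti_bounded[OF L2_integrable[OF L2h_L2[OF gL]]] by blast
  have "Astar f \<xi> \<in> L2"
  proof (rule L2_bounded)
    show "Astar f \<xi> \<in> borel_measurable borel" unfolding As using dm by simp
    show "\<bar>Astar f \<xi> x\<bar> \<le> \<bar>(1 / (2 * pi)) * double_layer \<xi> (-pi)\<bar> + B" if "x \<in> {-pi..pi}" for x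
      unfolding eq[OF that] using B[OF that] by linarith
  qed
  moreover have "AE x in circ. Astar f \<xi> x = (1 / (2 * pi)) * double_layer \<xi> (-pi) + anti (\<lambda>x. - A g x) x"
    by (rule AE_I2) (simp add: eq)
  ultimately show "weak_deriv (Astar f \<xi>) (\<lambda>x. - A g x)" using gL by (auto simp: weak_deriv_def)
qed

end

section \<open>The complex cotangent\<close>

lemma sin_complex: "sin w = Complex (sin (Re w) * cosh (Im w)) (cos (Re w) * sinh (Im w))"
  by (simp add: complex_eq_iff Re_sin Im_sin cosh_def sinh_def)

lemma cos_complex: "cos w = Complex (cos (Re w) * cosh (Im w)) (- (sin (Re w) * sinh (Im w)))"
  by (simp add: complex_eq_iff Re_cos Im_cos cosh_def sinh_def field_simps)

lemma norm_sin_sq: "(cmod (sin w))\<^sup>2 = (sin (Re w))\<^sup>2 + (sinh (Im w))\<^sup>2"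
proof -
  have "(cmod (sin w))\<^sup>2 = (sin (Re w))\<^sup>2 * (cosh (Im w))\<^sup>2 + (cos (Re w))\<^sup>2 * (sinh (Im w))\<^sup>2"
    by (simp only: cmod_power2 sin_complex complex.sel power_mult_distrib)
  also have "\<dots> = (sin (Re w))\<^sup>2 + (sinh (Im w))\<^sup>2"
    unfolding cosh_square_eq cos_squared_eq by (simp add: algebra_simps)
  finally show ?thesis .
qed

lemma norm_sin_half_sq: "2 * (cmod (sin (w / 2)))\<^sup>2 = cosh (Im w) - cos (Re w)"
  unfolding norm_sin_sq half_angle_denominator by simp

lemma cot_half_complex:
  "cot (w / 2) = Complex (sin (Re w)) (- sinh (Im w)) / of_real (cosh (Im w) - cos (Re w))"
proof -
  define a b where "a = Re w / 2" and "b = Im w / 2"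
  have ab: "Re w = 2 * a" "Im w = 2 * b" "Re (w / 2) = a" "Im (w / 2) = b" by (simp_all add: a_def b_def)
  have "cot (w / 2) = (cos (w / 2) * cnj (sin (w / 2))) / of_real ((cmod (sin (w / 2)))\<^sup>2)"
    unfolding cot_def by (subst complex_div_cnj) (simp add: of_real_power)
  also have "cos (w / 2) * cnj (sin (w / 2)) = Complex (sin (Re w)) (- sinh (Im w)) / 2"
  proof -
    have "cos a * cosh b * (sin a * cosh b) - sin a * sinh b * (cos a * sinh b) = sin a * cos a * ((cosh b)\<^sup>2 - (sinh b)\<^sup>2)"
      by (simp add: power2_eq_square algebra_simps)
    then have 1: "cos a * cosh b * (sin a * cosh b) - sin a * sinh b * (cos a * sinh b) = sin a * cos a"
      by (simp add: hyperbolic_pythagoras)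
    have "cos a * cosh b * (cos a * sinh b) + sin a * sinh b * (sin a * cosh b) = sinh b * cosh b * ((sin a)\<^sup>2 + (cos a)\<^sup>2)"
      by (simp only: power2_eq_square distrib_left mult_ac add_ac)
    then have 2: "cos a * cosh b * (cos a * sinh b) + sin a * sinh b * (sin a * cosh b) = sinh b * cosh b"
      by (simp only: sin_cos_squared_add mult_1_right)
    have "cos (w / 2) * cnj (sin (w / 2))
      = Complex (cos a * cosh b * (sin a * cosh b) - sin a * sinh b * (cos a * sinh b))
          (- (cos a * cosh b * (cos a * sinh b) + sin a * sinh b * (sin a * cosh b)))"
      by (simp add: sin_complex cos_complex ab complex_eq_iff algebra_simps)
    also have "\<dots> = Complex (sin a * cos a) (- (sinh b * cosh b))" by (simp only: 1 2)
    finally show ?thesis by (simp add: ab sin_double sinh_double complex_eq_iff)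
  qed
  also have "of_real ((cmod (sin (w / 2)))\<^sup>2) = complex_of_real (cosh (Im w) - cos (Re w)) / 2"
    unfolding norm_sin_half_sq[symmetric] by simp
  finally show ?thesis by simp
qed

text \<open>The squared modulus of the cotangent is (cosh d + cos s)/(cosh d - cos s). The bound is
  uniform in the imaginary part down to 0, which makes it usable as a majorant when the shifted
  graph approaches the curve.\<close>

lemma norm_cot_half_le:
  assumes s: "sin (Re w / 2) \<noteq> 0" and L: "\<bar>Im w\<bar> \<le> L"
  shows "cmod (cot (w / 2)) \<le> cosh L / \<bar>sin (Re w / 2)\<bar>"
proof -
  define d s where "d = Im w" and "s = Re w"
  have D: "cosh d - cos s > 0"
    unfolding half_angle_denominator using assms by (simp add: s_def add_pos_nonneg)
  have coshL: "cosh d \<le> cosh L" "1 \<le> cosh L"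
    using cosh_real_nonneg_le_iff[of "\<bar>d\<bar>" L] cosh_real_ge_1[of L] L by (auto simp: d_def)
  have "(cmod (cot (w / 2)))\<^sup>2 = ((sin s)\<^sup>2 + (sinh d)\<^sup>2) / (cosh d - cos s)\<^sup>2"
    unfolding cot_half_complex norm_divide power_divide
    by (simp add: cmod_power2 d_def s_def)
  also have "(sin s)\<^sup>2 + (sinh d)\<^sup>2 = (cosh d + cos s) * (cosh d - cos s)"
    using cosh_square_eq[of d] sin_squared_eq[of s] by (simp add: power2_eq_square algebra_simps)
  also have "\<dots> / (cosh d - cos s)\<^sup>2 = (cosh d + cos s) / (cosh d - cos s)"
    using D by (simp add: power2_eq_square)
  also have "\<dots> \<le> (2 * (cosh L)\<^sup>2) / (2 * (sin (s / 2))\<^sup>2)"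
  proof (rule frac_le)
    have "cosh L * 1 \<le> cosh L * cosh L" using coshL by (intro mult_left_mono) auto
    then show "cosh d + cos s \<le> 2 * (cosh L)\<^sup>2"
      using coshL cos_le_one[of s] unfolding power2_eq_square by linarith
    show "2 * (sin (s / 2))\<^sup>2 \<le> cosh d - cos s" unfolding half_angle_denominator by simp
    show "0 < 2 * (sin (s / 2))\<^sup>2" using assms by (simp add: s_def)
  qed simp
  also have "\<dots> = (cosh L / \<bar>sin (s / 2)\<bar>)\<^sup>2" by (simp add: power_divide)
  finally show ?thesis unfolding s_def by (rule power2_le_imp_le) (use coshL in simp)
qed

text \<open>cot w + i = exp(i w)/sin w, where |exp(i w)| <= 1 and |sin w| >= sinh(Im w) >= Im
  w.\<close>

lemma norm_cot_plus_i_le: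
  assumes "Im w > 0" shows "cmod (cot w + \<i>) \<le> 1 / Im w"
proof -
  have si: "Im w \<le> cmod (sin w)"
  proof (rule power2_le_imp_le)
    have "Im w \<le> sinh (Im w)" using real_le_x_sinh[of "Im w"] assms by (simp add: sinh_def exp_minus)
    then have "(Im w)\<^sup>2 \<le> (sinh (Im w))\<^sup>2" using assms by (intro power_mono) auto
    then show "(Im w)\<^sup>2 \<le> (cmod (sin w))\<^sup>2" unfolding norm_sin_sq by (simp add: add_increasing)
  qed simp
  then have s0: "sin w \<noteq> 0" using assms by auto
  have "cot w + \<i> = (cos w + \<i> * sin w) / sin w" using s0 by (simp add: cot_def field_simps)
  also have "\<dots> = exp (\<i> * w) / sin w" by (simp add: exp_Euler)
  finally have "cmod (cot w + \<i>) = exp (- Im w) / cmod (sin w)" by (simp add: norm_divide)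
  also have "\<dots> \<le> 1 / Im w" using assms si by (intro frac_le) auto
  finally show ?thesis .
qed

lemma cot_pi_periodic: "cot (w + of_real pi) = cot (w :: complex)"
proof -
  have "sin (w + of_real pi) = - sin w" "cos (w + of_real pi) = - cos w"
    by (simp_all add: sin_add cos_add flip: sin_of_real cos_of_real)
  then show ?thesis by (simp add: cot_def)
qed

text \<open>Turns a product of two kernels with a common evaluation point into a combination of
  single kernels, since there \<open>a - b\<close> no longer involves that point.\<close>

lemma cot_mult_cot:
  fixes a b :: complex
  assumes "sin a \<noteq> 0" "sin b \<noteq> 0" "sin (a - b) \<noteq> 0"
  shows "cot a * cot b = -1 + cot (a - b) * (cot b - cot a)"
proof -
  have "cot b - cot a = sin (a - b) / (sin a * sin b)"
    using assms by (simp add: cot_def sin_diff field_simps)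
  then have "cot (a - b) * (cot b - cot a) = cos (a - b) / (sin a * sin b)"
    using assms(3) by (simp add: cot_def)
  also have "\<dots> = cot a * cot b + 1" using assms by (simp add: cot_def cos_diff field_simps)
  finally show ?thesis by simp
qed

lemma tendsto_cot_complex:
  "(g \<longlongrightarrow> a) F \<Longrightarrow> sin a \<noteq> 0 \<Longrightarrow> ((\<lambda>x. cot (g x)) \<longlongrightarrow> cot (a :: complex)) F"
  by (rule isCont_tendsto_compose[OF isCont_cot])

lemma continuous_on_cot_complex:
  "continuous_on S g \<Longrightarrow> (\<And>x. x \<in> S \<Longrightarrow> sin (g x) \<noteq> 0) \<Longrightarrow> continuous_on S (\<lambda>x. cot (g x :: complex))"
  unfolding continuous_on_def by (auto intro: tendsto_cot_complex)

lemma integral_circ_HK: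
  fixes h :: "real \<Rightarrow> complex"
  assumes "continuous_on {-pi..pi} h"
  shows "integral\<^sup>L circ h = integral {-pi..pi} h"
  unfolding integral_circ_eq
  by (rule set_borel_integral_eq_integral(2)) (rule borel_integrable_atLeastAtMost'[OF assms])

text \<open>The logarithmic derivative of $\sin((\zeta + i \epsilon)/2)$ along the closed curve $\zeta$ does
  not depend on $\epsilon$, and $\cot \to -i$ at $i\infty$.\<close>

lemma integral_cot_curve:
  fixes \<zeta> \<zeta>' :: "real \<Rightarrow> complex"
  assumes der: "\<And>u. (\<zeta> has_vector_derivative \<zeta>' u) (at u)"
    and cont: "continuous_on UNIV \<zeta>'"
    and per: "\<And>w. cot ((\<zeta> pi + w) / 2) = cot ((\<zeta> (-pi) + w) / 2)"
    and nz: "\<And>u \<epsilon>. \<epsilon> > 0 \<Longrightarrow> sin ((\<zeta> u + \<i> * of_real \<epsilon>) / 2) \<noteq> 0"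
    and e: "\<epsilon> > 0"
  shows "(\<integral>u. cot ((\<zeta> u + \<i> * of_real \<epsilon>) / 2) * \<zeta>' u \<partial>circ) = - \<i> * (\<zeta> pi - \<zeta> (-pi))"
proof -
  define w where "w \<epsilon> u = (\<zeta> u + \<i> * of_real \<epsilon>) / 2" for \<epsilon> u
  have \<zeta>c: "continuous_on S \<zeta>" for S
    using der by (intro continuous_at_imp_continuous_on ballI has_vector_derivative_continuous) auto
  have \<zeta>'c: "continuous_on S \<zeta>'" for S using cont continuous_on_subset by blast
  have wu: "((\<lambda>u. w \<epsilon> u) has_vector_derivative \<zeta>' u / 2) (at u)" for \<epsilon> u
    unfolding w_def
    using has_vector_derivative_mult_left[OF has_vector_derivative_add_const[THEN iffD2, OF der[of u]], of "\<i> * of_real \<epsilon>" "1 / 2"]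
    by (simp add: add.commute)
  have we: "((\<lambda>\<epsilon>. w \<epsilon> u) has_vector_derivative \<i> / 2) (at \<epsilon>)" for \<epsilon> u
    unfolding w_def has_vector_derivative_def
    by (auto intro!: derivative_eq_intros simp: scaleR_conv_of_real)
  define F where "F \<epsilon> = integral {-pi..pi} (\<lambda>u. cot (w \<epsilon> u) * \<zeta>' u)" for \<epsilon>
  have gc: "continuous_on {-pi..pi} (\<lambda>u. cot (w \<epsilon> u) * \<zeta>' u)" if "\<epsilon> > 0" for \<epsilon>
    unfolding w_def using nz[OF that] by (intro continuous_on_cot_complex continuous_intros \<zeta>c \<zeta>'c) auto
  \<comment> \<open>The derivative in \<epsilon>, taken under the integral, is \<open>\<i>\<close>
    times the \<open>u\<close>-derivative of the cotangent, whose increment along the curve vanishes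
    by \<open>per\<close>.\<close>
  have F0: "(F has_vector_derivative 0) (at \<epsilon> within {0<..})" if "\<epsilon> \<in> {0<..}" for \<epsilon>
  proof -
    have "(F has_vector_derivative integral (cbox (-pi) pi) (\<lambda>u. (\<i> / 2 * (- inverse ((sin (w \<epsilon> u))\<^sup>2))) * \<zeta>' u)) (at \<epsilon> within {0<..})"
      unfolding F_def[abs_def] cbox_interval[symmetric]
    proof (rule leibniz_rule_vector_derivative)
      fix e :: real and u assume e: "e \<in> {0<..}"
      have "((cot \<circ> (\<lambda>e. w e u)) has_vector_derivative (\<i> / 2 * (- inverse ((sin (w e u))\<^sup>2)))) (at e)"
        by (rule field_vector_diff_chain_at[OF we DERIV_cot]) (use nz e in \<open>auto simp: w_def\<close>)
      then show "((\<lambda>e. cot (w e u) * \<zeta>' u) has_vector_derivative (\<i> / 2 * (- inverse ((sin (w e u))\<^sup>2))) * \<zeta>' u) (at e within {0<..})"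
        by (intro has_vector_derivative_mult_left) (auto simp: o_def intro: has_vector_derivative_at_within)
      show "(\<lambda>u. cot (w e u) * \<zeta>' u) integrable_on cbox (- pi) pi"
        using gc e by (intro integrable_continuous) auto
    next
      show "continuous_on ({0<..} \<times> cbox (- pi) pi) (\<lambda>(e, u). \<i> / 2 * - inverse ((sin (w e u))\<^sup>2) * \<zeta>' u)"
        unfolding split_beta w_def
        by (intro continuous_intros continuous_on_compose2[OF \<zeta>c[of UNIV]] continuous_on_compose2[OF \<zeta>'c[of UNIV]])
           (use nz in auto)
    qed (use that in auto)
    also have "integral (cbox (-pi) pi) (\<lambda>u. (\<i> / 2 * (- inverse ((sin (w \<epsilon> u))\<^sup>2))) * \<zeta>' u) = \<i> * cot (w \<epsilon> pi) - \<i> * cot (w \<epsilon> (-pi))"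
      unfolding cbox_interval
    proof (rule integral_unique, rule fundamental_theorem_of_calculus)
      fix u
      have "((cot \<circ> w \<epsilon>) has_vector_derivative (\<zeta>' u / 2 * (- inverse ((sin (w \<epsilon> u))\<^sup>2)))) (at u)"
        by (rule field_vector_diff_chain_at[OF wu DERIV_cot]) (use nz that in \<open>auto simp: w_def\<close>)
      moreover have e: "\<i> * (\<zeta>' u / 2 * (- inverse X)) = (\<i> / 2 * (- inverse X)) * \<zeta>' u" for X by simp
      ultimately have "((\<lambda>u. \<i> * (cot \<circ> w \<epsilon>) u) has_vector_derivative \<i> * (\<zeta>' u / 2 * (- inverse ((sin (w \<epsilon> u))\<^sup>2)))) (at u)"
        by (intro has_vector_derivative_mult_right)
      then show "((\<lambda>u. \<i> * cot (w \<epsilon> u)) has_vector_derivative (\<i> / 2 * (- inverse ((sin (w \<epsilon> u))\<^sup>2))) * \<zeta>' u) (at u within {-pi..pi})"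
        unfolding e o_def by (rule has_vector_derivative_at_within)
    qed simp
    also have "\<i> * cot (w \<epsilon> pi) - \<i> * cot (w \<epsilon> (-pi)) = 0" by (simp add: w_def per)
    finally show ?thesis .
  qed
  have "\<exists>c. \<forall>\<epsilon>\<in>{0<..}. F \<epsilon> = c"
    by (rule has_derivative_zero_constant) (use F0 in \<open>auto simp: has_vector_derivative_def\<close>)
  then obtain c where c: "\<And>\<epsilon>. \<epsilon> > 0 \<Longrightarrow> F \<epsilon> = c" by auto
  have int': "integral {-pi..pi} \<zeta>' = \<zeta> pi - \<zeta> (-pi)"
    by (rule integral_unique, rule fundamental_theorem_of_calculus) (auto intro: has_vector_derivative_at_within der)
  obtain B where "\<forall>y\<in>\<zeta>' ` {-pi..pi}. cmod y \<le> B"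
    using compact_imp_bounded[OF compact_continuous_image[OF \<zeta>'c compact_Icc[of "-pi" pi]]] unfolding bounded_iff by blast
  then have B: "cmod (\<zeta>' u) \<le> B" if "u \<in> {-pi..pi}" for u using that by blast
  obtain b where "\<forall>y\<in>\<zeta> ` {-pi..pi}. cmod y \<le> b"
    using compact_imp_bounded[OF compact_continuous_image[OF \<zeta>c compact_Icc[of "-pi" pi]]] unfolding bounded_iff by blast
  then have b: "cmod (\<zeta> u) \<le> b" if "u \<in> {-pi..pi}" for u using that by blast
  have B0: "B \<ge> 0" "b \<ge> 0"
    using order_trans[OF norm_ge_zero B[of 0]] order_trans[OF norm_ge_zero b[of 0]] by simp_all
  \<comment> \<open>At height \<open>b + t\<close>, where \<open>b\<close> bounds the curve, the
    argument has imaginary part at least t/2, so the cotangent is within 2/t of -i.\<close>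
  have bound: "cmod (c + \<i> * (\<zeta> pi - \<zeta> (-pi))) \<le> (2 * B * (2 * pi)) / t" if t: "t > 0" for t
  proof -
    have e: "b + t > 0" using B0 t by simp
    have "c + \<i> * (\<zeta> pi - \<zeta> (-pi)) = integral {-pi..pi} (\<lambda>u. cot (w (b + t) u) * \<zeta>' u) + integral {-pi..pi} (\<lambda>u. \<i> * \<zeta>' u)"
      using c[OF e] by (simp add: F_def int')
    also have "\<dots> = integral {-pi..pi} (\<lambda>u. cot (w (b + t) u) * \<zeta>' u + \<i> * \<zeta>' u)"
      by (rule Henstock_Kurzweil_Integration.integral_add[symmetric])
         (auto intro!: integrable_continuous_interval gc e continuous_intros \<zeta>'c)
    also have "norm \<dots> \<le> (2 * B / t) * (pi - (-pi))"
    proof (rule integral_bound)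
      show "continuous_on {-pi..pi} (\<lambda>u. cot (w (b + t) u) * \<zeta>' u + \<i> * \<zeta>' u)"
        by (intro continuous_intros gc e \<zeta>'c)
      fix u assume u: "u \<in> {-pi..pi}"
      have "\<bar>Im (\<zeta> u)\<bar> \<le> b" using abs_Im_le_cmod[of "\<zeta> u"] b[OF u] by linarith
      then have im: "Im (w (b + t) u) \<ge> t / 2" by (simp add: w_def abs_le_iff)
      have "cmod (cot (w (b + t) u) + \<i>) \<le> 1 / Im (w (b + t) u)"
        by (rule norm_cot_plus_i_le) (use im t in linarith)
      also have "\<dots> \<le> 1 / (t / 2)" using im t by (intro frac_le) auto
      finally have "cmod (cot (w (b + t) u) + \<i>) * cmod (\<zeta>' u) \<le> 1 / (t / 2) * B"
        using B[OF u] t by (intro mult_mono) auto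
      then show "norm (cot (w (b + t) u) * \<zeta>' u + \<i> * \<zeta>' u) \<le> 2 * B / t"
        by (simp add: norm_mult flip: distrib_right)
    qed simp
    finally show ?thesis by simp
  qed
  have "((\<lambda>t. (2 * B * (2 * pi)) / t) \<longlongrightarrow> 0) at_top"
    by (rule real_tendsto_divide_at_top[OF tendsto_const filterlim_ident])
  then have "cmod (c + \<i> * (\<zeta> pi - \<zeta> (-pi))) \<le> 0"
    by (rule tendsto_lowerbound) (rule eventually_mono[OF eventually_gt_at_top[of 0] bound], simp_all)
  then have "c = - \<i> * (\<zeta> pi - \<zeta> (-pi))" by (simp add: add_eq_0_iff2)
  moreover have "(\<integral>u. cot (w \<epsilon> u) * \<zeta>' u \<partial>circ) = F \<epsilon>"
    unfolding F_def by (rule integral_circ_HK[OF gc[OF e]])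
  ultimately show ?thesis using c[OF e] by (simp add: w_def)
qed

lemma integrable_circ_pair_bounded:
  fixes F :: "real \<times> real \<Rightarrow> complex"
  assumes "F \<in> borel_measurable (circ \<Otimes>\<^sub>M circ)" "\<And>x y. x \<in> {-pi..pi} \<Longrightarrow> y \<in> {-pi..pi} \<Longrightarrow> cmod (F (x, y)) \<le> B"
  shows "integrable (circ \<Otimes>\<^sub>M circ) F"
proof -
  interpret P: finite_measure "circ \<Otimes>\<^sub>M circ"
    by (rule finite_measure_pair_measure) unfold_locales
  show ?thesis
    by (rule P.integrable_const_bound[where B=B]) (use assms in \<open>auto intro!: AE_I2 simp: space_pair_measure\<close>)
qed

section \<open>Rellich identities\<close>

lemma measurable_borel_circ:
  assumes "F \<in> borel_measurable (borel \<Otimes>\<^sub>M borel)"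
  shows "F \<in> borel_measurable (borel \<Otimes>\<^sub>M circ)"
proof -
  have "(\<lambda>p. F (fst p, snd p)) \<in> borel_measurable (borel \<Otimes>\<^sub>M circ)"
  proof (rule measurable_compose[OF _ assms], rule measurable_Pair)
    show "snd \<in> borel_measurable (borel \<Otimes>\<^sub>M circ)"
      by (rule measurable_compose[OF measurable_snd measurable_circ_id])
  qed (rule measurable_fst)
  then show ?thesis by simp
qed

text \<open>The distance is replaced by that of the nearest translate, and |s| <= 4 |sin(s/2)|
  produces the factor 2 = sqrt 4. Singularities at both ends of the circle are thereby treated
  alike.\<close>

lemma periodic_Holder:
  fixes g :: "real \<Rightarrow> real"
  assumes per: "\<And>x. g (x + 2 * pi) = g x" and H: "\<And>x y. \<bar>g x - g y\<bar> \<le> H * sqrt \<bar>x - y\<bar>"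
  shows "\<bar>g x - g y\<bar> \<le> 2 * H * sqrt \<bar>sin ((x - y) / 2)\<bar>"
proof -
  define s where "s = pe (x - y)"
  have H0: "H \<ge> 0" using H[of 1 0] by simp
  have sp: "\<bar>s\<bar> \<le> pi" using pe_bounds[of "x - y"] by (auto simp: s_def)
  have p1: "g (x - (t + 2 * pi)) = g (x - t)" for t using per[of "x - (t + 2 * pi)"] by simp
  have "g (x - s) = g y" unfolding s_def using periodic_pe[of "\<lambda>t. g (x - t)" "x - y"] p1 by simp
  then have "\<bar>g x - g y\<bar> \<le> H * sqrt \<bar>s\<bar>" using H[of x "x - s"] by simp
  also have "sqrt \<bar>s\<bar> \<le> sqrt (4 * \<bar>sin (s / 2)\<bar>)" using abs_sin_half_ge[OF sp] by simp
  also have "\<bar>sin (s / 2)\<bar> = \<bar>sin ((x - y) / 2)\<bar>"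
  proof -
    have "\<bar>sin ((t + 2 * pi) / 2)\<bar> = \<bar>sin (t / 2)\<bar>" for t :: real
      by (simp add: add_divide_distrib sin_periodic_pi)
    then show ?thesis unfolding s_def by (rule periodic_pe[of "\<lambda>t. \<bar>sin (t / 2)\<bar>"])
  qed
  finally show ?thesis using H0 by (simp add: real_sqrt_mult mult_left_mono)
qed

context periodic_graph
begin

section \<open>The periodic Cauchy kernel along the shifted graph\<close>

definition z :: "real \<Rightarrow> complex" where "z x = of_real x + \<i> * of_real (f x)"

definition zd :: "real \<Rightarrow> complex" where "zd x = 1 + \<i> * of_real (f' x)"

lemma Re_z [simp]: "Re (z x) = x" and Im_z [simp]: "Im (z x) = f x"
  by (simp_all add: z_def)

lemma Re_zd [simp]: "Re (zd x) = 1" and Im_zd [simp]: "Im (zd x) = f' x"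
  by (simp_all add: zd_def)

lemma zd_nonzero: "zd x \<noteq> 0"
  by (simp add: complex_eq_iff)

lemma norm_zd_ge: "1 \<le> cmod (zd x)"
  using abs_Re_le_cmod[of "zd x"] by simp

lemma norm_zd_le: "cmod (zd x) \<le> 1 + m"
  using cmod_le[of "zd x"] f'_le[of x] by simp

lemma z_deriv: "(z has_vector_derivative zd x) (at x within S)"
proof -
  have "((\<lambda>x. complex_of_real x) has_vector_derivative 1) (at x within S)"
    using has_vector_derivative_of_real[OF DERIV_ident[of "at x within S"]] by simp
  moreover have "((\<lambda>x. complex_of_real (f x)) has_vector_derivative of_real (f' x)) (at x within S)"
    by (rule has_vector_derivative_of_real[OF has_field_derivative_at_within[OF f_deriv]])
  ultimately show ?thesis unfolding z_def[abs_def] zd_def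
    by (intro has_vector_derivative_add has_vector_derivative_mult_right)
qed

lemma zd_continuous: "continuous_on S zd"
  unfolding zd_def[abs_def] by (intro continuous_intros)

lemma zd_measurable [measurable]: "zd \<in> borel_measurable borel"
  by (rule borel_measurable_continuous_onI[OF zd_continuous])

lemma z_shift: "z (x + 2 * pi) = z x + of_real (2 * pi)"
  by (simp add: z_def f_periodic)

text \<open>Source at \<open>z y\<close>, evaluation at \<open>z x\<close> raised by \<epsilon>;
  \<open>\<epsilon> = 0\<close> is the singular kernel on the curve itself.\<close>

definition ck :: "real \<Rightarrow> real \<Rightarrow> real \<Rightarrow> complex" where
  "ck \<epsilon> x y = cot ((z x - z y + \<i> * of_real \<epsilon>) / 2)"

text \<open>A zero forces \<open>x\<close> and \<open>y\<close> to agree modulo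
  \<open>2 * pi\<close>; then \<open>f x = f y\<close>, and the imaginary part leaves \<epsilon> =
  0. A vertical shift moves a graph off itself.\<close>

lemma sin_z_nonzero:
  assumes "\<epsilon> > 0 \<or> sin ((x - y) / 2) \<noteq> 0"
  shows "sin ((z x - z y + \<i> * of_real \<epsilon>) / 2) \<noteq> 0"
proof
  let ?w = "z x - z y + \<i> * of_real \<epsilon>"
  assume "sin (?w / 2) = 0"
  then have "cosh (Im ?w) - cos (Re ?w) = 0" using norm_sin_half_sq[of ?w] by simp
  then have "cosh (f x - f y + \<epsilon>) - cos (x - y) = 0" by simp
  then have "(sin ((x - y) / 2))\<^sup>2 + (sinh ((f x - f y + \<epsilon>) / 2))\<^sup>2 = 0"
    unfolding half_angle_denominator by (metis mult_eq_0_iff zero_neq_numeral)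
  then have "sin ((x - y) / 2) = 0 \<and> sinh ((f x - f y + \<epsilon>) / 2) = 0"
    by (simp only: sum_power2_eq_zero_iff)
  then have s: "sin ((x - y) / 2) = 0" and h: "f x - f y + \<epsilon> = 0" by auto
  obtain n :: int where "x = y + 2 * pi * of_int n" using sin_half_zero[OF s] by blast
  then have "f x = f y" using periodic2pi_int[of f y n] f_periodic by simp
  then show False using assms s h by simp
qed

lemma ck_formula: "ck \<epsilon> x y = (of_real (sin (x - y)) - \<i> * of_real (sinh (f x - f y + \<epsilon>))) / of_real (cosh (f x - f y + \<epsilon>) - cos (x - y))"
  unfolding ck_def cot_half_complex by (simp add: Complex_eq)

lemma ck_measurable [measurable]: "(\<lambda>p. ck \<epsilon> (fst p) (snd p)) \<in> borel_measurable (borel \<Otimes>\<^sub>M borel)"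
  unfolding ck_formula sinh_def cosh_def by measurable

text \<open>In the argument of cosh, \<open>2 * pi * m\<close> bounds the oscillation of
  \<open>f\<close> and the 1 accounts for \<epsilon> <= 1; the bound is uniform in
  \<epsilon>.\<close>

lemma norm_ck_le:
  assumes "\<epsilon> \<in> {0..1}" "x \<in> {-pi..pi}" "y \<in> {-pi..pi}" "sin ((x - y) / 2) \<noteq> 0"
  shows "cmod (ck \<epsilon> x y) \<le> cosh (2 * pi * m + 1) / \<bar>sin ((x - y) / 2)\<bar>"
proof -
  have "\<bar>f x - f y\<bar> \<le> m * \<bar>x - y\<bar>" by (rule f_Lipschitz)
  also have "\<dots> \<le> m * (2 * pi)" using assms by (intro mult_left_mono m_nonneg) auto
  finally have "\<bar>f x - f y + \<epsilon>\<bar> \<le> 2 * pi * m + 1" using assms(1) by (auto simp: abs_le_iff mult_ac)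
  then show ?thesis
    unfolding ck_def using norm_cot_half_le[of "z x - z y + \<i> * of_real \<epsilon>" "2 * pi * m + 1"] assms(4) by simp
qed

lemma ck_bounded:
  assumes "\<epsilon> > 0"
  obtains B where "\<And>x y. x \<in> {-pi..pi} \<Longrightarrow> y \<in> {-pi..pi} \<Longrightarrow> cmod (ck \<epsilon> x y) \<le> B" "B \<ge> 0"
proof -
  have "continuous_on ({-pi..pi} \<times> {-pi..pi}) (\<lambda>p. ck \<epsilon> (fst p) (snd p))"
    unfolding ck_def z_def
    by (intro continuous_on_cot_complex continuous_intros) (use sin_z_nonzero assms in \<open>auto simp: z_def\<close>)
  then have "compact ((\<lambda>p. ck \<epsilon> (fst p) (snd p)) ` ({-pi..pi} \<times> {-pi..pi}))"
    by (intro compact_continuous_image compact_Times compact_Icc)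
  then obtain B where B: "\<forall>v\<in>(\<lambda>p. ck \<epsilon> (fst p) (snd p)) ` ({-pi..pi} \<times> {-pi..pi}). cmod v \<le> B"
    using compact_imp_bounded bounded_iff by metis
  have *: "cmod (ck \<epsilon> x y) \<le> B" if "x \<in> {-pi..pi}" "y \<in> {-pi..pi}" for x y
    using B that by force
  have "0 \<le> B" using order_trans[OF norm_ge_zero *[of 0 0]] by simp
  then show ?thesis using that * by blast
qed

text \<open>The value in the evaluation variable, used in the Rellich identity. The companion in the
  source variable has the same value, because curve and derivative both change sign; it supplies the
  jump term.\<close>

lemma integral_ck_zd1:
  assumes "\<epsilon> > 0" shows "(\<integral>u. ck \<epsilon> u y * zd u \<partial>circ) = - (2 * pi * \<i>)"
proof -
  have zp: "z pi = z (-pi) + of_real (2 * pi)" using z_shift[of "-pi"] by simp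
  have "(\<integral>u. cot ((z u - z y + \<i> * of_real \<epsilon>) / 2) * zd u \<partial>circ) = - \<i> * ((z pi - z y) - (z (-pi) - z y))"
  proof (rule integral_cot_curve)
    show "((\<lambda>u. z u - z y) has_vector_derivative zd u) (at u)" for u
      using has_vector_derivative_diff[OF z_deriv has_vector_derivative_const] by simp
    show "cot ((z pi - z y + w) / 2) = cot ((z (-pi) - z y + w) / 2)" for w
      using cot_pi_periodic[of "(z (-pi) - z y + w) / 2"] by (simp add: zp add_divide_distrib diff_divide_distrib algebra_simps)
  qed (use assms sin_z_nonzero zd_continuous in auto)
  then show ?thesis by (simp add: ck_def zp)
qed

lemma integral_ck_zd2:
  assumes "\<epsilon> > 0" shows "(\<integral>u. ck \<epsilon> x u * zd u \<partial>circ) = - (2 * pi * \<i>)"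
proof -
  have zp: "z pi = z (-pi) + of_real (2 * pi)" using z_shift[of "-pi"] by simp
  have "(\<integral>u. cot ((z x - z u + \<i> * of_real \<epsilon>) / 2) * - zd u \<partial>circ) = - \<i> * ((z x - z pi) - (z x - z (-pi)))"
  proof (rule integral_cot_curve)
    show "((\<lambda>u. z x - z u) has_vector_derivative - zd u) (at u)" for u
      using has_vector_derivative_diff[OF has_vector_derivative_const z_deriv] by simp
    show "cot ((z x - z pi + w) / 2) = cot ((z x - z (-pi) + w) / 2)" for w
      using cot_pi_periodic[of "(z x - z pi + w) / 2"] by (simp add: zp add_divide_distrib diff_divide_distrib algebra_simps)
  qed (use assms sin_z_nonzero continuous_on_minus[OF zd_continuous] in auto)
  then have "- (\<integral>u. ck \<epsilon> x u * zd u \<partial>circ) = 2 * pi * \<i>" by (simp add: ck_def zp)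
  then show ?thesis by (metis minus_minus)
qed

lemma integral_zd: "(\<integral>u. zd u \<partial>circ) = 2 * pi"
proof -
  have "integral {-pi..pi} zd = z pi - z (-pi)"
    by (rule integral_unique, rule fundamental_theorem_of_calculus) (auto intro: z_deriv)
  then show ?thesis using z_shift[of "-pi"] by (simp add: integral_circ_HK zd_continuous)
qed

lemma AE_sin_half: "AE y in circ. sin ((x - y) / 2) \<noteq> 0" if x: "x \<in> {-pi..pi}"
  using AE_circ_neq[of x] AE_circ_neq[of "x + 2 * pi"] AE_circ_neq[of "x - 2 * pi"] AE_space
proof eventually_elim
  case (elim y)
  show ?case
  proof
    assume "sin ((x - y) / 2) = 0"
    then obtain n :: int where n: "x = y + 2 * pi * of_int n" using sin_half_zero by blast
    have "\<bar>x - y\<bar> \<le> 2 * pi" using x elim(4) by (auto simp: abs_le_iff)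
    then have "\<bar>x - y\<bar> < 4 * pi" using pi_gt_zero by linarith
    then have "\<bar>of_int n :: real\<bar> < 2" by (simp add: n abs_mult)
    then have "\<bar>n\<bar> < 2" by linarith
    then have "n = -1 \<or> n = 0 \<or> n = 1" by arith
    then show False using elim n by auto
  qed
qed

end

text \<open>Densities regular enough to cancel the singularity of the cotangent after subtraction;
  mean-zero trigonometric polynomials qualify.\<close>

locale graph_density = periodic_graph +
  fixes \<omega> :: "real \<Rightarrow> real" and H\<^sub>\<omega> B\<^sub>\<omega> :: real
  assumes \<omega>_measurable [measurable]: "\<omega> \<in> borel_measurable borel"
    and \<omega>_periodic: "\<omega> (x + 2 * pi) = \<omega> x"
    and \<omega>_Holder: "\<bar>\<omega> x - \<omega> y\<bar> \<le> H\<^sub>\<omega> * sqrt \<bar>x - y\<bar>"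
    and \<omega>_le: "\<bar>\<omega> x\<bar> \<le> B\<^sub>\<omega>"
    and \<omega>_mean: "(\<integral>x. \<omega> x \<partial>circ) = 0"
begin

lemma B_nonneg: "0 \<le> B\<^sub>\<omega>" using \<omega>_le[of 0] by linarith

definition \<Phi> :: "real \<Rightarrow> real \<Rightarrow> complex" where
  "\<Phi> \<epsilon> x = (\<integral>y. ck \<epsilon> x y * of_real (\<omega> y) \<partial>circ)"

lemma ck_measurable2: "(\<lambda>y. ck \<epsilon> x y) \<in> borel_measurable borel"
  using ck_measurable by (rule measurable_pair_comp) auto

lemma Phi_measurable [measurable]: "\<Phi> \<epsilon> \<in> borel_measurable borel"
proof -
  have "(\<lambda>p. ck \<epsilon> (fst p) (snd p)) \<in> borel_measurable (borel \<Otimes>\<^sub>M circ)"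
    by (rule measurable_pair_comp[OF ck_measurable])
       (auto intro: measurable_compose[OF measurable_snd measurable_circ_id])
  moreover have "(\<lambda>p. complex_of_real (\<omega> (snd p))) \<in> borel_measurable (borel \<Otimes>\<^sub>M circ)"
    by (rule measurable_compose[OF measurable_snd measurable_circI]) measurable
  ultimately have "(\<lambda>p. ck \<epsilon> (fst p) (snd p) * complex_of_real (\<omega> (snd p))) \<in> borel_measurable (borel \<Otimes>\<^sub>M circ)"
    by (rule borel_measurable_times)
  then show ?thesis unfolding \<Phi>_def[abs_def]
    by (intro circ.borel_measurable_lebesgue_integral) (simp add: split_beta')
qed

text \<open>By the cotangent identity the product equals -1 plus a constant times the difference of
  two single kernels. Their integrals against \<open>zd\<close> coincide and cancel, so the result
  depends on neither \<open>y\<close> nor \<open>w\<close>.\<close>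

lemma integral_ck_ck:
  assumes e: "\<epsilon> > 0" and s: "sin ((w - y) / 2) \<noteq> 0"
  shows "(\<integral>x. ck \<epsilon> x y * (zd x * ck \<epsilon> x w) \<partial>circ) = - (2 * pi)"
proof -
  define q where "q = cot ((z w - z y) / 2)"
  have s': "sin ((z w - z y) / 2) \<noteq> 0" using sin_z_nonzero[of 0 w y] s by simp
  have eq: "ck \<epsilon> x y * (zd x * ck \<epsilon> x w) = - zd x + q * (ck \<epsilon> x w * zd x - ck \<epsilon> x y * zd x)" for x
  proof -
    have d: "(z x - z y + \<i> * of_real \<epsilon>) / 2 - (z x - z w + \<i> * of_real \<epsilon>) / 2 = (z w - z y) / 2"
      by (simp add: field_simps)
    have "ck \<epsilon> x y * ck \<epsilon> x w = -1 + q * (ck \<epsilon> x w - ck \<epsilon> x y)"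
      unfolding ck_def q_def d[symmetric]
      by (rule cot_mult_cot) (use sin_z_nonzero e s' in \<open>auto simp: d\<close>)
    then have "ck \<epsilon> x y * ck \<epsilon> x w * zd x = (-1 + q * (ck \<epsilon> x w - ck \<epsilon> x y)) * zd x" by simp
    then show ?thesis by (simp add: algebra_simps)
  qed
  have ci: "integrable circ (\<lambda>x. ck \<epsilon> x v * zd x)" for v
  proof -
    have "continuous_on {-pi..pi} (\<lambda>x. ck \<epsilon> x v * zd x)"
      unfolding ck_def z_def
      by (intro continuous_on_cot_complex continuous_intros zd_continuous) (use sin_z_nonzero e in \<open>auto simp: z_def\<close>)
    then show ?thesis unfolding integrable_circ_iff by (rule borel_integrable_atLeastAtMost')
  qed
  have zi: "integrable circ zd" unfolding integrable_circ_iff by (rule borel_integrable_atLeastAtMost'[OF zd_continuous])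
  show ?thesis unfolding eq using ci zi by (simp add: integral_ck_zd1[OF e] integral_zd)
qed

text \<open>No contour integration is needed: Fubini and the addition formula for the cotangent reduce the
  claim to \<open>integral_ck_ck\<close> and to the vanishing mean of \<open>\<omega>\<close>.\<close>

lemma integral_Phi_sq:
  assumes e: "\<epsilon> > 0"
  shows "(\<integral>x. (\<Phi> \<epsilon> x)\<^sup>2 * zd x \<partial>circ) = 0"
proof -
  obtain B where B: "\<And>x y. x \<in> {-pi..pi} \<Longrightarrow> y \<in> {-pi..pi} \<Longrightarrow> cmod (ck \<epsilon> x y) \<le> B" "B \<ge> 0"
    using ck_bounded[OF e] by blast
  have c\<omega>: "cmod (ck \<epsilon> x y * of_real (\<omega> y)) \<le> B * B\<^sub>\<omega>" if "x \<in> {-pi..pi}" "y \<in> {-pi..pi}" for x y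
    unfolding norm_mult using B that \<omega>_le[of y] by (intro mult_mono) auto
  have \<Phi>b: "cmod (\<Phi> \<epsilon> x) \<le> B * B\<^sub>\<omega> * (2 * pi)" if "x \<in> {-pi..pi}" for x
  proof -
    have "cmod (\<Phi> \<epsilon> x) \<le> (\<integral>y. cmod (ck \<epsilon> x y * of_real (\<omega> y)) \<partial>circ)"
      unfolding \<Phi>_def by (rule integral_norm_bound)
    also have "\<dots> \<le> (\<integral>y. B * B\<^sub>\<omega> \<partial>circ)"
    proof (rule integral_mono)
      have m: "(\<lambda>y. cmod (ck \<epsilon> x y * of_real (\<omega> y))) \<in> borel_measurable borel"
        using ck_measurable2[of \<epsilon> x] by measurable
      show "integrable circ (\<lambda>y. cmod (ck \<epsilon> x y * of_real (\<omega> y)))"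
        by (rule integrable_circ_bounded[OF m]) (use c\<omega>[OF that] in auto)
    qed (use c\<omega>[OF that] in auto)
    finally show ?thesis by (simp add: mult_ac)
  qed
  \<comment> \<open>Expanding the second factor of the square reduces the claim to this
    orthogonality of \<open>\<Phi>\<close> to every single kernel.\<close>
  have S0: "(\<integral>x. \<Phi> \<epsilon> x * (zd x * ck \<epsilon> x w) \<partial>circ) = 0" if w: "w \<in> {-pi..pi}" for w
  proof -
    define D where "D p = ck \<epsilon> (fst p) (snd p) * of_real (\<omega> (snd p)) * (zd (fst p) * ck \<epsilon> (fst p) w)" for p
    have "(\<lambda>p. ck \<epsilon> (fst p) w) \<in> borel_measurable (borel \<Otimes>\<^sub>M borel :: (real \<times> real) measure)"
      by (rule measurable_pair_comp[OF ck_measurable]) auto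
    then have "D \<in> borel_measurable (borel \<Otimes>\<^sub>M borel)" unfolding D_def[abs_def] by measurable
    then have Di: "integrable (circ \<Otimes>\<^sub>M circ) D"
    proof (intro integrable_circ_pair_bounded[where B="B * B\<^sub>\<omega> * ((1 + m) * B)"] measurable_circ_pair)
      fix x y :: real assume xy: "x \<in> {-pi..pi}" "y \<in> {-pi..pi}"
      have "cmod (zd x * ck \<epsilon> x w) \<le> (1 + m) * B"
        unfolding norm_mult using B xy w norm_zd_le m_nonneg by (intro mult_mono) auto
      then show "cmod (D (x, y)) \<le> B * B\<^sub>\<omega> * ((1 + m) * B)"
        unfolding D_def norm_mult[of "ck \<epsilon> _ _ * _"] fst_conv snd_conv
        using c\<omega>[OF xy] B B_nonneg by (intro mult_mono) auto
    qed
    have "(\<integral>x. \<Phi> \<epsilon> x * (zd x * ck \<epsilon> x w) \<partial>circ) = (\<integral>x. \<integral>y. D (x, y) \<partial>circ \<partial>circ)"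
      by (simp add: \<Phi>_def D_def)
    also have "\<dots> = (\<integral>y. \<integral>x. D (x, y) \<partial>circ \<partial>circ)"
      using circ_circ.Fubini_integral[of "\<lambda>x y. D (x, y)"] Di by (simp add: split_beta')
    also have "\<dots> = (\<integral>y. of_real (\<omega> y) * (\<integral>x. ck \<epsilon> x y * (zd x * ck \<epsilon> x w) \<partial>circ) \<partial>circ)"
      by (subst integral_mult_right_zero[symmetric]) (simp add: D_def mult_ac)
    also have "\<dots> = (\<integral>y. complex_of_real (\<omega> y) * (- (2 * of_real pi)) \<partial>circ)"
    proof (rule integral_cong_AE)
      have "(\<lambda>y. \<integral>x. D (x, y) \<partial>circ) \<in> borel_measurable circ"
        using circ_circ.integrable_snd[of "\<lambda>x y. D (x, y)"] Di by (simp add: split_beta')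
      moreover have "(\<integral>x. D (x, y) \<partial>circ) = of_real (\<omega> y) * (\<integral>x. ck \<epsilon> x y * (zd x * ck \<epsilon> x w) \<partial>circ)" for y
        by (subst integral_mult_right_zero[symmetric]) (simp add: D_def mult_ac)
      ultimately show "(\<lambda>y. of_real (\<omega> y) * (\<integral>x. ck \<epsilon> x y * (zd x * ck \<epsilon> x w) \<partial>circ)) \<in> borel_measurable circ"
        by simp
      show "AE y in circ. of_real (\<omega> y) * (\<integral>x. ck \<epsilon> x y * (zd x * ck \<epsilon> x w) \<partial>circ) = complex_of_real (\<omega> y) * (- (2 * of_real pi))"
        using AE_sin_half[OF w] by eventually_elim (simp add: integral_ck_ck[OF e])
    qed (rule measurable_circI, measurable)
    also have "\<dots> = 0" using \<omega>_mean by simp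
    finally show ?thesis .
  qed
  define E where "E p = \<Phi> \<epsilon> (fst p) * zd (fst p) * (ck \<epsilon> (fst p) (snd p) * of_real (\<omega> (snd p)))" for p
  have "E \<in> borel_measurable (borel \<Otimes>\<^sub>M borel)" unfolding E_def[abs_def] by measurable
  then have Ei: "integrable (circ \<Otimes>\<^sub>M circ) E"
  proof (intro integrable_circ_pair_bounded[where B="(B * B\<^sub>\<omega> * (2 * pi) * (1 + m)) * (B * B\<^sub>\<omega>)"] measurable_circ_pair)
    fix x y :: real assume xy: "x \<in> {-pi..pi}" "y \<in> {-pi..pi}"
    have "cmod (\<Phi> \<epsilon> x * zd x) \<le> B * B\<^sub>\<omega> * (2 * pi) * (1 + m)"
      unfolding norm_mult[of "\<Phi> \<epsilon> x"] using \<Phi>b[OF xy(1)] norm_zd_le B B_nonneg m_nonneg by (intro mult_mono) auto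
    then show "cmod (E (x, y)) \<le> (B * B\<^sub>\<omega> * (2 * pi) * (1 + m)) * (B * B\<^sub>\<omega>)"
      unfolding E_def norm_mult[of "\<Phi> _ _ * _"] fst_conv snd_conv
      using c\<omega>[OF xy] B B_nonneg m_nonneg by (intro mult_mono) auto
  qed
  have "(\<integral>y. E (x, y) \<partial>circ) = \<Phi> \<epsilon> x * zd x * \<Phi> \<epsilon> x" for x
    by (simp add: E_def \<Phi>_def)
  then have "(\<integral>x. (\<Phi> \<epsilon> x)\<^sup>2 * zd x \<partial>circ) = (\<integral>x. \<integral>y. E (x, y) \<partial>circ \<partial>circ)"
    by (simp add: power2_eq_square mult_ac)
  also have "\<dots> = (\<integral>y. \<integral>x. E (x, y) \<partial>circ \<partial>circ)"
    using circ_circ.Fubini_integral[of "\<lambda>x y. E (x, y)"] Ei by (simp add: split_beta')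
  also have "\<dots> = (\<integral>y. 0 \<partial>circ)"
  proof (rule Bochner_Integration.integral_cong[OF refl])
    fix y assume y: "y \<in> space circ"
    have "(\<integral>x. E (x, y) \<partial>circ) = of_real (\<omega> y) * (\<integral>x. \<Phi> \<epsilon> x * (zd x * ck \<epsilon> x y) \<partial>circ)"
      by (subst integral_mult_right_zero[symmetric]) (simp add: E_def mult_ac)
    then show "(\<integral>x. E (x, y) \<partial>circ) = 0" using S0 y by simp
  qed
  finally show ?thesis by simp
qed

text \<open>A regularisation of \<open>zd x * \<Phi> \<epsilon> x\<close>: the bracket vanishes at
  \<open>y = x\<close> to Hoelder order 1/2, so the integral makes sense even at \<epsilon> =
  0.\<close>

definition G :: "real \<Rightarrow> real \<Rightarrow> complex" where
  "G \<epsilon> x = (\<integral>y. ck \<epsilon> x y * (zd x * of_real (\<omega> y) - zd y * of_real (\<omega> x)) \<partial>circ)"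

definition gC :: real where
  "gC = cosh (2 * pi * m + 1) * ((1 + m) * (2 * H\<^sub>\<omega>) + B\<^sub>\<omega> * (2 * H))"

lemma G_integrand_le:
  assumes "\<epsilon> \<in> {0..1}" "x \<in> {-pi..pi}" "y \<in> {-pi..pi}" "sin ((x - y) / 2) \<noteq> 0"
  shows "cmod (ck \<epsilon> x y * (zd x * of_real (\<omega> y) - zd y * of_real (\<omega> x))) \<le> gC * wk (x - y)"
proof -
  define \<sigma> where "\<sigma> = \<bar>sin ((x - y) / 2)\<bar>"
  have \<sigma>: "\<sigma> > 0" using assms by (simp add: \<sigma>_def)
  have H0: "H\<^sub>\<omega> \<ge> 0" using \<omega>_Holder[of 1 0] by simp
  have 1: "\<bar>\<omega> x - \<omega> y\<bar> \<le> 2 * H\<^sub>\<omega> * sqrt \<sigma>"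
    unfolding \<sigma>_def by (rule periodic_Holder[OF \<omega>_periodic \<omega>_Holder])
  have 2: "\<bar>f' x - f' y\<bar> \<le> 2 * H * sqrt \<sigma>"
    unfolding \<sigma>_def by (rule periodic_Holder[OF f'_periodic f'_Holder])
  \<comment> \<open>One difference of \<omega> and one of the slope, each of order sqrt |sin((x -
    y)/2)|.\<close>
  have "zd x * of_real (\<omega> y) - zd y * of_real (\<omega> x) = zd x * of_real (\<omega> y - \<omega> x) + of_real (\<omega> x) * (\<i> * of_real (f' x - f' y))"
    by (simp add: zd_def algebra_simps)
  also have "cmod \<dots> \<le> cmod (zd x) * \<bar>\<omega> y - \<omega> x\<bar> + \<bar>\<omega> x\<bar> * \<bar>f' x - f' y\<bar>"
    by (rule order_trans[OF norm_triangle_ineq]) (simp add: norm_mult flip: of_real_diff)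
  also have "\<dots> \<le> (1 + m) * (2 * H\<^sub>\<omega> * sqrt \<sigma>) + B\<^sub>\<omega> * (2 * H * sqrt \<sigma>)"
    using 1 2 norm_zd_le[of x] \<omega>_le[of x] m_nonneg B_nonneg
    by (intro add_mono mult_mono) (auto simp: abs_minus_commute)
  finally have q: "cmod (zd x * of_real (\<omega> y) - zd y * of_real (\<omega> x)) \<le> ((1 + m) * (2 * H\<^sub>\<omega>) + B\<^sub>\<omega> * (2 * H)) * sqrt \<sigma>"
    by (simp add: algebra_simps)
  have "cmod (ck \<epsilon> x y * (zd x * of_real (\<omega> y) - zd y * of_real (\<omega> x)))
      \<le> (cosh (2 * pi * m + 1) / \<sigma>) * (((1 + m) * (2 * H\<^sub>\<omega>) + B\<^sub>\<omega> * (2 * H)) * sqrt \<sigma>)"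
    unfolding norm_mult[of "ck \<epsilon> x y"] using norm_ck_le[OF assms] q \<sigma>
    by (intro mult_mono) (auto simp: \<sigma>_def)
  also have "\<dots> = gC * (sqrt \<sigma> / \<sigma>)" by (simp add: gC_def)
  also have "sqrt \<sigma> / \<sigma> = wk (x - y)"
  proof -
    have "\<sigma> powr (- 1 / 2) = inverse (\<sigma> powr (1 / 2))" by (simp flip: powr_minus)
    then have "wk (x - y) = inverse (sqrt \<sigma>)"
      unfolding wk_def \<sigma>_def[symmetric] using \<sigma> by (simp only: powr_half_sqrt)
    moreover have "r / (r * r) = inverse r" if "r \<noteq> 0" for r :: real using that by (simp add: field_simps)
    from this[of "sqrt \<sigma>"] have "sqrt \<sigma> / \<sigma> = inverse (sqrt \<sigma>)" using \<sigma> by simp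
    ultimately show ?thesis by simp
  qed
  finally show ?thesis .
qed

lemma G_integrand_measurable:
  "(\<lambda>y. ck \<epsilon> x y * (zd x * of_real (\<omega> y) - zd y * of_real (\<omega> x))) \<in> borel_measurable borel"
  using ck_measurable2[of \<epsilon> x] by measurable

lemma G_integrand_integrable:
  assumes "\<epsilon> \<in> {0..1}" "x \<in> {-pi..pi}"
  shows "integrable circ (\<lambda>y. ck \<epsilon> x y * (zd x * of_real (\<omega> y) - zd y * of_real (\<omega> x)))"
proof (rule Bochner_Integration.integrable_bound[OF integrable_mult_right[OF integrable_circ_wk, of gC x]])
  show "AE y in circ. cmod (ck \<epsilon> x y * (zd x * of_real (\<omega> y) - zd y * of_real (\<omega> x))) \<le> norm (gC * wk (x - y))"
    using AE_sin_half[OF assms(2)] AE_space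
    by eventually_elim (rule order_trans[OF G_integrand_le], use assms in auto)
qed (rule measurable_circI[OF G_integrand_measurable])

lemma norm_G_le:
  assumes "\<epsilon> \<in> {0..1}" "x \<in> {-pi..pi}"
  shows "cmod (G \<epsilon> x) \<le> gC * integral\<^sup>L circ wk"
proof -
  have "cmod (G \<epsilon> x) \<le> (\<integral>y. cmod (ck \<epsilon> x y * (zd x * of_real (\<omega> y) - zd y * of_real (\<omega> x))) \<partial>circ)"
    unfolding G_def by (rule integral_norm_bound)
  also have "\<dots> \<le> (\<integral>y. gC * wk (x - y) \<partial>circ)"
  proof (rule integral_mono_AE)
    show "AE y in circ. cmod (ck \<epsilon> x y * (zd x * of_real (\<omega> y) - zd y * of_real (\<omega> x))) \<le> gC * wk (x - y)"
      using AE_sin_half[OF assms(2)] AE_space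
      by eventually_elim (rule G_integrand_le, use assms in auto)
  qed (use G_integrand_integrable[OF assms] integrable_circ_wk in auto)
  finally show ?thesis by (simp add: integral_circ_wk)
qed

lemma G_measurable: "G \<epsilon> \<in> borel_measurable borel"
proof -
  have "(\<lambda>p. ck \<epsilon> (fst p) (snd p) * (zd (fst p) * of_real (\<omega> (snd p)) - zd (snd p) * of_real (\<omega> (fst p)))) \<in> borel_measurable (borel \<Otimes>\<^sub>M borel)"
    by measurable
  from measurable_borel_circ[OF this]
show ?thesis unfolding G_def[abs_def]
    by (intro circ.borel_measurable_lebesgue_integral) (simp add: split_beta')
qed

text \<open>The term subtracted in \<open>G\<close> is \<omega>(x) times the known integral of the
  kernel against \<open>zd\<close>; this is the jump of the Cauchy integral, obtained as an exact
  identity before any limit.\<close>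

lemma zd_Phi:
  assumes e: "\<epsilon> > 0" "\<epsilon> \<le> 1" and x: "x \<in> {-pi..pi}"
  shows "zd x * \<Phi> \<epsilon> x = G \<epsilon> x - 2 * pi * \<i> * of_real (\<omega> x)"
proof -
  obtain B where B: "\<And>x y. x \<in> {-pi..pi} \<Longrightarrow> y \<in> {-pi..pi} \<Longrightarrow> cmod (ck \<epsilon> x y) \<le> B" "B \<ge> 0"
    using ck_bounded[OF e(1)] by blast
  have m1: "(\<lambda>y. ck \<epsilon> x y * of_real (\<omega> y)) \<in> borel_measurable borel" "(\<lambda>y. ck \<epsilon> x y * zd y) \<in> borel_measurable borel"
    using ck_measurable2[of \<epsilon> x] by measurable
  have i1: "integrable circ (\<lambda>y. ck \<epsilon> x y * of_real (\<omega> y))"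
    by (rule integrable_circ_bounded[OF m1(1), of "B * B\<^sub>\<omega>"])
       (use B x \<omega>_le in \<open>auto simp: norm_mult intro!: mult_mono\<close>)
  have i2: "integrable circ (\<lambda>y. ck \<epsilon> x y * zd y)"
    by (rule integrable_circ_bounded[OF m1(2), of "B * (1 + m)"])
       (use B x norm_zd_le in \<open>auto simp: norm_mult intro!: mult_mono\<close>)
  have "G \<epsilon> x = (\<integral>y. zd x * (ck \<epsilon> x y * of_real (\<omega> y)) - of_real (\<omega> x) * (ck \<epsilon> x y * zd y) \<partial>circ)"
    unfolding G_def by (rule Bochner_Integration.integral_cong) (auto simp: algebra_simps)
  also have "\<dots> = zd x * \<Phi> \<epsilon> x - of_real (\<omega> x) * (\<integral>y. ck \<epsilon> x y * zd y \<partial>circ)"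
    unfolding \<Phi>_def using i1 i2 by (subst Bochner_Integration.integral_diff) simp_all
  also have "\<dots> = zd x * \<Phi> \<epsilon> x + 2 * pi * \<i> * of_real (\<omega> x)"
    unfolding integral_ck_zd2[OF e(1)] by simp
  finally show ?thesis by simp
qed

lemma G_tendsto:
  assumes x: "x \<in> {-pi..pi}"
  shows "(\<lambda>n. G (inverse (real (Suc n))) x) \<longlonglongrightarrow> G 0 x"
  unfolding G_def
proof (rule integral_dominated_convergence[where w="\<lambda>y. gC * wk (x - y)"])
  have e: "inverse (real (Suc n)) \<in> {0..1}" for n by (auto simp: field_simps)
  show "AE y in circ. cmod (ck (inverse (real (Suc n))) x y * (zd x * of_real (\<omega> y) - zd y * of_real (\<omega> x))) \<le> gC * wk (x - y)" for n
    using AE_sin_half[OF x] AE_space by eventually_elim (rule G_integrand_le[OF e], use x in auto)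
  show "AE y in circ. (\<lambda>n. ck (inverse (real (Suc n))) x y * (zd x * of_real (\<omega> y) - zd y * of_real (\<omega> x)))
      \<longlonglongrightarrow> ck 0 x y * (zd x * of_real (\<omega> y) - zd y * of_real (\<omega> x))"
    using AE_sin_half[OF x]
  proof eventually_elim
    case (elim y)
    have "(\<lambda>n. (z x - z y + \<i> * of_real (inverse (real (Suc n)))) / 2) \<longlonglongrightarrow> (z x - z y + \<i> * of_real 0) / 2"
      by (intro tendsto_intros LIMSEQ_inverse_real_of_nat) auto
    then have "(\<lambda>n. ck (inverse (real (Suc n))) x y) \<longlonglongrightarrow> ck 0 x y"
      unfolding ck_def by (rule tendsto_cot_complex) (use sin_z_nonzero elim in blast)
    then show ?case by (intro tendsto_intros)
  qed
qed (use integrable_circ_wk in \<open>auto intro!: measurable_circI G_integrand_measurable\<close>)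

text \<open>Writing \<Phi>^2 zd as (zd \<Phi>)^2 / zd moves the identity onto \<open>G\<close>,
  which is bounded uniformly in \<epsilon>; since |zd| >= 1, dominated convergence reaches
  \<epsilon> = 0.\<close>

lemma integral_G_sq:
  "(\<integral>x. (G 0 x - 2 * pi * \<i> * of_real (\<omega> x))\<^sup>2 / zd x \<partial>circ) = 0"
proof -
  define b where "b = gC * integral\<^sup>L circ wk + 2 * pi * B\<^sub>\<omega>"
  have nb: "cmod ((G \<epsilon> x - 2 * pi * \<i> * of_real (\<omega> x))\<^sup>2 / zd x) \<le> b\<^sup>2" if "\<epsilon> \<in> {0..1}" "x \<in> {-pi..pi}" for \<epsilon> x
  proof -
    have "cmod (G \<epsilon> x - 2 * pi * \<i> * of_real (\<omega> x)) \<le> cmod (G \<epsilon> x) + cmod (2 * pi * \<i> * of_real (\<omega> x))"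
      by (rule norm_triangle_ineq4)
    also have "\<dots> \<le> b" unfolding b_def using norm_G_le[OF that] \<omega>_le[of x] by (intro add_mono) (auto simp: norm_mult)
    finally have "(cmod (G \<epsilon> x - 2 * pi * \<i> * of_real (\<omega> x)))\<^sup>2 \<le> b\<^sup>2" by (intro power_mono) auto
    then have "(cmod (G \<epsilon> x - 2 * pi * \<i> * of_real (\<omega> x)))\<^sup>2 / cmod (zd x) \<le> b\<^sup>2 / 1"
      using norm_zd_ge[of x] by (intro frac_le) auto
    then show ?thesis by (simp add: norm_divide norm_power)
  qed
  have zero: "(\<integral>x. (G \<epsilon> x - 2 * pi * \<i> * of_real (\<omega> x))\<^sup>2 / zd x \<partial>circ) = 0" if "\<epsilon> > 0" "\<epsilon> \<le> 1" for \<epsilon>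
  proof -
    have "(\<integral>x. (G \<epsilon> x - 2 * pi * \<i> * of_real (\<omega> x))\<^sup>2 / zd x \<partial>circ) = (\<integral>x. (\<Phi> \<epsilon> x)\<^sup>2 * zd x \<partial>circ)"
    proof (rule Bochner_Integration.integral_cong[OF refl])
      fix x assume "x \<in> space circ"
      then have "G \<epsilon> x - 2 * pi * \<i> * of_real (\<omega> x) = zd x * \<Phi> \<epsilon> x" using zd_Phi[OF that] by simp
      then show "(G \<epsilon> x - 2 * pi * \<i> * of_real (\<omega> x))\<^sup>2 / zd x = (\<Phi> \<epsilon> x)\<^sup>2 * zd x"
        using zd_nonzero[of x] by (simp add: power2_eq_square)
    qed
    then show ?thesis by (simp add: integral_Phi_sq[OF that(1)])
  qed
  have meas: "(\<lambda>x. (G \<epsilon> x - 2 * pi * \<i> * of_real (\<omega> x))\<^sup>2 / zd x) \<in> borel_measurable borel" for \<epsilon>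
    using G_measurable[of \<epsilon>] by measurable
  have e: "inverse (real (Suc n)) \<in> {0..1}" for n by (auto simp: field_simps)
  have "(\<lambda>n. \<integral>x. (G (inverse (real (Suc n))) x - 2 * pi * \<i> * of_real (\<omega> x))\<^sup>2 / zd x \<partial>circ)
      \<longlonglongrightarrow> (\<integral>x. (G 0 x - 2 * pi * \<i> * of_real (\<omega> x))\<^sup>2 / zd x \<partial>circ)"
  proof (rule integral_dominated_convergence[where w="\<lambda>x. b\<^sup>2"])
    show "AE x in circ. (\<lambda>n. (G (inverse (real (Suc n))) x - 2 * pi * \<i> * of_real (\<omega> x))\<^sup>2 / zd x)
        \<longlonglongrightarrow> (G 0 x - 2 * pi * \<i> * of_real (\<omega> x))\<^sup>2 / zd x"
      by (rule AE_I2) (intro tendsto_intros G_tendsto zd_nonzero, auto)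
    show "AE x in circ. cmod ((G (inverse (real (Suc n))) x - 2 * pi * \<i> * of_real (\<omega> x))\<^sup>2 / zd x) \<le> b\<^sup>2" for n
      by (rule AE_I2) (rule nb[OF e], auto)
    show "(\<lambda>x. (G (inverse (real (Suc n))) x - 2 * pi * \<i> * of_real (\<omega> x))\<^sup>2 / zd x) \<in> borel_measurable circ" for n
      by (rule measurable_circI[OF meas])
    show "(\<lambda>x. (G 0 x - 2 * pi * \<i> * of_real (\<omega> x))\<^sup>2 / zd x) \<in> borel_measurable circ"
      by (rule measurable_circI[OF meas])
  qed simp
  moreover have "(\<integral>x. (G (inverse (real (Suc n))) x - 2 * pi * \<i> * of_real (\<omega> x))\<^sup>2 / zd x \<partial>circ) = 0" for n
    by (rule zero) (auto simp: field_simps)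
  ultimately show ?thesis by (simp add: LIMSEQ_const_iff)
qed

text \<open>The imaginary part of the kernel times \<open>zd x\<close> is \<open>ker x y\<close>. As
  the cotangent is odd, the subtracted part contributes \<open>ker y x * \<omega> x\<close>, whose
  integral over \<open>y\<close> is 0.\<close>

lemma Im_G_0:
  assumes x: "x \<in> {-pi..pi}"
  shows "Im (G 0 x) = 2 * pi * A \<omega> x"
proof -
  have "Im (ck 0 x y * (zd x * of_real (\<omega> y) - zd y * of_real (\<omega> x))) = ker x y * \<omega> y + ker y x * \<omega> x" for x y
  proof -
    have D: "cosh (f y - f x) - cos (y - x) = cosh (f x - f y) - cos (x - y)"
      using cosh_minus[of "f x - f y"] cos_minus[of "x - y"] by simp
    have "sin (y - x) = - sin (x - y)" "sinh (f y - f x) = - sinh (f x - f y)"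
      using sin_minus[of "x - y"] sinh_minus[of "f x - f y"] by simp_all
    then have k: "ker x y * \<omega> y + ker y x * \<omega> x
        = ((f' x * sin (x - y) - sinh (f x - f y)) * \<omega> y + (- (f' y * sin (x - y)) + sinh (f x - f y)) * \<omega> x) / (cosh (f x - f y) - cos (x - y))"
      unfolding ker_def D by (simp add: add_divide_distrib)
    have "Im (ck 0 x y * (zd x * of_real (\<omega> y) - zd y * of_real (\<omega> x)))
        = Im ((of_real (sin (x - y)) - \<i> * of_real (sinh (f x - f y))) * (zd x * of_real (\<omega> y) - zd y * of_real (\<omega> x))) / (cosh (f x - f y) - cos (x - y))"
      unfolding ck_formula times_divide_eq_left Im_divide_of_real by simp
    also have "Im ((of_real (sin (x - y)) - \<i> * of_real (sinh (f x - f y))) * (zd x * of_real (\<omega> y) - zd y * of_real (\<omega> x)))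
        = (f' x * sin (x - y) - sinh (f x - f y)) * \<omega> y + (- (f' y * sin (x - y)) + sinh (f x - f y)) * \<omega> x"
      by (simp add: algebra_simps)
    finally show ?thesis using k by simp
  qed
  note im = this
  have i0: "integrable circ (\<lambda>y. ck 0 x y * (zd x * of_real (\<omega> y) - zd y * of_real (\<omega> x)))"
    by (rule G_integrand_integrable) (use x in auto)
  have "Im (G 0 x) = (\<integral>y. ker x y * \<omega> y + ker y x * \<omega> x \<partial>circ)"
    unfolding G_def integral_Im[OF i0, symmetric] im ..
  also have "\<dots> = (\<integral>y. ker x y * \<omega> y \<partial>circ) + (\<integral>y. ker y x * \<omega> x \<partial>circ)"
  proof (rule Bochner_Integration.integral_add)
    show "integrable circ (\<lambda>y. ker y x * \<omega> x)" using K.integrable_k1[of x] by simp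
    with integrable_Im[OF i0] have "integrable circ (\<lambda>y. (ker x y * \<omega> y + ker y x * \<omega> x) - ker y x * \<omega> x)"
      unfolding im by (rule Bochner_Integration.integrable_diff)
    then show "integrable circ (\<lambda>y. ker x y * \<omega> y)" by simp
  qed
  also have "\<dots> = 2 * pi * A \<omega> x" using integral_ker_0[OF x] by (simp add: A_def K.op_def)
  finally show ?thesis .
qed

text \<open>The reflected graph yields the boundary values from the other side of the curve.\<close>

lemma integral_G_sq':
  "(\<integral>x. (G 0 x + 2 * pi * \<i> * of_real (\<omega> x))\<^sup>2 / zd x \<partial>circ) = 0"
proof -
  interpret N: graph_density "\<lambda>x. - f x" "\<lambda>x. - f' x" m H \<omega> H\<^sub>\<omega> B\<^sub>\<omega>
  proof
    show "((\<lambda>x. - f x) has_real_derivative - f' x) (at x)" for x by (rule DERIV_minus[OF f_deriv])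
    show "\<bar>- f' x - - f' y\<bar> \<le> H * sqrt \<bar>x - y\<bar>" for x y
      using f'_Holder[of y x] by (simp add: abs_minus_commute[of x y])
  qed (auto simp: f_periodic f'_le \<omega>_periodic \<omega>_Holder \<omega>_le \<omega>_mean)
  \<comment> \<open>Reflection conjugates \<open>zd\<close>, the kernel and, \<omega> being real,
    also \<open>G 0\<close>; conjugating the reflected identity back flips the sign of the jump
    term.\<close>
  have zdc: "N.zd x = cnj (zd x)" for x by (simp add: N.zd_def zd_def)
  have "N.ck 0 x y = cnj (ck 0 x y)" for x y
  proof -
    have "cosh (- f x - - f y) = cosh (f x - f y)" "sinh (- f x - - f y) = - sinh (f x - f y)"
      using cosh_minus[of "f x - f y"] sinh_minus[of "f x - f y"] by simp_all
    then show ?thesis unfolding N.ck_formula ck_formula by simp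
  qed
  then have "N.G 0 x = cnj (G 0 x)" for x
    unfolding N.G_def G_def Bochner_Integration.integral_cnj[symmetric] zdc by simp
  then have "(N.G 0 x - 2 * pi * \<i> * of_real (\<omega> x))\<^sup>2 / N.zd x = cnj ((G 0 x + 2 * pi * \<i> * of_real (\<omega> x))\<^sup>2 / zd x)" for x
    by (simp add: zdc)
  then have "cnj (\<integral>x. (G 0 x + 2 * pi * \<i> * of_real (\<omega> x))\<^sup>2 / zd x \<partial>circ) = 0"
    using N.integral_G_sq by (simp only: Bochner_Integration.integral_cnj)
  then show ?thesis by simp
qed

end

section \<open>The a priori estimate\<close>

text \<open>Young's inequality, weighted so that half of b^2 can be absorbed on the other
  side.\<close>

lemma weighted_product_le:
  fixes p b g m :: real
  assumes "\<bar>p\<bar> \<le> m" shows "2 * p * b * g \<le> b\<^sup>2 / 2 + 2 * m\<^sup>2 * g\<^sup>2"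
proof -
  have "p\<^sup>2 \<le> m\<^sup>2" using assms power_mono[of "\<bar>p\<bar>" m 2] by simp
  then have "p\<^sup>2 * g\<^sup>2 \<le> m\<^sup>2 * g\<^sup>2" by (rule mult_right_mono) simp
  moreover have "0 \<le> (b - 2 * p * g)\<^sup>2 / 2" by simp
  then have "0 \<le> b\<^sup>2 / 2 - 2 * p * b * g + 2 * (p\<^sup>2 * g\<^sup>2)"
    by (simp add: power2_diff power_mult_distrib field_simps)
  ultimately show ?thesis by simp
qed

context graph_density
begin

definition B :: "real \<Rightarrow> real" where "B x = Re (G 0 x) / (2 * pi)"

text \<open>The real part of 1/zd, and also 1/|zd|^2: the weight left by division by
  \<open>zd\<close>.\<close>

definition \<sigma> :: "real \<Rightarrow> real" where "\<sigma> x = 1 / (1 + (f' x)\<^sup>2)"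

lemma \<sigma>_pos: "0 < \<sigma> x" and \<sigma>_le: "\<sigma> x \<le> 1" and \<sigma>_ge: "1 \<le> (1 + m\<^sup>2) * \<sigma> x"
proof -
  have p: "0 < 1 + (f' x)\<^sup>2" by (simp add: add_pos_nonneg)
  then show "0 < \<sigma> x" "\<sigma> x \<le> 1" by (simp_all add: \<sigma>_def)
  have "(f' x)\<^sup>2 \<le> m\<^sup>2" using f'_le[of x] power_mono[of "\<bar>f' x\<bar>" m 2] by simp
  then show "1 \<le> (1 + m\<^sup>2) * \<sigma> x" using p by (simp add: \<sigma>_def)
qed

lemma \<sigma>_measurable [measurable]: "\<sigma> \<in> borel_measurable borel"
  unfolding \<sigma>_def[abs_def] by measurable

lemma \<omega>_L2h: "\<omega> \<in> L2h"
  using L2_bounded[OF \<omega>_measurable \<omega>_le] \<omega>_mean by (simp add: L2h_def)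

lemma B_L2: "B \<in> L2"
proof (rule L2_bounded)
  show "B \<in> borel_measurable borel" unfolding B_def[abs_def] using G_measurable[of 0] by measurable
  fix x assume x: "x \<in> {-pi..pi}"
  have "\<bar>Re (G 0 x)\<bar> \<le> gC * integral\<^sup>L circ wk"
    using abs_Re_le_cmod[of "G 0 x"] norm_G_le[OF _ x, of 0] by simp
  then show "\<bar>B x\<bar> \<le> (gC * integral\<^sup>L circ wk) / (2 * pi)" by (simp add: B_def divide_right_mono)
qed

lemma \<sigma>_integrable: "integrable circ h \<Longrightarrow> integrable circ (\<lambda>x. \<sigma> x * h x)" for h :: "real \<Rightarrow> real"
proof (rule Bochner_Integration.integrable_bound[of circ h])
  assume h: "integrable circ h"
  then show "(\<lambda>x. \<sigma> x * h x) \<in> borel_measurable circ"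
    by (intro borel_measurable_times measurable_circI[OF \<sigma>_measurable]) simp
  have "\<sigma> x * \<bar>h x\<bar> \<le> 1 * \<bar>h x\<bar>" for x by (rule mult_right_mono[OF \<sigma>_le]) simp
  then show "AE x in circ. norm (\<sigma> x * h x) \<le> norm (h x)"
    using \<sigma>_pos by (auto simp: abs_mult less_imp_le)
qed

text \<open>The boundary value is 2 pi (B + i D) with \<open>D = A \<omega> + s * \<omega>\<close>,
  and \<open>P\<close> is the real part of (B + i D)^2 / zd. The sign \<open>s = -1\<close> belongs
  to the shifted graph, \<open>s = 1\<close> to its reflection.\<close>

lemma Rellich_identity:
  assumes s: "s = 1 \<or> s = -1"
  defines "P \<equiv> \<lambda>x. \<sigma> x * ((B x)\<^sup>2 - (A \<omega> x + s * \<omega> x)\<^sup>2 + 2 * f' x * B x * (A \<omega> x + s * \<omega> x))"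
  shows "integrable circ P" "(\<integral>x. P x \<partial>circ) = 0"
proof -
  define F where "F x = (G 0 x + of_real s * (2 * pi * \<i> * of_real (\<omega> x)))\<^sup>2 / zd x" for x
  have F0: "(\<integral>x. F x \<partial>circ) = 0"
    using s integral_G_sq integral_G_sq' by (auto simp: F_def)
  have Fi: "integrable circ F"
  proof (rule integrable_circ_bounded)
    show "F \<in> borel_measurable borel" unfolding F_def[abs_def] using G_measurable[of 0] by measurable
    fix x assume x: "x \<in> {-pi..pi}"
    have "cmod (G 0 x + of_real s * (2 * pi * \<i> * of_real (\<omega> x))) \<le> cmod (G 0 x) + cmod (of_real s * (2 * pi * \<i> * of_real (\<omega> x)))"
      by (rule norm_triangle_ineq)
    also have "\<dots> \<le> gC * integral\<^sup>L circ wk + 2 * pi * B\<^sub>\<omega>"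
      using norm_G_le[OF _ x, of 0] \<omega>_le[of x] s by (intro add_mono) (auto simp: norm_mult)
    finally have "(cmod (G 0 x + of_real s * (2 * pi * \<i> * of_real (\<omega> x))))\<^sup>2 / cmod (zd x) \<le> (gC * integral\<^sup>L circ wk + 2 * pi * B\<^sub>\<omega>)\<^sup>2 / 1"
      using norm_zd_ge[of x] by (intro frac_le power_mono) auto
    then show "cmod (F x) \<le> (gC * integral\<^sup>L circ wk + 2 * pi * B\<^sub>\<omega>)\<^sup>2"
      by (simp add: F_def norm_divide norm_power)
  qed
  have eq: "Re (F x) = (2 * pi)\<^sup>2 * P x" if x: "x \<in> {-pi..pi}" for x
  proof -
    define D where "D = A \<omega> x + s * \<omega> x"
    have "G 0 x + of_real s * (2 * pi * \<i> * of_real (\<omega> x)) = of_real (2 * pi) * Complex (B x) D"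
      using Im_G_0[OF x] by (simp add: complex_eq_iff B_def D_def algebra_simps)
    then have F: "F x = of_real ((2 * pi)\<^sup>2) * ((Complex (B x) D)\<^sup>2 / zd x)"
      by (simp add: F_def power_mult_distrib)
    have "(cmod (zd x))\<^sup>2 = 1 + (f' x)\<^sup>2" by (simp add: cmod_power2)
    then have "Re ((Complex (B x) D)\<^sup>2 / zd x) = Re ((Complex (B x) D)\<^sup>2 * cnj (zd x)) / (1 + (f' x)\<^sup>2)"
      by (subst complex_div_cnj) (simp only: Re_divide_of_real of_real_power[symmetric])
    also have "Re ((Complex (B x) D)\<^sup>2 * cnj (zd x)) = (B x)\<^sup>2 - D\<^sup>2 + 2 * f' x * B x * D"
      by (simp add: power2_eq_square algebra_simps)
    finally have "Re ((Complex (B x) D)\<^sup>2 / zd x) = P x" by (simp add: P_def \<sigma>_def D_def)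
    moreover have "Re (of_real r * v) = r * Re v" for r :: real and v by simp
    ultimately show ?thesis unfolding F by (simp only:)
  qed
  have PF: "P x = Re (F x) / (2 * pi)\<^sup>2" if "x \<in> {-pi..pi}" for x
    using eq[OF that] by simp
  have "integrable circ (\<lambda>x. Re (F x) / (2 * pi)\<^sup>2)" using integrable_Re[OF Fi] by simp
  then show "integrable circ P"
    by (rule Bochner_Integration.integrable_cong[THEN iffD1, rotated 2]) (auto simp: PF)
  have "(\<integral>x. P x \<partial>circ) = (\<integral>x. Re (F x) / (2 * pi)\<^sup>2 \<partial>circ)"
    by (rule Bochner_Integration.integral_cong) (auto simp: PF)
  then show "(\<integral>x. P x \<partial>circ) = 0" using integral_Re[OF Fi] F0 by simp
qed

text \<open>A chain through \<open>B\<close>: an affine combination of the identities bounds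
  \<open>B\<close> by \<open>g\<close>, and then each identity alone bounds
  \<open>a + s * \<omega>\<close> by \<open>B\<close>. Both links cost a factor
  \<open>2 * k\<close>, and the weight \<sigma> costs \<open>1 + m^2\<close> once.\<close>

lemma Rellich_estimate:
  assumes lam: "\<bar>lam\<bar> \<ge> 1"
  shows "qn \<omega> \<le> 4 * (1 + m\<^sup>2) * (1 + 2 * m\<^sup>2)\<^sup>2 * qn (\<lambda>x. lam * \<omega> x - A \<omega> x)"
proof -
  define a where "a = A \<omega>"
  define g where "g x = lam * \<omega> x - a x" for x
  define k where "k = 1 + 2 * m\<^sup>2"
  have k0: "k \<ge> 0" by (simp add: k_def)
  define P where "P s x = \<sigma> x * ((B x)\<^sup>2 - (a x + s * \<omega> x)\<^sup>2 + 2 * f' x * B x * (a x + s * \<omega> x))" for s x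
  have P: "integrable circ (P s)" "(\<integral>x. P s x \<partial>circ) = 0" if "s = 1 \<or> s = -1" for s
    using Rellich_identity[OF that] by (simp_all add: P_def[abs_def] a_def)
  have P1: "integrable circ (P 1)" "(\<integral>x. P 1 x \<partial>circ) = 0" and P2: "integrable circ (P (-1))" "(\<integral>x. P (-1) x \<partial>circ) = 0"
    using P[of 1] P[of "-1"] by simp_all
  have w: "\<omega> \<in> L2" and aL: "a \<in> L2" using \<omega>_L2h A_L2h[of \<omega>] by (auto simp: a_def L2h_def)
  have gL: "g \<in> L2" using L2_lincomb[OF w aL, of lam "-1"] by (simp add: g_def[abs_def])
  have DL: "(\<lambda>x. a x + s * \<omega> x) \<in> L2" for s using L2_lincomb[OF aL w, of 1 s] by simp
  define I where "I h = (\<integral>x. \<sigma> x * (h x)\<^sup>2 \<partial>circ)" for h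
  have Ii: "integrable circ (\<lambda>x. \<sigma> x * (h x)\<^sup>2)" if "h \<in> L2" for h
    by (rule \<sigma>_integrable[OF L2_sq_integrable[OF that]])
  have stepB: "I B \<le> 2 * k * I g"
  proof -
    \<comment> \<open>With these weights the linear terms average to \<open>- g\<close> and the
      squares to g^2 - (lam^2 - 1) \<omega>^2, so only a term of favourable sign still contains
      \<omega>.\<close>
    define U where "U x = (1/2 - lam/2) * P 1 x + (1/2 + lam/2) * P (-1) x" for x
    have Ui: "integrable circ U" and U0: "(\<integral>x. U x \<partial>circ) = 0"
      unfolding U_def[abs_def] using P1 P2 by simp_all
    have U: "U x = \<sigma> x * ((B x)\<^sup>2 + (lam\<^sup>2 - 1) * (\<omega> x)\<^sup>2 - (g x)\<^sup>2 - 2 * f' x * B x * g x)" for x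
      unfolding U_def P_def g_def by (simp add: field_simps power2_eq_square)
    have "\<sigma> x * (B x)\<^sup>2 \<le> 2 * U x + 2 * k * (\<sigma> x * (g x)\<^sup>2)" for x
    proof -
      have "2 * f' x * B x * g x \<le> (B x)\<^sup>2 / 2 + 2 * m\<^sup>2 * (g x)\<^sup>2"
        by (rule weighted_product_le[OF f'_le])
      moreover have "0 \<le> (lam\<^sup>2 - 1) * (\<omega> x)\<^sup>2"
        using lam abs_le_square_iff[of 1 lam] by simp
      ultimately have "(B x)\<^sup>2 \<le> 2 * ((B x)\<^sup>2 + (lam\<^sup>2 - 1) * (\<omega> x)\<^sup>2 - (g x)\<^sup>2 - 2 * f' x * B x * g x) + 2 * k * (g x)\<^sup>2"
        by (simp add: k_def distrib_right)
      then have "\<sigma> x * (B x)\<^sup>2 \<le> \<sigma> x * (2 * ((B x)\<^sup>2 + (lam\<^sup>2 - 1) * (\<omega> x)\<^sup>2 - (g x)\<^sup>2 - 2 * f' x * B x * g x) + 2 * k * (g x)\<^sup>2)"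
        using \<sigma>_pos[of x] by (intro mult_left_mono) auto
      then show ?thesis unfolding U by (simp only: distrib_left mult_ac)
    qed
    then have "I B \<le> (\<integral>x. 2 * U x + 2 * k * (\<sigma> x * (g x)\<^sup>2) \<partial>circ)"
      unfolding I_def using Ii[OF B_L2] Ii[OF gL] Ui by (intro integral_mono) auto
    also have "\<dots> = 2 * k * I g" using Ui U0 Ii[OF gL] by (simp add: I_def)
    finally show ?thesis .
  qed
  \<comment> \<open>Now \<open>B\<close> is the known quantity: the same inequality absorbs half of
    the square of \<open>a + s * \<omega>\<close> instead.\<close>
  have stepD: "I (\<lambda>x. a x + s * \<omega> x) \<le> 2 * k * I B" if s: "s = 1 \<or> s = -1" for s
  proof -
    have "\<sigma> x * (a x + s * \<omega> x)\<^sup>2 \<le> - 2 * P s x + 2 * k * (\<sigma> x * (B x)\<^sup>2)" for x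
    proof -
      define D where "D = a x + s * \<omega> x"
      have "2 * f' x * D * B x \<le> D\<^sup>2 / 2 + 2 * m\<^sup>2 * (B x)\<^sup>2" by (rule weighted_product_le[OF f'_le])
      then have "2 * f' x * B x * D \<le> D\<^sup>2 / 2 + 2 * m\<^sup>2 * (B x)\<^sup>2" by (simp only: mult_ac)
      then have "D\<^sup>2 \<le> - 2 * ((B x)\<^sup>2 - D\<^sup>2 + 2 * f' x * B x * D) + 2 * k * (B x)\<^sup>2"
        by (simp add: k_def distrib_right)
      then have "\<sigma> x * D\<^sup>2 \<le> \<sigma> x * (- 2 * ((B x)\<^sup>2 - D\<^sup>2 + 2 * f' x * B x * D) + 2 * k * (B x)\<^sup>2)"
        using \<sigma>_pos[of x] by (intro mult_left_mono) auto
      then show ?thesis unfolding P_def D_def[symmetric] by (simp only: distrib_left mult_ac)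
    qed
    then have "I (\<lambda>x. a x + s * \<omega> x) \<le> (\<integral>x. - 2 * P s x + 2 * k * (\<sigma> x * (B x)\<^sup>2) \<partial>circ)"
      unfolding I_def using Ii[OF B_L2] Ii[OF DL] P(1)[OF s] by (intro integral_mono) auto
    also have "\<dots> = 2 * k * I B" using P[OF s] Ii[OF B_L2] by (simp add: I_def)
    finally show ?thesis .
  qed
  \<comment> \<open>The parallelogram law with the square of \<open>a\<close> dropped.\<close>
  have "I \<omega> \<le> (\<integral>x. 1/2 * (\<sigma> x * (a x + 1 * \<omega> x)\<^sup>2) + 1/2 * (\<sigma> x * (a x + (-1) * \<omega> x)\<^sup>2) \<partial>circ)"
    unfolding I_def
  proof (rule integral_mono)
    show "integrable circ (\<lambda>x. 1/2 * (\<sigma> x * (a x + 1 * \<omega> x)\<^sup>2) + 1/2 * (\<sigma> x * (a x + (-1) * \<omega> x)\<^sup>2))"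
      by (intro Bochner_Integration.integrable_add integrable_mult_right Ii DL)
    fix x
    have "0 \<le> \<sigma> x * (a x)\<^sup>2" using \<sigma>_pos[of x] by simp
    then show "\<sigma> x * (\<omega> x)\<^sup>2 \<le> 1/2 * (\<sigma> x * (a x + 1 * \<omega> x)\<^sup>2) + 1/2 * (\<sigma> x * (a x + (-1) * \<omega> x)\<^sup>2)"
      by (simp add: power2_eq_square algebra_simps)
  qed (rule Ii[OF w])
  also have "\<dots> = 1/2 * I (\<lambda>x. a x + 1 * \<omega> x) + 1/2 * I (\<lambda>x. a x + (-1) * \<omega> x)"
    unfolding I_def
    by (subst Bochner_Integration.integral_add) (auto intro!: integrable_mult_right Ii DL[of 1, simplified] DL[of "-1", simplified])
  also have "\<dots> \<le> 2 * k * I B" using stepD[of 1] stepD[of "-1"] by simp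
  also have "\<dots> \<le> 2 * k * (2 * k * I g)" using stepB k0 by (intro mult_left_mono) auto
  finally have w4: "I \<omega> \<le> 4 * k\<^sup>2 * I g" by (simp add: power2_eq_square)
  have "qn \<omega> \<le> (\<integral>x. (1 + m\<^sup>2) * (\<sigma> x * (\<omega> x)\<^sup>2) \<partial>circ)"
    unfolding qn_def
  proof (rule integral_mono)
    show "(\<omega> x)\<^sup>2 \<le> (1 + m\<^sup>2) * (\<sigma> x * (\<omega> x)\<^sup>2)" for x
      using mult_right_mono[OF \<sigma>_ge[of x], of "(\<omega> x)\<^sup>2"] by (simp add: mult_ac)
  qed (use L2_sq_integrable[OF w] Ii[OF w] in auto)
  also have "\<dots> = (1 + m\<^sup>2) * I \<omega>" by (simp add: I_def)
  also have "\<dots> \<le> (1 + m\<^sup>2) * (4 * k\<^sup>2 * I g)" by (rule mult_left_mono[OF w4]) simp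
  also have "I g \<le> qn g"
    unfolding I_def qn_def
  proof (rule integral_mono[OF Ii[OF gL] L2_sq_integrable[OF gL]])
    show "\<sigma> x * (g x)\<^sup>2 \<le> (g x)\<^sup>2" for x using mult_right_mono[OF \<sigma>_le[of x], of "(g x)\<^sup>2"] by simp
  qed
  then have "(1 + m\<^sup>2) * (4 * k\<^sup>2 * I g) \<le> (1 + m\<^sup>2) * (4 * k\<^sup>2 * qn g)"
    by (intro mult_left_mono) auto
  finally show ?thesis by (simp only: k_def g_def[abs_def] a_def mult_ac)
qed

end

section \<open>From trigonometric polynomials to all mean-zero densities\<close>

lemma cos_sin_Lipschitz: "\<bar>cos x - cos y\<bar> \<le> \<bar>x - y\<bar>" "\<bar>sin x - sin y\<bar> \<le> \<bar>x - y\<bar>" for x y :: real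
  using field_differentiable_bound[of UNIV cos "\<lambda>x. - sin x" 1 x y] field_differentiable_bound[of UNIV sin cos 1 x y]
  by (auto intro!: derivative_eq_intros)

lemma tp_periodic: "tp I c (x + 2 * pi) = tp I c x"
proof -
  have "cis (of_int k * (x + 2 * pi)) = cis (of_int k * x)" for k
  proof -
    have "cis (of_int k * (x + 2 * pi)) = cis (of_int k * x) * cis (2 * pi * of_int k)"
      by (simp add: cis_mult algebra_simps)
    also have "cis (2 * pi * of_int k) = 1" by (rule cis_multiple_2pi) simp
    finally show ?thesis by simp
  qed
  then show ?thesis by (simp only: tp_def)
qed

text \<open>A difference bounded by \<open>2 * b\<close> and by \<open>L * |x - y|\<close> is
  bounded by the geometric mean of the two; this gives a Hoelder bound on the whole line, not only
  for nearby points.\<close>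

lemma tp_Holder: "\<exists>H. \<forall>x y. \<bar>Re (tp I c x) - Re (tp I c y)\<bar> \<le> H * sqrt \<bar>x - y\<bar>"
proof -
  define b where "b = (\<Sum>k\<in>I. cmod (c k))"
  define L where "L = (\<Sum>k\<in>I. cmod (c k) * (2 * \<bar>of_int k\<bar>))"
  have b0: "b \<ge> 0" "L \<ge> 0" by (auto simp: b_def L_def intro!: sum_nonneg)
  have "\<bar>Re (tp I c x) - Re (tp I c y)\<bar> \<le> sqrt (2 * b * L) * sqrt \<bar>x - y\<bar>" for x y
  proof -
    let ?d = "\<bar>Re (tp I c x) - Re (tp I c y)\<bar>"
    have d: "?d \<le> cmod (tp I c x - tp I c y)"
      using abs_Re_le_cmod[of "tp I c x - tp I c y"] by simp
    have "cmod (tp I c x - tp I c y) \<le> b + b"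
      using norm_triangle_ineq4[of "tp I c x" "tp I c y"] norm_tp_le[of I c x] norm_tp_le[of I c y] by (simp add: b_def)
    with d have 1: "?d \<le> 2 * b" by simp
    have "tp I c x - tp I c y = (\<Sum>k\<in>I. c k * (cis (of_int k * x) - cis (of_int k * y)))"
      by (simp add: tp_def sum_subtractf right_diff_distrib)
    also have "cmod \<dots> \<le> (\<Sum>k\<in>I. cmod (c k) * (2 * \<bar>of_int k\<bar>) * \<bar>x - y\<bar>)"
    proof (rule order_trans[OF norm_sum], rule sum_mono)
      fix k
      have "cmod (cis (of_int k * x) - cis (of_int k * y)) \<le> \<bar>cos (of_int k * x) - cos (of_int k * y)\<bar> + \<bar>sin (of_int k * x) - sin (of_int k * y)\<bar>"
        using cmod_le[of "cis (of_int k * x) - cis (of_int k * y)"] by simp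
      also have "\<dots> \<le> 2 * \<bar>of_int k * x - of_int k * y\<bar>"
        using add_mono[OF cos_sin_Lipschitz[of "of_int k * x" "of_int k * y"]] by simp
      also have "\<dots> = 2 * \<bar>of_int k\<bar> * \<bar>x - y\<bar>" by (simp add: abs_mult flip: right_diff_distrib)
      finally show "norm (c k * (cis (of_int k * x) - cis (of_int k * y))) \<le> cmod (c k) * (2 * \<bar>of_int k\<bar>) * \<bar>x - y\<bar>"
        unfolding norm_mult mult.assoc by (intro mult_left_mono) (auto simp: mult.assoc)
    qed
    also have "\<dots> = L * \<bar>x - y\<bar>" by (simp add: L_def sum_distrib_right)
    finally have 2: "?d \<le> L * \<bar>x - y\<bar>" using d by simp
    have "?d * ?d \<le> (2 * b) * (L * \<bar>x - y\<bar>)" using 1 2 b0 by (intro mult_mono) auto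
    then have "?d \<le> sqrt ((2 * b) * (L * \<bar>x - y\<bar>))" by (intro real_le_rsqrt) (simp add: power2_eq_square)
    then show ?thesis by (simp add: real_sqrt_mult mult_ac)
  qed
  then show ?thesis by blast
qed

text \<open>Four times the constant of \<open>Rellich_estimate\<close>; the extra 4 comes from two
  squared triangle inequalities in the density argument.\<close>

definition rellich_const :: "real \<Rightarrow> real" where
  "rellich_const m = 16 * (1 + m\<^sup>2) * (1 + 2 * m\<^sup>2)\<^sup>2"

lemma rellich_const_pos: "0 < rellich_const m"
proof -
  have "0 < 1 + m\<^sup>2" "0 < 1 + 2 * m\<^sup>2" by (simp_all add: add_pos_nonneg)
  then show ?thesis by (simp add: rellich_const_def)
qed

context periodic_graph
begin

interpretation A: L2h_operator A "(1 / (2 * pi))\<^sup>2 * (kC * integral\<^sup>L circ wk)\<^sup>2"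
  by (rule A_operator)

text \<open>\<open>Rellich_estimate\<close> applies to each partial Fourier sum. Boundedness of lam
  - A lets the approximation error vanish in the limit, so the operator norm, and with it
  \<open>H\<close>, leaves no trace in the constant.\<close>

lemma lower_bound:
  assumes w: "\<omega> \<in> L2h" and lam: "\<bar>lam\<bar> \<ge> 1"
  shows "qn \<omega> \<le> rellich_const m * qn (\<lambda>x. lam * \<omega> x - A \<omega> x)"
proof -
  define C where "C = 4 * (1 + m\<^sup>2) * (1 + 2 * m\<^sup>2)\<^sup>2"
  have C0: "C \<ge> 0" by (simp add: C_def)
  have C4: "rellich_const m = 4 * C" by (simp add: rellich_const_def C_def)
  have wL: "\<omega> \<in> L2" by (rule L2h_L2[OF w])
  define p where "p n x = Re (tp (band n) (fourier_coeff \<omega>) x)" for n x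
  have pV: "p n \<in> L2h" for n
  proof -
    have "fourier_coeff (p n) 0 = fourier_coeff \<omega> 0"
      unfolding p_def[abs_def] by (subst fourier_coeff_Re_tp[OF conj_symm_fourier_coeff uminus_band]) auto
    then have "(\<integral>x. p n x \<partial>circ) = 0" using w by (simp add: fourier_coeff_0 L2h_def)
    then show ?thesis using L2_Re_tp by (simp add: L2h_def p_def[abs_def])
  qed
  have pe: "qn (p n) \<le> C * qn (\<lambda>x. lam * p n x - A (p n) x)" for n
  proof -
    obtain Hw where Hw: "\<And>x y. \<bar>p n x - p n y\<bar> \<le> Hw * sqrt \<bar>x - y\<bar>"
      using tp_Holder unfolding p_def by blast
    interpret graph_density f f' m H "p n" Hw "\<Sum>k\<in>band n. cmod (fourier_coeff \<omega> k)"
    proof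
      show "p n \<in> borel_measurable borel" by (rule L2_measurable[OF L2h_L2[OF pV]])
      show "p n (x + 2 * pi) = p n x" for x by (simp only: p_def tp_periodic)
      show "\<bar>p n x\<bar> \<le> (\<Sum>k\<in>band n. cmod (fourier_coeff \<omega> k))" for x
        unfolding p_def by (rule order_trans[OF abs_Re_le_cmod norm_tp_le])
      show "(\<integral>x. p n x \<partial>circ) = 0" using pV by (simp add: L2h_def)
    qed (rule Hw)
    show ?thesis unfolding C_def by (rule Rellich_estimate[OF lam])
  qed
  let ?R = "\<lambda>u x. lam * u x + - A u x"
  interpret R: L2h_operator ?R "2 * lam\<^sup>2 + 2 * ((1 / (2 * pi))\<^sup>2 * (kC * integral\<^sup>L circ wk)\<^sup>2)"
    by (rule A.scaled_minus_operator)
  define K' where "K' = 2 * lam\<^sup>2 + 2 * ((1 / (2 * pi))\<^sup>2 * (kC * integral\<^sup>L circ wk)\<^sup>2)"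
  have "qn \<omega> \<le> 2 * qn (\<lambda>x. \<omega> x - p n x) + 2 * (C * (2 * (K' * qn (\<lambda>x. \<omega> x - p n x)) + 2 * qn (?R \<omega>)))" for n
  proof -
    have "qn (?R (p n)) \<le> 2 * qn (\<lambda>x. ?R (p n) x - ?R \<omega> x) + 2 * qn (?R \<omega>)"
      using qn_add[OF L2_diff[OF L2h_L2[OF R.T_L2h[OF pV[of n]]] L2h_L2[OF R.T_L2h[OF w]]] L2h_L2[OF R.T_L2h[OF w]]]
      by simp
    also have "qn (\<lambda>x. ?R (p n) x - ?R \<omega> x) = qn (\<lambda>x. ?R \<omega> x - ?R (p n) x)"
      using qn_uminus[of "\<lambda>x. ?R \<omega> x - ?R (p n) x"] by simp
    also have "\<dots> = qn (?R (\<lambda>x. \<omega> x - p n x))"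
    proof (rule qn_cong_AE)
      show "AE x in circ. ?R \<omega> x - ?R (p n) x = ?R (\<lambda>x. \<omega> x - p n x) x"
        using R.T_diff[OF w pV[of n]] by eventually_elim simp
    qed (intro L2_diff L2h_L2 R.T_L2h L2h_diff w pV)+
    also have "\<dots> \<le> K' * qn (\<lambda>x. \<omega> x - p n x)"
      unfolding K'_def by (rule R.T_bound) (intro L2h_diff w pV)
    finally have "qn (?R (p n)) \<le> 2 * (K' * qn (\<lambda>x. \<omega> x - p n x)) + 2 * qn (?R \<omega>)" by simp
    then have "C * qn (?R (p n)) \<le> C * (2 * (K' * qn (\<lambda>x. \<omega> x - p n x)) + 2 * qn (?R \<omega>))"
      using C0 by (rule mult_left_mono)
    moreover have "qn (p n) \<le> C * qn (?R (p n))" using pe[of n] by simp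
    moreover have "qn \<omega> \<le> 2 * qn (\<lambda>x. \<omega> x - p n x) + 2 * qn (p n)"
      using qn_add[OF L2_diff[OF wL L2h_L2[OF pV[of n]]] L2h_L2[OF pV[of n]]] by simp
    ultimately show ?thesis by linarith
  qed
  moreover have lim: "(\<lambda>n. qn (\<lambda>x. \<omega> x - p n x)) \<longlonglongrightarrow> 0"
    using fourier_series_converges[OF wL] by (simp add: p_def)
  have "(\<lambda>n. 2 * qn (\<lambda>x. \<omega> x - p n x) + 2 * (C * (2 * (K' * qn (\<lambda>x. \<omega> x - p n x)) + 2 * qn (?R \<omega>))))
      \<longlonglongrightarrow> 2 * 0 + 2 * (C * (2 * (K' * 0) + 2 * qn (?R \<omega>)))"
    by (intro tendsto_intros lim)
  ultimately have "qn \<omega> \<le> 2 * 0 + 2 * (C * (2 * (K' * 0) + 2 * qn (?R \<omega>)))"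
    by (intro tendsto_lowerbound[OF _ always_eventually]) auto
  then show ?thesis by (simp add: C4)
qed

lemma surjective:
  assumes lam: "\<bar>lam\<bar> \<ge> 1" and g: "g \<in> L2h"
  shows "\<exists>u\<in>L2h. AE x in circ. lam * u x - A u x = g x"
proof (cases "lam \<ge> 1")
  case True
  then show ?thesis by (intro A.surjective_by_continuity[OF lower_bound _ g]) auto
next
  case False
  \<comment> \<open>The continuity argument runs along the positive axis, so negative
    \<open>lam\<close> are handled by replacing \<open>A\<close> with its negative.\<close>
  then have l: "- lam \<ge> 1" using lam by auto
  have M: "L2h_operator (\<lambda>u x. - A u x) ((1 / (2 * pi))\<^sup>2 * (kC * integral\<^sup>L circ wk)\<^sup>2)"
  proof
    fix u assume u: "u \<in> L2h"
    show "(\<lambda>x. - A u x) \<in> L2h" by (rule L2h_uminus[OF A.T_L2h[OF u]])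
    show "qn (\<lambda>x. - A u x) \<le> (1 / (2 * pi))\<^sup>2 * (kC * integral\<^sup>L circ wk)\<^sup>2 * qn u"
      unfolding qn_uminus by (rule A.T_bound[OF u])
    fix v a b assume v: "v \<in> L2h"
    show "AE x in circ. - A (\<lambda>x. a * u x + b * v x) x = a * - A u x + b * - A v x"
      using A.T_lincomb[OF u v, of a b] by eventually_elim simp
  qed
  have low: "qn u \<le> rellich_const m * qn (\<lambda>x. mu * u x - - A u x)" if "mu \<ge> 1" "u \<in> L2h" for mu u
  proof -
    have "(\<lambda>x. - mu * u x - A u x) = (\<lambda>x. - (mu * u x - - A u x))" by auto
    then have "qn (\<lambda>x. - mu * u x - A u x) = qn (\<lambda>x. mu * u x - - A u x)" by (simp only: qn_uminus)
    then show ?thesis using lower_bound[OF that(2), of "- mu"] that(1) by simp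
  qed
  obtain u where u: "u \<in> L2h" "AE x in circ. - lam * u x - - A u x = - g x"
    using L2h_operator.surjective_by_continuity[OF M low l L2h_uminus[OF g]] by blast
  have "AE x in circ. lam * u x - A u x = g x" using u(2) by eventually_elim simp
  then show ?thesis using u(1) by blast
qed

end

section \<open>The resolvent on mean-zero $H^1$ functions\<close>

lemma continuous_AE_eq:
  fixes u v :: "real \<Rightarrow> real"
  assumes c: "continuous_on {-pi..pi} u" "continuous_on {-pi..pi} v" and ae: "AE x in circ. u x = v x"
    and x: "x \<in> {-pi..pi}"
  shows "u x = v x"
proof -
  have dc: "continuous_on {-pi..pi} (\<lambda>x. (u x - v x)\<^sup>2)" by (intro continuous_intros c)
  have si: "set_integrable lborel {-pi..pi} (\<lambda>x. (u x - v x)\<^sup>2)" by (rule borel_integrable_atLeastAtMost'[OF dc])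
  have "(\<integral>x. (u x - v x)\<^sup>2 \<partial>circ) = 0"
    by (rule integral_eq_zero_AE) (use ae in eventually_elim, simp)
  then have "integral {-pi..pi} (\<lambda>x. (u x - v x)\<^sup>2) = 0"
    using set_borel_integral_eq_integral(2)[OF si] by (simp add: integral_circ_eq)
  then show ?thesis using x dc by (subst (asm) integral_eq_0_iff) auto
qed

lemma integrable_circ_indicator:
  fixes h :: "real \<Rightarrow> real"
  assumes h: "integrable circ h" and A: "A \<in> sets borel"
  shows "integrable circ (\<lambda>u. indicator A u * h u)"
proof (rule Bochner_Integration.integrable_bound[OF h])
  show "(\<lambda>u. indicator A u * h u) \<in> borel_measurable circ"
    using A borel_measurable_integrable[OF h] by (intro borel_measurable_times measurable_circI[of "indicator A"]) auto
qed (auto simp: indicator_def)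

text \<open>Cauchy-Schwarz against the indicator of the interval, whose norm is sqrt (y - x); every
  Hoelder exponent 1/2 of the graph originates here.\<close>

lemma anti_diff_le:
  assumes h: "h \<in> L2" and xy: "-pi \<le> x" "x \<le> y" "y \<le> pi"
  shows "\<bar>anti h y - anti h x\<bar> \<le> sqrt (qn h) * sqrt (y - x)"
proof -
  have hi: "integrable circ h" by (rule L2_integrable[OF h])
  have i: "integrable circ (\<lambda>u. indicator {-pi..t} u * h u)" for t
    by (rule integrable_circ_indicator[OF hi]) simp
  have iL: "indicator {x..y} \<in> L2" by (rule L2_bounded[of _ 1]) (auto simp: indicator_def)
  have "anti h y - anti h x = (\<integral>u. indicator {-pi..y} u * h u - indicator {-pi..x} u * h u \<partial>circ)"
    using xy i by (simp add: anti_eq_circ)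
  also have "\<dots> = (\<integral>u. indicator {x..y} u * h u \<partial>circ)"
  proof (rule integral_cong_AE)
    show "AE u in circ. indicator {-pi..y} u * h u - indicator {-pi..x} u * h u = indicator {x..y} u * h u"
      using AE_circ_neq[of x] AE_space
      by eventually_elim (use xy in \<open>auto simp: indicator_def\<close>)
    show "(\<lambda>u. indicator {-pi..y} u * h u - indicator {-pi..x} u * h u) \<in> borel_measurable circ"
      by (rule borel_measurable_integrable[OF Bochner_Integration.integrable_diff[OF i i]])
    show "(\<lambda>u. indicator {x..y} u * h u) \<in> borel_measurable circ"
      using L2_mult_integrable[OF iL h] by simp
  qed
  finally have "(anti h y - anti h x)\<^sup>2 \<le> qn (indicator {x..y}) * qn h"
    using L2_Cauchy_Schwarz[OF iL h] by simp
  also have "qn (indicator {x..y}) = y - x"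
  proof -
    have "qn (indicator {x..y}) = (\<integral>u. indicator {x..y} u *\<^sub>R 1 \<partial>circ)"
      unfolding qn_def by (rule Bochner_Integration.integral_cong) (auto simp: indicator_def)
    also have "\<dots> = (LINT u:{x..y}|lborel. 1)"
      unfolding integral_circ_eq set_lebesgue_integral_def
      by (rule Bochner_Integration.integral_cong) (use xy in \<open>auto simp: indicator_def\<close>)
    also have "\<dots> = y - x" using xy by (simp add: set_lebesgue_integral_def)
    finally show ?thesis .
  qed
  finally have "(anti h y - anti h x)\<^sup>2 \<le> qn h * (y - x)" by (simp add: mult.commute)
  then have "\<bar>anti h y - anti h x\<bar> \<le> sqrt (qn h * (y - x))" by (intro real_le_rsqrt) simp
  then show ?thesis by (simp add: real_sqrt_mult)
qed

text \<open>An interval no longer than a period crosses at most one endpoint, and splitting there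
  gives the factor 2. Longer intervals are covered by the oscillation over one period, which is at
  most \<open>K * sqrt (2 * pi)\<close>.\<close>

lemma Holder_periodic_extension:
  fixes g :: "real \<Rightarrow> real"
  assumes per: "\<And>x. g (x + 2 * pi) = g x" and K: "0 \<le> K"
    and loc: "\<And>x y. -pi \<le> x \<Longrightarrow> x \<le> y \<Longrightarrow> y \<le> pi \<Longrightarrow> \<bar>g y - g x\<bar> \<le> K * sqrt (y - x)"
  shows "\<bar>g x - g y\<bar> \<le> 2 * K * sqrt \<bar>x - y\<bar>"
proof -
  have main: "\<bar>g y - g x\<bar> \<le> 2 * K * sqrt (y - x)" if xy: "x \<le> y" for x y
  proof (cases "y - x \<le> 2 * pi")
    case True
    define n where "n = \<lfloor>(x + pi) / (2 * pi)\<rfloor>"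
    have x': "x = pe x + 2 * pi * of_int n" by (simp add: pe_def n_def)
    define y' where "y' = y - 2 * pi * of_int n"
    have y': "y = y' + 2 * pi * of_int n" by (simp add: y'_def)
    have gy: "g y = g y'" unfolding y' by (rule periodic2pi_int[of g, OF per])
    have gx: "g x = g (pe x)" by (rule periodic_pe[of g, OF per, symmetric])
    have d: "y' - pe x = y - x" using x' y' by linarith
    have b: "-pi \<le> pe x" "pe x < pi" by (rule pe_bounds)+
    show ?thesis
    proof (cases "y' \<le> pi")
      case True
      have "\<bar>g y' - g (pe x)\<bar> \<le> K * sqrt (y' - pe x)" using loc[of "pe x" y'] b d xy True by simp
      also have "\<dots> \<le> 2 * K * sqrt (y' - pe x)" using K d xy by (intro mult_right_mono) auto
      finally show ?thesis using gx gy d by simp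
    next
      case False
      have gp: "g pi = g (-pi)" using per[of "-pi"] by simp
      have gy2: "g y' = g (y' - 2 * pi)" using per[of "y' - 2 * pi"] by simp
      have "\<bar>g pi - g (pe x)\<bar> \<le> K * sqrt (pi - pe x)" using loc[of "pe x" pi] b by simp
      also have "\<dots> \<le> K * sqrt (y - x)" using K d False by (intro mult_left_mono) auto
      finally have 1: "\<bar>g pi - g (pe x)\<bar> \<le> K * sqrt (y - x)" .
      have "\<bar>g (y' - 2 * pi) - g (-pi)\<bar> \<le> K * sqrt (y' - 2 * pi - (-pi))"
        by (rule loc) (use b d False \<open>y - x \<le> 2 * pi\<close> in auto)
      also have "\<dots> \<le> K * sqrt (y - x)" using K d b by (intro mult_left_mono) auto
      finally have 2: "\<bar>g (y' - 2 * pi) - g (-pi)\<bar> \<le> K * sqrt (y - x)" .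
      show ?thesis using 1 2 unfolding gx gy gy2 gp by simp
    qed
  next
    case False
    have b: "\<bar>g v - g u\<bar> \<le> K * sqrt (2 * pi)" for u v
    proof -
      have *: "\<bar>g v - g u\<bar> \<le> K * sqrt (2 * pi)" if "-pi \<le> u" "u \<le> v" "v \<le> pi" for u v
        by (rule order_trans[OF loc[OF that]]) (use K that in \<open>auto intro!: mult_left_mono\<close>)
      have "\<bar>g (pe v) - g (pe u)\<bar> \<le> K * sqrt (2 * pi)"
      proof (cases "pe u \<le> pe v")
        case True
        then show ?thesis using * pe_bounds[of u] pe_bounds[of v] by simp
      next
        case False
        then show ?thesis using *[of "pe v" "pe u"] pe_bounds[of u] pe_bounds[of v] by (simp add: abs_minus_commute)
      qed
      then show ?thesis by (simp add: periodic_pe[of g, OF per])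
    qed
    have "\<bar>g y - g x\<bar> \<le> K * sqrt (2 * pi)" by (rule b)
    also have "\<dots> \<le> 2 * K * sqrt (y - x)" using K False by (intro mult_mono) auto
    finally show ?thesis .
  qed
  show ?thesis
  proof (cases "x \<le> y")
    case True then show ?thesis using main[of x y] by (simp add: abs_minus_commute)
  next
    case False then show ?thesis using main[of y x] by simp
  qed
qed

text \<open>Membership in \<open>Hs 2\<close> survives changes on periodic Borel null sets while
  \<open>deriv f\<close> is pointwise; the C1 hypothesis selects the right representative. Then
  \<open>f'\<close> has a weak derivative \<open>h\<close> with \<open>sqrt (qn h) <= M\<close>. The
  2 in the Hoelder constant comes from the periodic extension, that in the slope bound from the
  constant of integration.\<close>

lemma Hs_2_periodic_graph:
  assumes f: "f \<in> Hs 2" and C1: "f C1_differentiable_on UNIV" and M: "Hs_norm 2 f \<le> M"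
  shows "periodic_graph f (deriv f) (2 * M * sqrt (2 * pi)) (2 * M)"
proof -
  obtain D where D: "\<And>x. (f has_vector_derivative D x) (at x)" "continuous_on UNIV D"
    using C1 unfolding C1_differentiable_on_def by auto
  have fd: "(f has_real_derivative D x) (at x)" for x
    using D(1) by (simp add: has_real_derivative_iff_has_vector_derivative)
  then have df: "deriv f = D" using DERIV_imp_deriv by blast
  have fper: "f (x + 2 * pi) = f x" for x using f by (simp add: Hs_def periodic2pi_def)
  have Dper: "D (x + 2 * pi) = D x" for x
  proof -
    have "((\<lambda>x. f (x + 2 * pi)) has_real_derivative D (x + 2 * pi)) (at x)"
      using DERIV_chain2[OF fd DERIV_add[OF DERIV_ident DERIV_const]] by simp
    then show ?thesis using fd[of x] DERIV_unique by (simp add: fper) blast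
  qed
  have Dc: "continuous_on S D" for S using D(2) continuous_on_subset by blast
  have fL: "f \<in> L2" using f by (simp add: Hs_def in_L2_iff)
  have Dm: "D \<in> borel_measurable borel" by (rule borel_measurable_continuous_onI[OF D(2)])
  obtain b where "\<forall>y\<in>D ` {-pi..pi}. norm y \<le> b"
    using compact_imp_bounded[OF compact_continuous_image[OF Dc compact_Icc[of "-pi" pi]]] unfolding bounded_iff by blast
  then have DL: "D \<in> L2" by (intro L2_bounded[OF Dm, of b]) auto
  have anti: "anti D x = f x - f (-pi)" if "x \<in> {-pi..pi}" for x
    unfolding anti_def
    by (rule set_integral_FTC[of _ _ "{}"])
       (use that D(1) in \<open>auto intro!: borel_integrable_atLeastAtMost' Dc continuous_at_imp_continuous_on has_vector_derivative_continuous\<close>)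
  have "(\<integral>x. D x \<partial>circ) = 0" using anti[of pi] fper[of "-pi"] by (simp add: anti_pi)
  then have wf: "weak_deriv f D"
    unfolding weak_deriv_def using fL DL anti
    by (auto simp: L2h_def intro!: exI[of _ "f (-pi)"] AE_I2)
  have fc: "fourier_coeff D k = \<i> * of_int k * fourier_coeff f k" for k by (rule fourier_coeff_weak_deriv[OF wf])
  have le2: "(of_int k)\<^sup>2 * (cmod (fourier_coeff D k))\<^sup>2 \<le> sob_weight 2 f k" for k
  proof -
    have "(of_int k)\<^sup>2 * (of_int k)\<^sup>2 \<le> (1 + (real_of_int k)\<^sup>2)\<^sup>2"
      by (simp add: power2_eq_square algebra_simps)
    then have "((of_int k)\<^sup>2 * (of_int k)\<^sup>2) * (cmod (fourier_coeff f k))\<^sup>2 \<le> (1 + (real_of_int k)\<^sup>2)\<^sup>2 * (cmod (fourier_coeff f k))\<^sup>2"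
      by (rule mult_right_mono) simp
    then show ?thesis by (simp add: sob_weight_def fc norm_mult power_mult_distrib mult.assoc)
  qed
  have ss: "sob_weight 2 f summable_on UNIV" using f by (simp add: Hs_def)
  have "(\<lambda>k. (of_int k)\<^sup>2 * (cmod (fourier_coeff D k))\<^sup>2) summable_on UNIV"
    by (rule summable_on_comparison_test[OF ss]) (use le2 in auto)
  then obtain h where h: "weak_deriv D h" using weak_deriv_exists[OF DL] by blast
  have hL: "h \<in> L2" using h by (simp add: weak_deriv_def L2h_def)
  obtain c where c: "AE x in circ. D x = c + anti h x" using h by (auto simp: weak_deriv_def)
  \<comment> \<open>Both sides are continuous, so equality almost everywhere becomes equality
    everywhere, as pointwise bounds require.\<close>
  have De: "D x = c + anti h x" if "x \<in> {-pi..pi}" for x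
    by (rule continuous_AE_eq[OF Dc _ c that]) (intro continuous_intros continuous_anti L2_integrable hL)
  have "qn h = 2 * pi * (\<Sum>\<^sub>\<infinity>k. (cmod (fourier_coeff h k))\<^sup>2)" by (rule Parseval[OF hL, symmetric])
  also have "\<dots> \<le> 2 * pi * (\<Sum>\<^sub>\<infinity>k. sob_weight 2 f k)"
  proof (rule mult_left_mono, rule infsum_mono)
    show "(cmod (fourier_coeff h k))\<^sup>2 \<le> sob_weight 2 f k" for k
      using le2[of k] by (simp add: fourier_coeff_weak_deriv[OF h] norm_mult power_mult_distrib)
  qed (use summable_fourier_coeff[OF hL] ss in auto)
  finally have "sqrt (qn h) \<le> Hs_norm 2 f" unfolding Hs_norm_def by simp
  then have K: "sqrt (qn h) \<le> M" using M by simp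
  have M0: "M \<ge> 0" using K real_sqrt_ge_zero[OF qn_nonneg[of h]] by linarith
  have loc: "\<bar>D y - D x\<bar> \<le> M * sqrt (y - x)" if "-pi \<le> x" "x \<le> y" "y \<le> pi" for x y
  proof -
    have "\<bar>D y - D x\<bar> = \<bar>anti h y - anti h x\<bar>" using De[of x] De[of y] that by simp
    also have "\<dots> \<le> sqrt (qn h) * sqrt (y - x)" by (rule anti_diff_le[OF hL that])
    also have "\<dots> \<le> M * sqrt (y - x)" using K that by (intro mult_right_mono) auto
    finally show ?thesis .
  qed
  have Hol: "\<bar>D x - D y\<bar> \<le> 2 * M * sqrt \<bar>x - y\<bar>" for x y
    by (rule Holder_periodic_extension[OF Dper M0 loc])
  have b1: "\<bar>anti h x\<bar> \<le> M * sqrt (2 * pi)" if "x \<in> {-pi..pi}" for x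
  proof -
    have "\<bar>anti h x\<bar> \<le> sqrt (qn h) * sqrt (x - (-pi))" using anti_diff_le[OF hL, of "-pi" x] that by simp
    also have "\<dots> \<le> M * sqrt (2 * pi)" using K M0 that by (intro mult_mono) auto
    finally show ?thesis .
  qed
  \<comment> \<open>Periodicity of \<open>f\<close> makes its derivative mean-zero, which pins down
    the constant of integration and so bounds it by the size of \<open>anti h\<close>.\<close>
  have "2 * pi * c = - (\<integral>x. anti h x \<partial>circ)"
  proof -
    have "(\<integral>x. D x \<partial>circ) = (\<integral>x. c + anti h x \<partial>circ)"
      by (rule Bochner_Integration.integral_cong) (auto simp: De)
    then show ?thesis using \<open>(\<integral>x. D x \<partial>circ) = 0\<close> integrable_anti[OF L2_integrable[OF hL]] by simp
  qed
  moreover have "\<bar>\<integral>x. anti h x \<partial>circ\<bar> \<le> 2 * pi * (M * sqrt (2 * pi))"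
  proof -
    have "\<bar>\<integral>x. anti h x \<partial>circ\<bar> \<le> (\<integral>x. \<bar>anti h x\<bar> \<partial>circ)" by (rule integral_abs_bound)
    also have "\<dots> \<le> (\<integral>x. M * sqrt (2 * pi) \<partial>circ)"
      by (rule integral_mono) (use integrable_anti[OF L2_integrable[OF hL]] b1 in auto)
    finally show ?thesis by simp
  qed
  ultimately have "\<bar>2 * pi * c\<bar> \<le> 2 * pi * (M * sqrt (2 * pi))" by (simp only: abs_minus_cancel)
  then have "2 * pi * \<bar>c\<bar> \<le> 2 * pi * (M * sqrt (2 * pi))" by (simp only: abs_mult) simp
  then have cb: "\<bar>c\<bar> \<le> M * sqrt (2 * pi)" by simp
  have Db: "\<bar>D x\<bar> \<le> 2 * M * sqrt (2 * pi)" for x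
  proof -
    have p: "pe x \<in> {-pi..pi}" using pe_bounds[of x] by auto
    have "D x = c + anti h (pe x)" using De[OF p] periodic_pe[of D, OF Dper] by simp
    then show ?thesis using cb b1[OF p] by simp
  qed
  show ?thesis unfolding df
    by unfold_locales (use fper fd Db Hol in auto)
qed

section \<open>The resolvent equation at the level of derivatives\<close>

lemma anti_lincomb:
  assumes "integrable circ g" "integrable circ h" "x \<le> pi"
  shows "anti (\<lambda>x. a * g x + b * h x) x = a * anti g x + b * anti h x"
proof -
  have i: "integrable circ (\<lambda>u. indicator {-pi..x} u * v u)" if "integrable circ v" for v :: "real \<Rightarrow> real"
    by (rule integrable_circ_indicator[OF that]) simp
  have "anti (\<lambda>x. a * g x + b * h x) x = (\<integral>u. a * (indicator {-pi..x} u * g u) + b * (indicator {-pi..x} u * h u) \<partial>circ)"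
    unfolding anti_eq_circ[OF assms(3)] by (rule Bochner_Integration.integral_cong) (auto simp: algebra_simps)
  also have "\<dots> = a * anti g x + b * anti h x"
    using i[OF assms(1)] i[OF assms(2)] by (simp add: anti_eq_circ[OF assms(3)])
  finally show ?thesis .
qed

text \<open>The free constant \<open>c\<close> absorbs the mean removed by the projection.\<close>

lemma weak_deriv_lincomb:
  assumes w: "weak_deriv \<xi> g" and v: "weak_deriv \<eta> h"
  shows "weak_deriv (\<lambda>x. a * \<xi> x + b * \<eta> x + c) (\<lambda>x. a * g x + b * h x)"
proof -
  obtain c1 where c1: "AE x in circ. \<xi> x = c1 + anti g x" using w by (auto simp: weak_deriv_def)
  obtain c2 where c2: "AE x in circ. \<eta> x = c2 + anti h x" using v by (auto simp: weak_deriv_def)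
  have gi: "integrable circ g" "integrable circ h" using w v by (auto simp: weak_deriv_def L2h_def L2_integrable)
  have "AE x in circ. a * \<xi> x + b * \<eta> x + c = (a * c1 + b * c2 + c) + anti (\<lambda>x. a * g x + b * h x) x"
    using c1 c2 AE_space
  proof eventually_elim
    case (elim x)
    then show ?case using anti_lincomb[OF gi, of x a b] by (simp add: algebra_simps)
  qed
  moreover have "(\<lambda>x. a * \<xi> x + b * \<eta> x + c) \<in> L2"
    using L2_add[OF L2_lincomb[of \<xi> \<eta> a b] L2_const[of c]] w v by (simp add: weak_deriv_def)
  moreover have "(\<lambda>x. a * g x + b * h x) \<in> L2h" using w v by (auto simp: weak_deriv_def intro: L2h_lincomb)
  ultimately show ?thesis by (auto simp: weak_deriv_def)
qed

lemma Hhat_1_weak_deriv: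
  assumes "\<xi> \<in> Hhat 1" obtains g where "weak_deriv \<xi> g" "periodic2pi \<xi>" "(\<integral>x. \<xi> x \<partial>circ) = 0"
  using assms Hs_1_weak_deriv[of \<xi>] by (auto simp: in_Hhat_iff Hs_def)

lemma weak_deriv_Hhat_1:
  "weak_deriv \<xi> g \<Longrightarrow> periodic2pi \<xi> \<Longrightarrow> (\<integral>x. \<xi> x \<partial>circ) = 0 \<Longrightarrow> \<xi> \<in> Hhat 1"
  using weak_deriv_Hs_1 in_Hhat_iff by blast

context periodic_graph
begin

text \<open>The projection only shifts by a constant, invisible to the derivative, and the potential
  differentiates to \<open>- A g\<close>; hence the plus sign. As the mean of the potential is
  removed, the mean of \<xi> is merely scaled.\<close>

lemma resolv_op_weak_deriv:
  assumes w: "weak_deriv \<xi> g" and p: "periodic2pi \<xi>"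
  shows "weak_deriv (resolv_op lam f \<xi>) (\<lambda>x. lam * g x + A g x)"
    and "periodic2pi (resolv_op lam f \<xi>)"
    and "(\<integral>x. resolv_op lam f \<xi> x \<partial>circ) = lam * (\<integral>x. \<xi> x \<partial>circ)"
proof -
  define c where "c = (1 / (2 * pi)) * (\<integral>x. Astar f \<xi> x \<partial>circ)"
  have eq: "resolv_op lam f \<xi> = (\<lambda>x. lam * \<xi> x + (-1) * Astar f \<xi> x + c)"
    by (simp add: resolv_op_def Pproj_def c_def integral_circ_eq fun_eq_iff)
  note As = Astar_weak_deriv[OF w p]
  show "weak_deriv (resolv_op lam f \<xi>) (\<lambda>x. lam * g x + A g x)"
    using weak_deriv_lincomb[OF w As(1), of lam "-1" c] by (simp add: eq)
  show "periodic2pi (resolv_op lam f \<xi>)" using p As(2) by (simp add: eq periodic2pi_def)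
  have "integrable circ \<xi>" "integrable circ (Astar f \<xi>)"
    using w As(1) by (auto simp: weak_deriv_def L2_integrable)
  then show "(\<integral>x. resolv_op lam f \<xi> x \<partial>circ) = lam * (\<integral>x. \<xi> x \<partial>circ)"
    by (simp add: eq c_def)
qed

text \<open>Up to sign, lam + A is (-lam) - A, so \<open>lower_bound\<close> is used at
  \<open>- lam\<close>; this is harmless because only |lam| enters. The 2 under the root is
  Poincare's inequality.\<close>

lemma resolv_op_estimate:
  assumes xi: "\<xi> \<in> Hhat 1" and lam: "\<bar>lam\<bar> \<ge> 1"
  shows "Hs_norm 1 \<xi> \<le> sqrt (2 * rellich_const m) * Hs_norm 1 (resolv_op lam f \<xi>)"
proof -
  obtain g where g: "weak_deriv \<xi> g" "periodic2pi \<xi>" "(\<integral>x. \<xi> x \<partial>circ) = 0"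
    using Hhat_1_weak_deriv[OF xi] by blast
  note r = resolv_op_weak_deriv[OF g(1,2), of lam]
  have gh: "g \<in> L2h" using g by (simp add: weak_deriv_def)
  have "(Hs_norm 1 \<xi>)\<^sup>2 \<le> 2 * qn g" using weak_deriv_norm(2)[OF g(1)] Poincare[OF g(1,3)] by simp
  also have "qn g \<le> rellich_const m * qn (\<lambda>x. lam * g x + A g x)"
  proof -
    have "(\<lambda>x. - lam * g x - A g x) = (\<lambda>x. - (lam * g x + A g x))" by auto
    then have "qn (\<lambda>x. - lam * g x - A g x) = qn (\<lambda>x. lam * g x + A g x)" by (simp only: qn_uminus)
    then show ?thesis using lower_bound[OF gh, of "- lam"] lam by simp
  qed
  also have "qn (\<lambda>x. lam * g x + A g x) \<le> (Hs_norm 1 (resolv_op lam f \<xi>))\<^sup>2"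
    using weak_deriv_norm(2)[OF r(1)] by simp
  finally have "(Hs_norm 1 \<xi>)\<^sup>2 \<le> 2 * (rellich_const m * (Hs_norm 1 (resolv_op lam f \<xi>))\<^sup>2)"
    using rellich_const_pos[of m] by (simp add: mult_left_mono)
  also have "\<dots> = (sqrt (2 * rellich_const m) * Hs_norm 1 (resolv_op lam f \<xi>))\<^sup>2"
    using rellich_const_pos[of m] by (simp add: power_mult_distrib)
  finally show ?thesis by (rule power2_le_imp_le) (simp add: rellich_const_pos less_imp_le)
qed

lemma resolv_op_Hhat:
  assumes xi: "\<xi> \<in> Hhat 1" shows "resolv_op lam f \<xi> \<in> Hhat 1"
proof -
  obtain g where g: "weak_deriv \<xi> g" "periodic2pi \<xi>" "(\<integral>x. \<xi> x \<partial>circ) = 0"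
    using Hhat_1_weak_deriv[OF xi] by blast
  note R = resolv_op_weak_deriv[OF g(1,2), of lam]
  show ?thesis by (rule weak_deriv_Hhat_1[OF R(1,2)]) (simp add: R(3) g(3))
qed

text \<open>The norm sees only almost-everywhere classes, so the estimate gives \<xi> = 0 on the
  circle; periodicity spreads this over the line.\<close>

lemma resolv_op_injective:
  assumes xi: "\<xi> \<in> Hhat 1" and lam: "\<bar>lam\<bar> \<ge> 1" and z: "AE x in lborel. resolv_op lam f \<xi> x = 0"
  shows "AE x in lborel. \<xi> x = 0"
proof -
  obtain g where g: "weak_deriv \<xi> g" "periodic2pi \<xi>" "(\<integral>x. \<xi> x \<partial>circ) = 0"
    using Hhat_1_weak_deriv[OF xi] by blast
  have \<xi>L: "\<xi> \<in> L2" using g by (simp add: weak_deriv_def)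
  have rL: "resolv_op lam f \<xi> \<in> L2" using resolv_op_weak_deriv(1)[OF g(1,2), of lam] by (simp add: weak_deriv_def)
  have "AE x in circ. resolv_op lam f \<xi> x = 0" using z by (auto simp: AE_circ_iff elim: eventually_mono)
  then have "fourier_coeff (resolv_op lam f \<xi>) k = 0" for k
    using fourier_coeff_cong_AE[OF L2_integrable[OF rL], of "\<lambda>x. 0"] by (simp add: fourier_coeff_const cong: if_cong)
  then have "Hs_norm 1 (resolv_op lam f \<xi>) = 0" by (simp add: Hs_norm_def sob_weight_def)
  then have "Hs_norm 1 \<xi> \<le> 0" using resolv_op_estimate[OF xi lam] by simp
  then have "Hs_norm 1 \<xi> = 0" by (rule antisym[OF _ Hs_norm_nonneg])
  then have "qn \<xi> + qn g = 0" using weak_deriv_norm(2)[OF g(1)] by simp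
  then have "qn \<xi> = 0" using qn_nonneg[of \<xi>] qn_nonneg[of g] by linarith
  then have "AE x in circ. \<xi> x = 0" by (simp add: qn_eq_0_iff[OF \<xi>L])
  then show ?thesis using g(2) by (intro AE_periodic L2_measurable[OF \<xi>L]) (auto simp: periodic2pi_def)
qed

text \<open>The differentiated equation is solved in \<open>L2h\<close> and the solution integrated
  to a mean-zero periodic \<xi>. The defect \<open>d\<close> then has zero derivative and zero mean,
  so Poincare's inequality forces it to vanish.\<close>

lemma resolv_op_surjective:
  assumes eta: "\<eta> \<in> Hhat 1" and lam: "\<bar>lam\<bar> \<ge> 1"
  shows "\<exists>\<xi>\<in>Hhat 1. AE x in lborel. resolv_op lam f \<xi> x = \<eta> x"
proof -
  obtain r where r: "weak_deriv \<eta> r" "periodic2pi \<eta>" "(\<integral>x. \<eta> x \<partial>circ) = 0"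
    using Hhat_1_weak_deriv[OF eta] by blast
  have rh: "r \<in> L2h" using r by (simp add: weak_deriv_def)
  \<comment> \<open>The equation \<open>lam * u + A u = r\<close>, multiplied by -1 to fit
    \<open>surjective\<close> at \<open>- lam\<close>.\<close>
  obtain u where u: "u \<in> L2h" "AE x in circ. - lam * u x - A u x = - r x"
    using surjective[of "- lam", OF _ L2h_uminus[OF rh]] lam by auto
  have uL: "u \<in> L2" and ui: "integrable circ u" using u(1) by (auto simp: L2h_def L2_integrable)
  have ac: "continuous_on {-pi..pi} (anti u)" by (rule continuous_anti[OF ui])
  have am: "(\<lambda>x. indicator {-pi..pi} x *\<^sub>R anti u x) \<in> borel_measurable borel"
    by (rule borel_measurable_continuous_on_indicator[OF _ ac]) simp
  \<comment> \<open>Continuity of \<open>anti u\<close> is known only on [-pi, pi], which contains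
    all values of \<open>pe\<close>; the inserted indicator makes the composition Borel on the
    line.\<close>
  have anti_pe: "(\<lambda>x. anti u (pe x)) = (\<lambda>x. indicator {-pi..pi} (pe x) *\<^sub>R anti u (pe x))"
    using pe_bounds by (auto simp: fun_eq_iff indicator_def less_imp_le)
  have apm: "(\<lambda>x. anti u (pe x)) \<in> borel_measurable borel"
    unfolding anti_pe by (rule measurable_compose[OF pe_measurable am])
  define c where "c = - (1 / (2 * pi)) * (\<integral>x. anti u (pe x) \<partial>circ)"
  define \<xi> where "\<xi> x = c + anti u (pe x)" for x
  obtain b where b: "\<And>x. x \<in> {-pi..pi} \<Longrightarrow> \<bar>anti u x\<bar> \<le> b" using anti_bounded[OF ui] by blast
  have apb: "\<bar>anti u (pe x)\<bar> \<le> b" for x using b[of "pe x"] pe_bounds[of x] by simp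
  have \<xi>L: "\<xi> \<in> L2"
  proof (rule L2_bounded)
    show "\<xi> \<in> borel_measurable borel" unfolding \<xi>_def[abs_def] using apm by simp
    show "\<bar>\<xi> x\<bar> \<le> \<bar>c\<bar> + b" for x using apb[of x] by (simp add: \<xi>_def)
  qed
  have "AE x in circ. \<xi> x = c + anti u x"
    using AE_circ_neq[of pi] AE_space by eventually_elim (simp add: \<xi>_def pe_eq)
  then have w: "weak_deriv \<xi> u" using \<xi>L u(1) by (auto simp: weak_deriv_def)
  have p: "periodic2pi \<xi>" by (simp add: periodic2pi_def \<xi>_def pe_periodic)
  have m0: "(\<integral>x. \<xi> x \<partial>circ) = 0"
    using integrable_circ_bounded[OF apm, of b] apb by (simp add: \<xi>_def[abs_def] c_def)
  note R = resolv_op_weak_deriv[OF w p, of lam]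
  define d where "d x = 1 * resolv_op lam f \<xi> x + (-1) * \<eta> x + 0" for x
  have dw: "weak_deriv d (\<lambda>x. 1 * (lam * u x + A u x) + (-1) * r x)"
    unfolding d_def[abs_def] by (rule weak_deriv_lincomb[OF R(1) r(1)])
  have "AE x in circ. 1 * (lam * u x + A u x) + (-1) * r x = 0" using u(2) by eventually_elim simp
  then have "qn (\<lambda>x. 1 * (lam * u x + A u x) + (-1) * r x) = 0"
    using dw by (subst qn_eq_0_iff) (auto simp: weak_deriv_def L2h_def)
  moreover have dL: "d \<in> L2" using dw by (simp add: weak_deriv_def)
  have "(\<integral>x. d x \<partial>circ) = 0"
  proof -
    have "integrable circ (resolv_op lam f \<xi>)" "integrable circ \<eta>"
      using R(1) r(1) by (auto simp: weak_deriv_def L2_integrable)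
    then show ?thesis using R(3) m0 r(3) by (simp add: d_def)
  qed
  ultimately have "qn d = 0" using Poincare[OF dw] qn_nonneg[of d] by simp
  then have "AE x in circ. d x = 0" by (simp add: qn_eq_0_iff[OF dL])
  moreover have "d (x + 2 * pi) = d x" for x using R(2) r(2) by (simp add: d_def periodic2pi_def)
  ultimately have "AE x in lborel. d x = 0" by (intro AE_periodic L2_measurable[OF dL])
  then have "AE x in lborel. resolv_op lam f \<xi> x = \<eta> x" by eventually_elim (simp add: d_def)
  moreover have "\<xi> \<in> Hhat 1" by (rule weak_deriv_Hhat_1[OF w p m0])
  ultimately show ?thesis by blast
qed

end

text \<open>Resolvent membership is expressed by invariance of \<open>Hhat 1\<close>, injectivity
  and surjectivity, with functions identified almost everywhere; the bound on the inverse is the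
  first conjunct for any \<open>M\<close> above the norm of \<open>f\<close>. The C1 condition picks
  the classical representative of an H^2 function.\<close>

theorem theorem3p6:
  fixes M :: real
  assumes "M > 0"
  shows "(\<exists>C>0. \<forall>lam \<xi> f.
            \<bar>lam\<bar> \<ge> 1 \<longrightarrow> \<xi> \<in> Hhat 1 \<longrightarrow>
            f \<in> Hs 2 \<longrightarrow> f C1_differentiable_on UNIV \<longrightarrow> Hs_norm 2 f \<le> M \<longrightarrow>
            Hs_norm 1 \<xi> \<le> C * Hs_norm 1 (resolv_op lam f \<xi>))
       \<and> (\<forall>f lam. f \<in> Hs 2 \<longrightarrow> f C1_differentiable_on UNIV \<longrightarrow> \<bar>lam\<bar> \<ge> 1 \<longrightarrow>
            (\<forall>\<xi>\<in>Hhat 1. resolv_op lam f \<xi> \<in> Hhat 1)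
          \<and> (\<forall>\<xi>\<in>Hhat 1. (AE x in lborel. resolv_op lam f \<xi> x = 0) \<longrightarrow>
                 (AE x in lborel. \<xi> x = 0))
          \<and> (\<forall>\<eta>\<in>Hhat 1. \<exists>\<xi>\<in>Hhat 1. AE x in lborel. resolv_op lam f \<xi> x = \<eta> x))"
proof (intro conjI allI impI)
  show "\<exists>C>0. \<forall>lam \<xi> f.
            \<bar>lam\<bar> \<ge> 1 \<longrightarrow> \<xi> \<in> Hhat 1 \<longrightarrow>
            f \<in> Hs 2 \<longrightarrow> f C1_differentiable_on UNIV \<longrightarrow> Hs_norm 2 f \<le> M \<longrightarrow>
            Hs_norm 1 \<xi> \<le> C * Hs_norm 1 (resolv_op lam f \<xi>)"
  proof (intro exI conjI allI impI)
    \<comment> \<open>The argument of \<open>rellich_const\<close> is the bound for the slope that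
      \<open>Hs_2_periodic_graph\<close> derives from \<open>M\<close>.\<close>
    show "0 < sqrt (2 * rellich_const (2 * M * sqrt (2 * pi)))" by (simp add: rellich_const_pos)
    fix lam :: real and \<xi> f
    assume "\<bar>lam\<bar> \<ge> 1" "\<xi> \<in> Hhat 1" "f \<in> Hs 2" "f C1_differentiable_on UNIV" "Hs_norm 2 f \<le> M"
    then show "Hs_norm 1 \<xi> \<le> sqrt (2 * rellich_const (2 * M * sqrt (2 * pi))) * Hs_norm 1 (resolv_op lam f \<xi>)"
      using periodic_graph.resolv_op_estimate[OF Hs_2_periodic_graph] by blast
  qed
next
  fix f and lam :: real
  assume f: "f \<in> Hs 2" "f C1_differentiable_on UNIV" and lam: "\<bar>lam\<bar> \<ge> 1"
  \<comment> \<open>This part concerns a single \<open>f\<close>, so its own norm takes the place of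
    \<open>M\<close>.\<close>
  interpret periodic_graph f "deriv f" "2 * Hs_norm 2 f * sqrt (2 * pi)" "2 * Hs_norm 2 f"
    by (rule Hs_2_periodic_graph[OF f]) simp
  show "\<forall>\<xi>\<in>Hhat 1. resolv_op lam f \<xi> \<in> Hhat 1" using resolv_op_Hhat by blast
  show "\<forall>\<xi>\<in>Hhat 1. (AE x in lborel. resolv_op lam f \<xi> x = 0) \<longrightarrow> (AE x in lborel. \<xi> x = 0)"
    using resolv_op_injective lam by blast
  show "\<forall>\<eta>\<in>Hhat 1. \<exists>\<xi>\<in>Hhat 1. AE x in lborel. resolv_op lam f \<xi> x = \<eta> x"
    using resolv_op_surjective lam by blast
qed

end
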